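(* Let $G$ be a finite simple graph. Then the following conditions are equivalent: (1) $G$ is edgewise strongly shellable (ESS). (2) The edge ideal $I(G)$ has linear quotients. (3) The edge ideal $I(G)$ has a linear resolution. (4) The complement graph $\overline{G}$ is chordal. (5) The complement graph $\overline{G}$ has a perfect elimination ordering.
   Context: A finite simple graph $G$ has a finite vertex set $\mathcal{V}(G)$ and an edge set $\mathcal{E}(G)$ consisting of two-element subsets of $\mathcal{V}(G)$. The complement graph $\overline{G}$ has the same vertices, and distinct $u,v$ satisfy $\{u,v\}\in\mathcal{E}(\overline{G})$ if and only if $\{u,v\}\notin\mathcal{E}(G)$. $G$ is edgewise strongly shellable (ESS) if the simplicial complex whose facets are the edges of $G$ is strongly shellable, i.e. the edges can be arranged in a linear order $E_1,\dots,E_t$ such that for each pair $i<j$ there exists $k<j$ with $|E_j\setminus E_k|=1$ and $E_i\cap E_j\subseteq E_k\subseteq E_i\cup E_j$. With $\mathcal{V}(G)=\{1,\dots,n\}$, the edge ideal is $I(G)=\langle x_ix_j:\{i,j\}\in\mathcal{E}(G)\rangle\subset S=\mathbb{K}[x_1,\dots,x_n]$ for some base field $\mathbb{K}$. A graded proper ideal $I\subset S$ has linear quotients if there exists a system of homogeneous generators $f_1,f_2,\dots,f_m$ of $I$ such that the colon ideal $\langle f_1,\dots,f_{i-1}\rangle:f_i$ is generated by linear forms for all $i$. The ideal $I(G)$, generated in degree 2, has a linear resolution if its minimal graded free resolution over $S$ is $2$-linear. A graph is chordal if each of its cycles of length $>3$ has a chord, i.e. an edge of the graph joining two vertices of the cycle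 that is not an edge of the cycle. A clique of a graph is a set of vertices any two distinct elements of which are adjacent. A perfect elimination ordering of a graph $H$ is an ordering $i_1,\dots,i_n$ of its vertices such that for each $j$ with $1\le j<n$ the set $\{i_k\in\mathcal{V}(H): j<k\le n,\ \{i_k,i_j\}\in\mathcal{E}(H)\}$ is a clique of $H$.
   Formalization: In the definition of linear quotients the system of homogeneous generators is required to be minimal; with redundant generators the claim fails, e.g. (ab, cd) via abc, acd, ab, cd, although the complement is a 4-cycle. *)

theory Defs
  imports
    "HOL-Algebra.Ideal"
    "HOL-Library.Poly_Mapping"
    "Jordan_Normal_Form.Matrix"
begin

section \<open>Graphs\<close>

definition simple_graph :: "'a set \<Rightarrow> 'a set set \<Rightarrow> bool" where
  "simple_graph V E \<longleftrightarrow> finite V \<and> (\<forall>e\<in>E. e \<subseteq> V \<and> card e = 2)"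

definition complement_edges :: "'a set \<Rightarrow> 'a set set \<Rightarrow> 'a set set" where
  "complement_edges V E = {{u, v} | u v. u \<in> V \<and> v \<in> V \<and> u \<noteq> v \<and> {u, v} \<notin> E}"

definition strongly_shellable :: "'a set set \<Rightarrow> bool" where
  "strongly_shellable \<F> \<longleftrightarrow>
     (\<exists>Fs. distinct Fs \<and> set Fs = \<F> \<and>
       (\<forall>j<length Fs. \<forall>i<j. \<exists>k<j.
          card (Fs ! j - Fs ! k) = 1 \<and>
          Fs ! i \<inter> Fs ! j \<subseteq> Fs ! k \<and> Fs ! k \<subseteq> Fs ! i \<union> Fs ! j))"

definition edgewise_strongly_shellable :: "'a set \<Rightarrow> 'a set set \<Rightarrow> bool" where
  "edgewise_strongly_shellable V E \<longleftrightarrow> strongly_shellable E"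

definition cycle_edges :: "'a list \<Rightarrow> 'a set set" where
  "cycle_edges cs = {{cs ! i, cs ! (Suc i mod length cs)} | i. i < length cs}"

definition graph_cycle :: "'a set \<Rightarrow> 'a set set \<Rightarrow> 'a list \<Rightarrow> bool" where
  "graph_cycle V E cs \<longleftrightarrow>
     3 \<le> length cs \<and> distinct cs \<and> set cs \<subseteq> V \<and> cycle_edges cs \<subseteq> E"

definition chordal :: "'a set \<Rightarrow> 'a set set \<Rightarrow> bool" where
  "chordal V E \<longleftrightarrow>
     (\<forall>cs. graph_cycle V E cs \<and> length cs > 3 \<longrightarrow>
       (\<exists>u\<in>set cs. \<exists>v\<in>set cs. {u, v} \<in> E \<and> {u, v} \<notin> cycle_edges cs))"

definition clique :: "'a set \<Rightarrow> 'a set set \<Rightarrow> 'a set \<Rightarrow> bool" where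
  "clique V E U \<longleftrightarrow> U \<subseteq> V \<and> (\<forall>u\<in>U. \<forall>v\<in>U. u \<noteq> v \<longrightarrow> {u, v} \<in> E)"

(* Positions are counted from 0, so the condition 1 <= j < n becomes Suc j < length vs. *)
definition perfect_elimination_ordering :: "'a set \<Rightarrow> 'a set set \<Rightarrow> 'a list \<Rightarrow> bool" where
  "perfect_elimination_ordering V E vs \<longleftrightarrow>
     distinct vs \<and> set vs = V \<and>
     (\<forall>j. Suc j < length vs \<longrightarrow>
        clique V E {vs ! k | k. j < k \<and> k < length vs \<and> {vs ! k, vs ! j} \<in> E})"

section \<open>Polynomial rings and ideals\<close>

type_synonym ('a, 'k) mpoly = "('a \<Rightarrow>\<^sub>0 nat) \<Rightarrow>\<^sub>0 'k"

definition poly_vars :: "('a, 'k::zero) mpoly \<Rightarrow> 'a set" where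
  "poly_vars p = (\<Union>m\<in>Poly_Mapping.keys p. Poly_Mapping.keys m)"

(* The polynomial ring K[x_v : v in V], as a subring of the polynomials in variables indexed by
   the whole type 'a. The operations are those of the type class, only the carrier is cut down. *)
definition poly_ring :: "'a set \<Rightarrow> ('a, 'k::field) mpoly ring" where
  "poly_ring V = \<lparr>carrier = {p. poly_vars p \<subseteq> V}, monoid.mult = (*), one = 1, zero = 0, add = (+)\<rparr>"

definition Var :: "'a \<Rightarrow> ('a, 'k::field) mpoly" where
  "Var v = Poly_Mapping.single (Poly_Mapping.single v 1) 1"

definition mon_deg :: "('a \<Rightarrow>\<^sub>0 nat) \<Rightarrow> nat" where
  "mon_deg m = (\<Sum>v\<in>Poly_Mapping.keys m. Poly_Mapping.lookup m v)"

(* The degree is an integer because the entries of a graded matrix have degrees that are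
   differences of shifts; for negative d only the zero polynomial is homogeneous. *)
definition homogeneous_of_degree :: "int \<Rightarrow> ('a, 'k::field) mpoly \<Rightarrow> bool" where
  "homogeneous_of_degree d p \<longleftrightarrow> (\<forall>m\<in>Poly_Mapping.keys p. int (mon_deg m) = d)"

definition linear_forms :: "'a set \<Rightarrow> ('a, 'k::field) mpoly set" where
  "linear_forms V = {p \<in> carrier (poly_ring V). homogeneous_of_degree 1 p}"

definition edge_ideal :: "'a set \<Rightarrow> 'a set set \<Rightarrow> ('a, 'k::field) mpoly set" where
  "edge_ideal V E = genideal (poly_ring V) {Var i * Var j | i j. {i, j} \<in> E \<and> i \<noteq> j}"

definition irrelevant_ideal :: "'a set \<Rightarrow> ('a, 'k::field) mpoly set" where
  "irrelevant_ideal V = genideal (poly_ring V) (Var ` V)"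

definition colon_ideal ::
  "'a set \<Rightarrow> ('a, 'k::field) mpoly set \<Rightarrow> ('a, 'k) mpoly \<Rightarrow> ('a, 'k) mpoly set" where
  "colon_ideal V J f = {g \<in> carrier (poly_ring V). g * f \<in> J}"

definition homogeneous_generators ::
  "'a set \<Rightarrow> ('a, 'k::field) mpoly set \<Rightarrow> ('a, 'k) mpoly list \<Rightarrow> bool" where
  "homogeneous_generators V I fs \<longleftrightarrow>
     set fs \<subseteq> carrier (poly_ring V) \<and> (\<forall>f\<in>set fs. \<exists>d. homogeneous_of_degree d f) \<and>
     genideal (poly_ring V) (set fs) = I"

definition minimal_homogeneous_generators ::
  "'a set \<Rightarrow> ('a, 'k::field) mpoly set \<Rightarrow> ('a, 'k) mpoly list \<Rightarrow> bool" where
  "minimal_homogeneous_generators V I fs \<longleftrightarrow>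
     homogeneous_generators V I fs \<and>
     (\<forall>i<length fs. genideal (poly_ring V) (set (take i fs @ drop (Suc i) fs)) \<noteq> I)"

(* As usual, the system of generators is required to be minimal. If redundant generators were
   allowed, the ideal (ab, cd), with no linear resolution, would have linear quotients, via
   abc, acd, ab, cd with successive colon ideals 0, (b), (c), (a). *)
definition has_linear_quotients :: "'a set \<Rightarrow> ('a, 'k::field) mpoly set \<Rightarrow> bool" where
  "has_linear_quotients V I \<longleftrightarrow>
     (\<exists>fs. minimal_homogeneous_generators V I fs \<and>
       (\<forall>i<length fs. \<exists>L. L \<subseteq> linear_forms V \<and>
          colon_ideal V (genideal (poly_ring V) (set (take i fs))) (fs ! i)
            = genideal (poly_ring V) L))"

section \<open>Graded free resolutions\<close>

definition free_mod :: "'a set \<Rightarrow> nat \<Rightarrow> ('a, 'k::field) mpoly vec set" where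
  "free_mod V n = {v \<in> carrier_vec n. \<forall>i<n. v $ i \<in> carrier (poly_ring V)}"

(* A graded free resolution  ... -> F 1 -> F 0 -> I -> 0  of an ideal I:
   F i is the direct sum of the S(- d i c) for c < b i, the matrix \<phi> i represents the
   differential F (Suc i) -> F i, and g lists the images in I of the basis of F 0. *)
definition graded_free_resolution ::
  "'a set \<Rightarrow> ('a, 'k::field) mpoly set \<Rightarrow> (nat \<Rightarrow> nat) \<Rightarrow> (nat \<Rightarrow> nat \<Rightarrow> int) \<Rightarrow>
   ('a, 'k) mpoly vec \<Rightarrow> (nat \<Rightarrow> ('a, 'k) mpoly mat) \<Rightarrow> bool" where
  "graded_free_resolution V I b d g \<phi> \<longleftrightarrow>
     g \<in> free_mod V (b 0) \<and>
     (\<forall>c<b 0. homogeneous_of_degree (d 0 c) (g $ c)) \<and>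
     (\<forall>i. \<phi> i \<in> carrier_mat (b i) (b (Suc i)) \<and>
        (\<forall>r<b i. \<forall>c<b (Suc i). \<phi> i $$ (r, c) \<in> carrier (poly_ring V) \<and>
           homogeneous_of_degree (d (Suc i) c - d i r) (\<phi> i $$ (r, c)))) \<and>
     (\<lambda>v. g \<bullet> v) ` free_mod V (b 0) = I \<and>
     {v \<in> free_mod V (b 0). g \<bullet> v = 0} = (\<lambda>w. \<phi> 0 *\<^sub>v w) ` free_mod V (b 1) \<and>
     (\<forall>i. {v \<in> free_mod V (b (Suc i)). \<phi> i *\<^sub>v v = 0\<^sub>v (b i)}
          = (\<lambda>w. \<phi> (Suc i) *\<^sub>v w) ` free_mod V (b (Suc (Suc i))))"

definition minimal_graded_free_resolution ::
  "'a set \<Rightarrow> ('a, 'k::field) mpoly set \<Rightarrow> (nat \<Rightarrow> nat) \<Rightarrow> (nat \<Rightarrow> nat \<Rightarrow> int) \<Rightarrow>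
   ('a, 'k) mpoly vec \<Rightarrow> (nat \<Rightarrow> ('a, 'k) mpoly mat) \<Rightarrow> bool" where
  "minimal_graded_free_resolution V I b d g \<phi> \<longleftrightarrow>
     graded_free_resolution V I b d g \<phi> \<and>
     (\<forall>i. \<forall>r<b i. \<forall>c<b (Suc i). \<phi> i $$ (r, c) \<in> irrelevant_ideal V)"

(* The minimal graded free resolution is unique up to isomorphism, so it is q-linear as soon as
   one of its realisations by matrices is. *)
definition has_linear_resolution :: "'a set \<Rightarrow> nat \<Rightarrow> ('a, 'k::field) mpoly set \<Rightarrow> bool" where
  "has_linear_resolution V q I \<longleftrightarrow>
     (\<exists>b d g \<phi>. minimal_graded_free_resolution V I b d g \<phi> \<and>
       (\<forall>i. \<forall>c<b i. d i c = int q + int i))"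

end

(* Write T for the property that the Koszul homology Tor(K, I(G)) of the edge ideal vanishes outside
   the linear strand. It is computed by hand: the Koszul complex of the polynomial ring is exact by an
   explicit contraction in each multidegree, and the long exact sequences become diagram chases with
   chains of homogeneous polynomials.

   T follows from a linear resolution by dimension shifting, and from linear quotients by induction on
   the generators, because an ideal of linear forms is prime and generated by a regular sequence.
   T implies that the complement of G is chordal: a chordless cycle on m >= 4 vertices W in the
   complement gives a nonzero class in the multidegree of W, in degree m - 3 of the complex.
   A chordal graph has a perfect elimination ordering by Dirac's theorem. Sorting the edges of G by
   their first vertex in such an ordering of the complement shells G, and a shelling yields linear
   quotients with respect to the monomial generators. Finally T yields a minimal linear resolution: in each
   step the syzygies are generated by linear ones, and one takes a basis of these. *)

theory Submission
  imports Defs "HOL-Library.Function_Algebras"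
begin

section \<open>Chordal graphs\<close>

text \<open>Generators with linear quotients need not be monomials, and a resolution is given by
  arbitrary matrices, so neither (2) nor (3) can be read combinatorially. T depends on the ideal
  only, and for the monomial ideal I(G) it can be tested in single multidegrees. Conditions (2) and
  (3) are never compared with each other: both follow from (1), and both yield T and hence (4). T is
  stated for the column module of a matrix of forms of one degree. A chain with values in that
  module is represented by a chain of coefficient vectors, whose degree then counts the distance
  from the linear strand. So no quotient modules occur, and each connecting homomorphism becomes:
  choose coefficients, apply the Koszul differential, correct by a boundary. Faces of all sizes are
  carried along at once; their size matters only where it bounds an induction. Signs are cancelled
  pairwise and never by halving, so the characteristic of the field does not matter.\<close>

lemma complement_edges_iff:
  "{u, v} \<in> complement_edges V E \<longleftrightarrow> u \<in> V \<and> v \<in> V \<and> u \<noteq> v \<and> {u, v} \<notin> E"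
  by (auto simp: complement_edges_def doubleton_eq_iff insert_commute)

text \<open>Sort the edges by their first vertex in the perfect elimination ordering of the complement:
  for two disjoint edges, the smallest of the four vertices is joined to the edge not containing it.\<close>
lemma peo_shellable:
  assumes graph: "simple_graph V E" and peo: "perfect_elimination_ordering V (complement_edges V E) vs"
  shows "edgewise_strongly_shellable V E"
proof -
  have vs: "distinct vs" "set vs = V" and cl: "\<And>j. Suc j < length vs \<Longrightarrow>
      clique V (complement_edges V E) {vs ! k | k. j < k \<and> k < length vs \<and> {vs ! k, vs ! j} \<in> complement_edges V E}"
    using peo by (auto simp: perfect_elimination_ordering_def)
  have E: "\<And>e. e \<in> E \<Longrightarrow> e \<subseteq> V" "\<And>e. e \<in> E \<Longrightarrow> card e = 2" "finite V"
    using graph by (auto simp: simple_graph_def)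
  have Efin: "finite e" if "e \<in> E" for e using finite_subset[OF E(1)[OF that] E(3)] .
  have "finite E" using finite_subset[of E "Pow V"] E by auto
  then obtain Es where Es: "set Es = E" "distinct Es" using finite_distinct_list by blast
  define pos where "pos v = (THE i. i < length vs \<and> vs ! i = v)" for v
  have posI: "pos (vs ! i) = i" if "i < length vs" for i
    unfolding pos_def by (rule the_equality) (use that vs(1) in \<open>auto simp: nth_eq_iff_index_eq\<close>)
  have pos: "pos v < length vs" "vs ! pos v = v" if "v \<in> V" for v
    using that vs(2) posI by (auto simp: in_set_conv_nth)
  define key where "key e = Min (pos ` e)" for e
  define Fs where "Fs = sort_key key Es"
  have Fs: "set Fs = E" "distinct Fs" "sorted (map key Fs)" using Es by (simp_all add: Fs_def)
  have key_ex: "\<exists>v\<in>e. key e = pos v" if "e \<in> E" for e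
  proof -
    have "finite e" "e \<noteq> {}" using E(2)[OF that] Efin[OF that] by auto
    then have "Min (pos ` e) \<in> pos ` e" by (intro Min_in) auto
    then show ?thesis by (auto simp: key_def)
  qed
  have key_le: "key e \<le> pos v" if "e \<in> E" "v \<in> e" for e v
    using that Efin[OF that(1)] unfolding key_def by (intro Min_le) auto
  \<comment> \<open>If \<open>a\<close> had no neighbour in \<open>f\<close>, both ends of
    \<open>f\<close> would be later neighbours of \<open>a\<close> in the complement, and the
    elimination property would make \<open>f\<close> a non-edge.\<close>
  have cross: "\<exists>u\<in>f. {a, u} \<in> E" if a: "a \<in> V" and f: "f \<in> E" "a \<notin> f" and less: "\<And>u. u \<in> f \<Longrightarrow> pos a < pos u" for a f
  proof (rule ccontr)
    assume none: "\<not> (\<exists>u\<in>f. {a, u} \<in> E)"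
    obtain c d where cd: "f = {c, d}" "c \<noteq> d" using E(2)[OF f(1)] by (auto simp: card_2_iff)
    have cdV: "c \<in> V" "d \<in> V" using E(1)[OF f(1)] cd by auto
    let ?U = "{vs ! k | k. pos a < k \<and> k < length vs \<and> {vs ! k, vs ! pos a} \<in> complement_edges V E}"
    have mem: "u \<in> ?U" if u: "u \<in> f" for u
    proof -
      have uV: "u \<in> V" using u E(1)[OF f(1)] by blast
      have "u \<noteq> a" "{u, a} \<notin> E" using u none f(2) by (auto simp: insert_commute)
      then have "{u, a} \<in> complement_edges V E" using uV a by (simp add: complement_edges_iff)
      then show ?thesis
        by (intro CollectI exI[of _ "pos u"]) (simp add: pos[OF uV] pos(2)[OF a] less[OF u])
    qed
    have "c \<in> ?U" "d \<in> ?U" using mem[of c] mem[of d] cd(1) by blast+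
    moreover have "Suc (pos a) < length vs" using less[of c] pos(1)[OF cdV(1)] cd by auto
    ultimately have "{c, d} \<in> complement_edges V E" using cl[of "pos a"] cd(2) by (auto simp: clique_def)
    then show False using f cd by (simp add: complement_edges_iff)
  qed
  show ?thesis unfolding edgewise_strongly_shellable_def strongly_shellable_def
  proof (intro exI[of _ Fs] conjI allI impI)
    fix j i assume j: "j < length Fs" and i: "i < j"
    let ?e = "Fs ! i" and ?f = "Fs ! j"
    have ef: "?e \<in> E" "?f \<in> E" using i j by (simp_all flip: Fs(1))
    have ne: "?e \<noteq> ?f" using Fs(2) i j by (simp add: nth_eq_iff_index_eq)
    have fin: "finite ?e" "finite ?f" using E ef finite_subset by blast+
    show "\<exists>k<j. card (?f - Fs ! k) = 1 \<and> ?e \<inter> ?f \<subseteq> Fs ! k \<and> Fs ! k \<subseteq> ?e \<union> ?f"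
    proof (cases "?e \<inter> ?f = {}")
      \<comment> \<open>For edges with a common vertex, \<open>i\<close> itself serves as
        \<open>k\<close>.\<close>
      case False
      then have "card (?f \<inter> ?e) \<noteq> 0" using fin by (auto simp: card_eq_0_iff)
      moreover have "card (?f \<inter> ?e) \<noteq> 2"
      proof
        assume "card (?f \<inter> ?e) = 2"
        then have "?f \<inter> ?e = ?f" "?f \<inter> ?e = ?e"
          using E(2) ef fin card_subset_eq[of ?f "?f \<inter> ?e"] card_subset_eq[of ?e "?f \<inter> ?e"] by auto
        then show False using ne by simp
      qed
      moreover have "card (?f \<inter> ?e) \<le> 2" using card_mono[of ?f "?f \<inter> ?e"] fin E(2) ef by auto
      moreover have "card (?f - ?e) = 2 - card (?f \<inter> ?e)"
        using card_Diff_subset_Int[of ?f ?e] fin E(2)[OF ef(2)] by simp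
      ultimately have "card (?f - ?e) = 1" by linarith
      then show ?thesis using i by (intro exI[of _ i]) auto
    next
      case True
      obtain a where a: "a \<in> ?e" "key ?e = pos a" using key_ex[OF ef(1)] by blast
      have aV: "a \<in> V" using a E(1)[OF ef(1)] by blast
      have ij: "key ?e \<le> key ?f" using sorted_nth_mono[OF Fs(3), of i j] i j by simp
      have less: "pos a < pos u" if u: "u \<in> ?f" for u
      proof -
        have "pos a \<le> pos u" using ij a key_le[OF ef(2) u] by simp
        moreover have "u \<in> V" using u E(1)[OF ef(2)] by blast
        then have "pos a \<noteq> pos u" using pos(2) aV a u True by (metis IntI empty_iff)
        ultimately show ?thesis by simp
      qed
      have "a \<notin> ?f" using a True by blast
      then obtain u where u: "u \<in> ?f" "{a, u} \<in> E" using cross[OF aV ef(2) _ less] by blast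
      obtain k where k: "k < length Fs" "Fs ! k = {a, u}" using u(2) Fs(1) by (metis in_set_conv_nth)
      \<comment> \<open>\<open>a\<close> precedes all of \<open>?f\<close>, so the edge
        \<open>{a, u}\<close> has a strictly smaller key than \<open>?f\<close>. Strictness puts it
        before position \<open>j\<close> however ties are ordered.\<close>
      have "key (Fs ! k) \<le> pos a" using key_le[OF u(2), of a] k by simp
      also have "pos a < key ?f" using key_ex[OF ef(2)] less by auto
      finally have less_key: "key (Fs ! k) < key ?f" .
      have "k < j"
      proof (rule ccontr)
        assume "\<not> k < j"
        then show False using sorted_nth_mono[OF Fs(3), of j k] k(1) j less_key by simp
      qed
      moreover have "card (?f - Fs ! k) = 1"
        using u \<open>a \<notin> ?f\<close> E(2)[OF ef(2)] fin k by (simp add: card_Diff_singleton_if)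
      moreover have "?e \<inter> ?f \<subseteq> Fs ! k" "Fs ! k \<subseteq> ?e \<union> ?f" using True k a u by auto
      ultimately show ?thesis by (intro exI[of _ k]) simp
    qed
  qed (use Fs in auto)
qed

section \<open>Induced paths and Dirac's theorem\<close>

definition chordless :: "('a \<Rightarrow> 'a \<Rightarrow> bool) \<Rightarrow> 'a list \<Rightarrow> bool" where
  "chordless A p \<longleftrightarrow> (\<forall>i j. i < j \<longrightarrow> j < length p \<longrightarrow> A (p ! i) (p ! j) \<longrightarrow> j = Suc i)"

lemma rtranclp_successively:
  assumes "R\<^sup>*\<^sup>* a b"
  shows "\<exists>p. p \<noteq> [] \<and> hd p = a \<and> last p = b \<and> successively R p"
  using assms
proof (induction rule: rtranclp_induct)
  case base
  show ?case by (intro exI[of _ "[a]"]) simp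
next
  case (step y z)
  then obtain p where p: "p \<noteq> []" "hd p = a" "last p = y" "successively R p" by blast
  then show ?case using step by (intro exI[of _ "p @ [z]"]) (auto simp: successively_append_iff)
qed

lemma successively_mono_set:
  assumes "successively P p" "\<And>x y. x \<in> set p \<Longrightarrow> y \<in> set p \<Longrightarrow> P x y \<Longrightarrow> Q x y"
  shows "successively Q p"
  using assms by (induction P p rule: successively.induct) auto

lemma successively_take: "successively A p \<Longrightarrow> successively A (take n p)"
  and successively_drop: "successively A p \<Longrightarrow> successively A (drop n p)"
  using successively_append_iff[of A "take n p" "drop n p"] by simp_all

text \<open>A walk of minimal length in \<open>W\<close> will do: a chord or a repeated vertex would
  let the stretch in between be cut out. For symmetric \<open>A\<close> the resulting path is an
  induced one.\<close>

lemma shortest_path: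
  assumes "p0 \<noteq> []" "hd p0 = a" "last p0 = b" "successively A p0" "set p0 \<subseteq> W"
  obtains p where "p \<noteq> []" "hd p = a" "last p = b" "successively A p" "set p \<subseteq> W" "distinct p" "chordless A p"
proof -
  define P where "P p \<longleftrightarrow> p \<noteq> [] \<and> hd p = a \<and> last p = b \<and> successively A p \<and> set p \<subseteq> W" for p
  obtain p where p: "P p" and min: "\<And>q. P q \<Longrightarrow> length p \<le> length q"
    using ex_has_least_nat[of P p0 length] assms unfolding P_def by metis
  have short: "j = Suc i" if ij: "i < j" "j < length p" and A: "A (p ! i) (p ! j)" for i j
  proof (rule ccontr)
    assume "j \<noteq> Suc i"
    let ?q = "take (Suc i) p @ drop j p"
    have ne: "take (Suc i) p \<noteq> []" "drop j p \<noteq> []" using ij by auto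
    have "last (take (Suc i) p) = p ! i" using ij by (simp add: take_Suc_conv_app_nth)
    moreover have "hd (drop j p) = p ! j" using ij by (simp add: hd_drop_conv_nth)
    moreover have "successively A (take (Suc i) p)" "successively A (drop j p)"
      using p by (simp_all only: P_def successively_take successively_drop)
    ultimately have "successively A ?q" unfolding successively_append_iff using A by simp
    moreover have "set ?q \<subseteq> W" using p set_take_subset[of "Suc i" p] set_drop_subset[of j p] by (auto simp: P_def)
    moreover have "hd ?q = a" "last ?q = b" using p ne ij by (auto simp: P_def)
    ultimately have "P ?q" using ne by (simp add: P_def)
    then show False using min[of ?q] ij \<open>j \<noteq> Suc i\<close> by simp
  qed
  have "distinct p"
  proof (rule ccontr)
    assume "\<not> distinct p"
    then obtain i j where ij: "i < j" "j < length p" "p ! i = p ! j"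
      by (metis distinct_conv_nth linorder_neqE_nat)
    let ?q = "take i p @ drop j p"
    have q: "?q \<noteq> []" "length ?q < length p" using ij by auto
    have "successively A ?q"
    \<comment> \<open>For \<open>i = 0\<close> nothing remains before the cut, so there is no joint
      to check.\<close>
    proof (cases i)
      case 0
      then show ?thesis using p by (simp add: P_def successively_drop)
    next
      case (Suc k)
      have "A (p ! k) (p ! i)"
        using p ij(1,2) Suc by (simp add: P_def successively_conv_nth)
      moreover have "last (take i p) = p ! k" using Suc ij by (simp add: take_Suc_conv_app_nth)
      moreover have "hd (drop j p) = p ! i" using ij by (simp add: hd_drop_conv_nth)
      moreover have "successively A (take i p)" "successively A (drop j p)"
        using p by (simp_all only: P_def successively_take successively_drop)
      ultimately show ?thesis unfolding successively_append_iff by simp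
    qed
    moreover have "hd ?q = a"
    proof (cases "i = 0")
      case True
      then show ?thesis using ij p by (simp add: hd_drop_conv_nth P_def) (metis hd_conv_nth)
    qed (use p ij in \<open>auto simp: P_def\<close>)
    moreover have "last ?q = b" "set ?q \<subseteq> W"
      using p ij set_take_subset[of i p] set_drop_subset[of j p] by (auto simp: P_def)
    ultimately have "P ?q" using q by (simp add: P_def)
    then show False using min[of ?q] q by simp
  qed
  moreover have "chordless A p" using short by (auto simp: chordless_def)
  ultimately show thesis using p by (intro that[of p]) (simp_all add: P_def)
qed

text \<open>Chordality of the subgraph induced on \<open>W\<close>, where a cycle is a vertex \<open>x\<close> with a path \<open>p\<close> joining two of its
  neighbours.\<close>
definition chordal_on :: "'a set \<Rightarrow> ('a \<Rightarrow> 'a \<Rightarrow> bool) \<Rightarrow> bool" where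
  "chordal_on W A \<longleftrightarrow> (\<forall>x p. x \<in> W \<longrightarrow> set p \<subseteq> W \<longrightarrow> distinct (x # p) \<longrightarrow> successively A p \<longrightarrow> length p \<ge> 3 \<longrightarrow>
     chordless A p \<longrightarrow> \<not> (\<forall>i<length p. A x (p ! i) \<longleftrightarrow> i = 0 \<or> Suc i = length p))"

definition simplicial :: "'a set \<Rightarrow> ('a \<Rightarrow> 'a \<Rightarrow> bool) \<Rightarrow> 'a \<Rightarrow> bool" where
  "simplicial W A y \<longleftrightarrow> y \<in> W \<and> (\<forall>u\<in>W. \<forall>v\<in>W. A y u \<longrightarrow> A y v \<longrightarrow> u \<noteq> v \<longrightarrow> A u v)"

lemma chordal_on_subset:
  assumes "chordal_on W A" "W' \<subseteq> W"
  shows "chordal_on W' A"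
  unfolding chordal_on_def
proof (intro allI impI)
  fix x p
  assume "x \<in> W'" "set p \<subseteq> W'" "distinct (x # p)" "successively A p" "3 \<le> length p" "chordless A p"
  then show "\<not> (\<forall>i<length p. A x (p ! i) = (i = 0 \<or> Suc i = length p))"
    using assms(2) by (intro assms(1)[unfolded chordal_on_def, rule_format]) auto
qed

text \<open>Dirac: the neighbours \<open>S\<close> of a component \<open>C\<close> of the graph minus the closed neighbourhood of \<open>x\<close>
  form a clique, and one recurses into \<open>C \<union> S\<close>.\<close>
lemma chordal_on_simplicial:
  assumes "finite W" "W \<noteq> {}" "symp A" "irreflp A" "chordal_on W A"
  shows "(\<exists>y. simplicial W A y) \<and> (\<forall>x\<in>W. (\<exists>z\<in>W. z \<noteq> x \<and> \<not> A x z) \<longrightarrow>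
    (\<exists>y. simplicial W A y \<and> y \<noteq> x \<and> \<not> A x y))"
  using assms
proof (induction "card W" arbitrary: W rule: less_induct)
  case less
  have sym: "\<And>u v. A u v \<Longrightarrow> A v u" using less.prems(3) by (auto dest: sympD)
  have irr: "\<not> A u u" for u using less.prems(4) by (auto dest: irreflpD)
  have IH: "(\<exists>y. simplicial W' A y) \<and> (\<forall>x\<in>W'. (\<exists>z\<in>W'. z \<noteq> x \<and> \<not> A x z) \<longrightarrow>
    (\<exists>y. simplicial W' A y \<and> y \<noteq> x \<and> \<not> A x y))" if "W' \<subset> W" "W' \<noteq> {}" for W'
    using that less.prems finite_subset[of W' W] chordal_on_subset[of W A W']
    by (intro less.hyps psubset_card_mono) auto
  \<comment> \<open>Here \<open>C\<close> is the component of \<open>z\<close> among the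
    non-neighbours of \<open>x\<close>, and \<open>S\<close> is its boundary. This stronger half of
    the statement makes the induction work: it is reused with a vertex of \<open>S\<close> in the
    role of \<open>x\<close>.\<close>
  have two: "\<exists>y. simplicial W A y \<and> y \<noteq> x \<and> \<not> A x y" if x: "x \<in> W" and z: "z \<in> W" "z \<noteq> x" "\<not> A x z" for x z
  proof -
    define F where "F = {u \<in> W. u \<noteq> x \<and> \<not> A x u}"
    define R where "R u v \<longleftrightarrow> u \<in> F \<and> v \<in> F \<and> A u v" for u v
    define C where "C = {c. R\<^sup>*\<^sup>* z c}"
    define S where "S = {s \<in> W - C. \<exists>c\<in>C. A c s}"
    have zF: "z \<in> F" using z by (simp add: F_def)
    have CF: "C \<subseteq> F"
    proof
      fix c assume "c \<in> C"
      then have "R\<^sup>*\<^sup>* z c" by (simp add: C_def)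
      then show "c \<in> F" by (induction rule: rtranclp_induct) (auto simp: R_def zF)
    qed
    have zC: "z \<in> C" by (simp add: C_def)
    have Rsym: "R\<^sup>*\<^sup>* v u" if "R\<^sup>*\<^sup>* u v" for u v
      using that
    proof (induction rule: rtranclp_induct)
      case (step y z)
      have "R z y" using step(2) sym by (simp add: R_def)
      then show ?case using step.IH by (rule converse_rtranclp_into_rtranclp)
    qed simp
    \<comment> \<open>A vertex next to \<open>C\<close> that is not adjacent to \<open>x\<close>
      would belong to the component itself; \<open>x\<close> has no neighbour in
      \<open>C\<close>.\<close>
    have SN: "A x s" if s: "s \<in> S" for s
    proof (rule ccontr)
      assume nx: "\<not> A x s"
      obtain c where c: "c \<in> C" "A c s" "s \<in> W" "s \<notin> C" using s by (auto simp: S_def)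
      have "s \<noteq> x" using c(1,2) CF sym by (auto simp: F_def)
      then have "R c s" using c CF nx by (auto simp: R_def F_def)
      then have "s \<in> C" using c(1) by (auto simp: C_def)
      then show False using c by simp
    qed
    \<comment> \<open>A shortest path from \<open>s\<close> to \<open>t\<close> through
      \<open>C\<close> is closed by \<open>x\<close> to a chordless cycle, since \<open>x\<close> is
      adjacent to all of \<open>S\<close> and to nothing in \<open>C\<close>.\<close>
    have SC: "A s t" if s: "s \<in> S" and t: "t \<in> S" and st: "s \<noteq> t" for s t
    proof (rule ccontr)
      assume nst: "\<not> A s t"
      obtain a b where ab: "a \<in> C" "A a s" "b \<in> C" "A b t" using s t by (auto simp: S_def)
      have sW: "s \<in> W" "t \<in> W" using s t by (auto simp: S_def)
      have "R\<^sup>*\<^sup>* a b" using ab Rsym unfolding C_def by (metis mem_Collect_eq rtranclp_trans)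
      then obtain q where q: "q \<noteq> []" "hd q = a" "last q = b" "successively R q"
        using rtranclp_successively by metis
      have qC: "set q \<subseteq> C"
      proof -
        have "\<forall>v\<in>set q. R\<^sup>*\<^sup>* (hd q) v" using q(1,4)
        proof (induction q rule: rev_induct)
          case (snoc v q)
          show ?case
          proof (cases "q = []")
            case False
            then have "R (last q) v" "successively R q" using snoc.prems by (auto simp: successively_append_iff)
            moreover have "R\<^sup>*\<^sup>* (hd q) (last q)" using snoc.IH False calculation(2) by simp
            ultimately show ?thesis using snoc.IH False by (auto intro: rtranclp.rtrancl_into_rtrancl)
          qed simp
        qed simp
        then show ?thesis using q(2) ab(1) by (auto simp: C_def intro: rtranclp_trans)
      qed
      have sA: "successively A q" by (rule successively_mono_set[OF q(4)]) (auto simp: R_def)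
      let ?p0 = "s # q @ [t]"
      have "successively A ?p0"
        using sA q ab sym by (auto simp: successively_Cons successively_append_iff)
      then obtain p where p: "p \<noteq> []" "hd p = s" "last p = t" "successively A p" "set p \<subseteq> insert s (insert t C)"
        "distinct p" "chordless A p"
        by (rule shortest_path[of ?p0 s t A "insert s (insert t C)", rotated 3]) (use qC in auto)
      \<comment> \<open>Since \<open>s\<close> and \<open>t\<close> are distinct and not adjacent,
        the cycle has at least four vertices.\<close>
      have len: "length p \<ge> 3"
      proof (rule ccontr)
        assume "\<not> 3 \<le> length p"
        then consider u where "p = [u]" | u v where "p = [u, v]"
          using p(1) by (cases p; cases "tl p"; cases "tl (tl p)") auto
        then show False using p st nst by cases auto
      qed
      have xp: "x \<notin> set p" using p(5) SN s t irr CF by (auto simp: F_def)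
      have "\<forall>i<length p. A x (p ! i) \<longleftrightarrow> i = 0 \<or> Suc i = length p"
      proof (intro allI impI)
        fix i assume i: "i < length p"
        have s0: "p ! 0 = s" using p(1,2) by (simp add: hd_conv_nth)
        have tl: "p ! (length p - 1) = t" using p(1,3) by (simp add: last_conv_nth)
        show "A x (p ! i) \<longleftrightarrow> i = 0 \<or> Suc i = length p"
        proof (cases "i = 0 \<or> Suc i = length p")
          case True
          then have "p ! i = s \<or> p ! i = t" using s0 tl by (metis diff_Suc_1)
          then show ?thesis using True SN s t by auto
        next
          case False
          then have "p ! i \<noteq> s" "p ! i \<noteq> t"
            using s0 tl p(1,6) i by (auto simp: nth_eq_iff_index_eq simp flip: s0 tl)
          then have "p ! i \<in> C" using p(5) i nth_mem by blast
          then show ?thesis using False CF by (auto simp: F_def)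
        qed
      qed
      moreover have "set p \<subseteq> W" using p(5) sW CF by (auto simp: F_def)
      ultimately show False
        using less.prems(5) x xp p len unfolding chordal_on_def by (metis distinct.simps(2))
    qed
    have nb: "simplicial W A y" if "simplicial W' A y" "y \<in> C" "\<And>u. u \<in> W \<Longrightarrow> A y u \<Longrightarrow> u \<in> W'" for y W'
      using that CF unfolding simplicial_def F_def by blast
    have nbC: "u \<in> C \<union> S" if "y \<in> C" "u \<in> W" "A y u" for y u using that by (auto simp: S_def)
    have CW: "C \<subseteq> W" "x \<notin> C" "x \<notin> S" using CF SN irr by (auto simp: F_def)
    have fin: "y \<noteq> x \<and> \<not> A x y" if "y \<in> C" for y using that CF by (auto simp: F_def)
    show ?thesis
    \<comment> \<open>If some \<open>s\<close> misses a vertex of \<open>C \<union> S\<close>, the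
      induction hypothesis for \<open>C \<union> S\<close> and \<open>s\<close> yields a simplicial
      vertex not adjacent to \<open>s\<close>, which lies in \<open>C\<close> because
      \<open>S\<close> is a clique. Otherwise every vertex of \<open>S\<close> is joined to all of
      \<open>C \<union> S\<close>, and a simplicial vertex of \<open>C\<close> stays simplicial
      there. A vertex of \<open>C\<close> has all its neighbours in \<open>C \<union> S\<close>, so
      it is simplicial in \<open>W\<close> too.\<close>
    proof (cases "\<exists>s\<in>S. \<exists>w\<in>C \<union> S. w \<noteq> s \<and> \<not> A s w")
      case True
      then obtain s w where sw: "s \<in> S" "w \<in> C \<union> S" "w \<noteq> s" "\<not> A s w" by blast
      have "C \<union> S \<subset> W" using CW x by (auto simp: S_def)
      then obtain y where y: "simplicial (C \<union> S) A y" "y \<noteq> s" "\<not> A s y" using IH[of "C \<union> S"] sw zC by blast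
      have "y \<in> C" using y SC[OF sw(1)] by (auto simp: simplicial_def)
      then have "simplicial W A y" using nb[OF y(1)] nbC by blast
      then show ?thesis using fin \<open>y \<in> C\<close> by blast
    next
      case False
      have "C \<subset> W" using CW x by auto
      then obtain y where y: "simplicial C A y" using IH[of C] zC by blast
      then have yC: "y \<in> C" by (simp add: simplicial_def)
      have "simplicial (C \<union> S) A y"
        unfolding simplicial_def
      proof (intro conjI ballI impI)
        fix u v assume uv: "u \<in> C \<union> S" "v \<in> C \<union> S" "A y u" "A y v" "u \<noteq> v"
        have joined: "A s w" if "s \<in> S" "w \<in> C \<union> S" "w \<noteq> s" for s w using False that by blast
        consider "u \<in> S" | "v \<in> S" | "u \<in> C" "v \<in> C" using uv by blast
        then show "A u v"
        proof cases
          case 1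
          then show ?thesis using joined uv by blast
        next
          case 2
          then show ?thesis using joined[of v u] uv sym by blast
        next
          case 3
          then show ?thesis using y uv unfolding simplicial_def by blast
        qed
      qed (use yC in simp)
      then have "simplicial W A y" using nb yC nbC by blast
      then show ?thesis using fin yC by blast
    qed
  qed
  have "\<exists>y. simplicial W A y"
  proof (cases "\<forall>x\<in>W. \<forall>z\<in>W. z \<noteq> x \<longrightarrow> A x z")
    case True
    obtain y where "y \<in> W" using less.prems(2) by blast
    then show ?thesis using True by (intro exI[of _ y]) (auto simp: simplicial_def)
  qed (use two in blast)
  then show ?case using two by blast
qed

text \<open>A simplicial vertex is put in front, and the rest inherits chordality. Stating the
  condition on positions leaves only a shift of the indices by one.\<close>

lemma chordal_on_elimination:
  assumes "finite W" "symp A" "irreflp A" "chordal_on W A"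
  shows "\<exists>vs. distinct vs \<and> set vs = W \<and> (\<forall>j k l. j < k \<longrightarrow> j < l \<longrightarrow> k < length vs \<longrightarrow> l < length vs \<longrightarrow> k \<noteq> l \<longrightarrow>
    A (vs ! j) (vs ! k) \<longrightarrow> A (vs ! j) (vs ! l) \<longrightarrow> A (vs ! k) (vs ! l))"
  using assms
proof (induction "card W" arbitrary: W)
  case 0
  then show ?case by simp
next
  case (Suc n)
  then have "W \<noteq> {}" by auto
  then obtain y where y: "simplicial W A y" using chordal_on_simplicial Suc.prems by metis
  then have yW: "y \<in> W" by (simp add: simplicial_def)
  have "chordal_on (W - {y}) A" using Suc.prems by (auto intro: chordal_on_subset)
  then obtain vs where vs: "distinct vs" "set vs = W - {y}"
    "\<And>j k l. j < k \<Longrightarrow> j < l \<Longrightarrow> k < length vs \<Longrightarrow> l < length vs \<Longrightarrow> k \<noteq> l \<Longrightarrow>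
      A (vs ! j) (vs ! k) \<Longrightarrow> A (vs ! j) (vs ! l) \<Longrightarrow> A (vs ! k) (vs ! l)"
    using Suc.hyps(1)[of "W - {y}"] Suc.hyps(2) Suc.prems yW by (metis card_Diff_singleton diff_Suc_1 finite_Diff)
  have "A ((y # vs) ! k) ((y # vs) ! l)"
    if jkl: "j < k" "j < l" "k < length (y # vs)" "l < length (y # vs)" "k \<noteq> l"
      "A ((y # vs) ! j) ((y # vs) ! k)" "A ((y # vs) ! j) ((y # vs) ! l)" for j k l
  proof -
    obtain k' l' where kl: "k = Suc k'" "l = Suc l'" using jkl(1,2) by (cases k; cases l) auto
    show ?thesis
    proof (cases j)
      case 0
      have "vs ! k' \<in> W" "vs ! l' \<in> W" "vs ! k' \<noteq> vs ! l'"
        using that kl vs(1,2) nth_mem[of k' vs] nth_mem[of l' vs] by (auto simp: nth_eq_iff_index_eq)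
      moreover have "A y (vs ! k')" "A y (vs ! l')" using jkl(6,7) kl 0 by simp_all
      ultimately have "A (vs ! k') (vs ! l')" using y unfolding simplicial_def by blast
      then show ?thesis using kl by simp
    next
      case (Suc j')
      then show ?thesis using that kl vs(3)[of j' k' l'] by simp
    qed
  qed
  moreover have "distinct (y # vs)" "set (y # vs) = W" using vs yW by auto
  ultimately show ?case by blast
qed

text \<open>The forbidden configuration is the cycle \<open>x # p\<close>. Every edge between its
  vertices turns out to lie on the cycle, so the chord promised by \<open>chordal\<close> cannot
  exist.\<close>

lemma chordal_imp_chordal_on:
  assumes "chordal V E" "W \<subseteq> V" "\<And>u. {u} \<notin> E"
  shows "chordal_on W (\<lambda>u v. u \<noteq> v \<and> {u, v} \<in> E)"
  unfolding chordal_on_def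
proof (intro allI impI notI)
  fix x p
  let ?A = "\<lambda>u v. u \<noteq> v \<and> {u, v} \<in> E"
  assume x: "x \<in> W" and p: "set p \<subseteq> W" "distinct (x # p)" "successively ?A p" "length p \<ge> 3" "chordless ?A p"
    and ends: "\<forall>i<length p. ?A x (p ! i) \<longleftrightarrow> i = 0 \<or> Suc i = length p"
  let ?c = "x # p"
  let ?n = "length ?c"
  have ce: "{?c ! i, ?c ! (Suc i mod ?n)} \<in> cycle_edges ?c" if "i < ?n" for i
    using that unfolding cycle_edges_def by blast
  have first: "{x, p ! 0} \<in> cycle_edges ?c" using ce[of 0] p(4) by (cases p) auto
  have last: "{x, p ! (length p - 1)} \<in> cycle_edges ?c"
  proof -
    have "Suc (length p) mod ?n = 0" by simp
    moreover have "?c ! length p = p ! (length p - 1)" using p(4) by (cases p) auto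
    ultimately show ?thesis using ce[of "length p"] by (simp add: insert_commute del: mod_Suc)
  qed
  have mid: "{p ! i, p ! Suc i} \<in> cycle_edges ?c" if "Suc i < length p" for i
    using ce[of "Suc i"] that by simp
  have "cycle_edges ?c \<subseteq> E"
  proof
    fix e assume "e \<in> cycle_edges ?c"
    then obtain i where i: "i < ?n" "e = {?c ! i, ?c ! (Suc i mod ?n)}" unfolding cycle_edges_def by blast
    consider "i = 0" | "i = length p" | k where "i = Suc k" "Suc k < length p"
      using i(1) by (cases i) (auto simp: less_Suc_eq)
    then show "e \<in> E"
    proof cases
      case 1
      then have "e = {x, p ! 0}" using i(2) p(4) by (cases p) auto
      then show ?thesis using ends p(4) by (metis less_le_trans zero_less_numeral)
    next
      case 2
      then have "e = {p ! (length p - 1), x}" using i(2) p(4) by (cases p) auto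
      moreover have "length p - 1 < length p" "Suc (length p - 1) = length p" using p(4) by auto
      then have "?A x (p ! (length p - 1))" using ends by blast
      ultimately show ?thesis by (simp add: insert_commute)
    next
      case 3
      then have "e = {p ! k, p ! Suc k}" using i(2) by simp
      moreover have "?A (p ! k) (p ! Suc k)" using p(3) 3 by (simp add: successively_conv_nth)
      ultimately show ?thesis by simp
    qed
  qed
  then have "graph_cycle V E ?c" using x p assms(2) by (auto simp: graph_cycle_def)
  then obtain u v where uv: "u \<in> set ?c" "v \<in> set ?c" "{u, v} \<in> E" "{u, v} \<notin> cycle_edges ?c"
    using assms(1) p(4) unfolding chordal_def by (metis One_nat_def Suc_le_eq length_Cons less_Suc_eq_le numeral_3_eq_3)
  \<comment> \<open>\<open>chordal\<close> does not ask the ends of a chord to differ; the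
    hypothesis on singletons excludes the degenerate case.\<close>
  have ne: "u \<noteq> v" using uv(3) assms(3) by auto
  have xcase: "{x, w} \<in> cycle_edges ?c" if "w \<in> set p" "{x, w} \<in> E" for w
  proof -
    obtain i where i: "i < length p" "w = p ! i" using \<open>w \<in> set p\<close> by (metis in_set_conv_nth)
    have "x \<noteq> w" using p(2) that(1) by auto
    then have "i = 0 \<or> Suc i = length p" using ends i that(2) by blast
    then show ?thesis using first last i by (metis diff_Suc_1)
  qed
  have pcase: "{p ! i, p ! j} \<in> cycle_edges ?c" if "i < j" "j < length p" "{p ! i, p ! j} \<in> E" for i j
  proof -
    have "p ! i \<noteq> p ! j" using p(2) that by (simp add: nth_eq_iff_index_eq)
    then have "j = Suc i" using p(5) that unfolding chordless_def by blast
    then show ?thesis using mid[of i] that by simp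
  qed
  show False
  proof (cases "u = x \<or> v = x")
    case True
    then show ?thesis using uv ne xcase by (auto simp: insert_commute)
  next
    case False
    then obtain i j where ij: "i < length p" "u = p ! i" "j < length p" "v = p ! j"
      using uv by (auto simp: in_set_conv_nth)
    then have "i < j \<or> j < i" using ne by (metis linorder_neqE_nat)
    then show ?thesis using pcase[of i j] pcase[of j i] ij uv by (auto simp: insert_commute)
  qed
qed

lemma chordal_imp_peo:
  assumes "finite V" "chordal V E" "\<And>u. {u} \<notin> E"
  shows "\<exists>vs. perfect_elimination_ordering V E vs"
proof -
  let ?A = "\<lambda>u v. u \<noteq> v \<and> {u, v} \<in> E"
  have A: "symp ?A" "irreflp ?A" by (auto intro!: sympI irreflpI simp: insert_commute)
  from chordal_on_elimination[OF assms(1) A chordal_imp_chordal_on[OF assms(2) subset_refl assms(3)]]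
  obtain vs where vs: "distinct vs" "set vs = V"
    "\<forall>j k l. j < k \<longrightarrow> j < l \<longrightarrow> k < length vs \<longrightarrow> l < length vs \<longrightarrow> k \<noteq> l \<longrightarrow>
      ?A (vs ! j) (vs ! k) \<longrightarrow> ?A (vs ! j) (vs ! l) \<longrightarrow> ?A (vs ! k) (vs ! l)"
    by (elim exE conjE) (rule that)
  have "perfect_elimination_ordering V E vs"
    unfolding perfect_elimination_ordering_def
  proof (intro conjI allI impI)
    fix j
    show "clique V E {vs ! k | k. j < k \<and> k < length vs \<and> {vs ! k, vs ! j} \<in> E}"
      unfolding clique_def
    proof (intro conjI ballI impI subsetI)
      fix u v assume "u \<in> {vs ! k | k. j < k \<and> k < length vs \<and> {vs ! k, vs ! j} \<in> E}"
        "v \<in> {vs ! k | k. j < k \<and> k < length vs \<and> {vs ! k, vs ! j} \<in> E}" and "u \<noteq> v"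
      then obtain k l where kl: "j < k" "k < length vs" "{vs ! k, vs ! j} \<in> E" "u = vs ! k"
        "j < l" "l < length vs" "{vs ! l, vs ! j} \<in> E" "v = vs ! l" by blast
      have "vs ! j \<noteq> vs ! k" "vs ! j \<noteq> vs ! l" using vs(1) kl by (auto simp: nth_eq_iff_index_eq)
      then show "{u, v} \<in> E"
        using vs(3)[rule_format, of j k l] kl \<open>u \<noteq> v\<close> by (auto simp: insert_commute)
    qed (use vs in auto)
  qed (use vs in auto)
  then show ?thesis ..
qed

section \<open>Homogeneous polynomials\<close>

abbreviation coef :: "('a \<Rightarrow>\<^sub>0 'b::zero) \<Rightarrow> 'a \<Rightarrow> 'b" where
  "coef \<equiv> Poly_Mapping.lookup"

abbreviation single :: "'a \<Rightarrow> 'b \<Rightarrow> ('a \<Rightarrow>\<^sub>0 'b::zero)" where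
  "single \<equiv> Poly_Mapping.single"

abbreviation supp :: "('a \<Rightarrow>\<^sub>0 'b::zero) \<Rightarrow> 'a set" where
  "supp \<equiv> Poly_Mapping.keys"

definition polys :: "'a set \<Rightarrow> ('a, 'k::field) mpoly set" where
  "polys V = {p. poly_vars p \<subseteq> V}"

definition forms :: "'a set \<Rightarrow> nat \<Rightarrow> ('a, 'k::field) mpoly set" where
  "forms V e = {p \<in> polys V. \<forall>m\<in>supp p. mon_deg m = e}"

lemma carrier_poly_ring [simp]: "carrier (poly_ring V) = polys V"
  by (simp add: poly_ring_def polys_def)

lemma polys_iff: "p \<in> polys V \<longleftrightarrow> (\<forall>m\<in>supp p. supp m \<subseteq> V)"
  by (auto simp: polys_def poly_vars_def)

lemma forms_polys: "p \<in> forms V e \<Longrightarrow> p \<in> polys V"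
  by (simp add: forms_def)

lemma forms_homogeneous: "p \<in> forms V e \<longleftrightarrow> p \<in> polys V \<and> homogeneous_of_degree (int e) p"
  by (auto simp: forms_def homogeneous_of_degree_def)

lemma supp_mon_add: "supp (m + m' :: 'a \<Rightarrow>\<^sub>0 nat) = supp m \<union> supp m'"
  by (auto simp: in_keys_iff lookup_add)

lemma supp_multE:
  assumes "m \<in> supp (p * q)"
  obtains a b where "a \<in> supp p" "b \<in> supp q" "m = a + b"
  using assms keys_mult[of p q] by blast

lemma mon_deg_superset:
  assumes "finite A" "supp m \<subseteq> A"
  shows "mon_deg m = (\<Sum>v\<in>A. coef m v)"
  unfolding mon_deg_def
  by (rule sum.mono_neutral_left) (use assms in \<open>auto simp: in_keys_iff\<close>)

lemma mon_deg_add: "mon_deg (m + m') = mon_deg m + mon_deg m'"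
proof -
  let ?A = "supp m \<union> supp m'"
  have "mon_deg (m + m') = (\<Sum>v\<in>?A. coef (m + m') v)"
    by (rule mon_deg_superset) (auto simp: supp_mon_add)
  also have "\<dots> = mon_deg m + mon_deg m'"
    by (simp add: lookup_add sum.distrib mon_deg_superset[of ?A])
  finally show ?thesis .
qed

lemma mon_deg_single [simp]: "mon_deg (single v n) = n"
  by (simp add: mon_deg_def)

lemma mon_deg_0 [simp]: "mon_deg 0 = 0"
  by (simp add: mon_deg_def)

lemma mon_deg_eq_0: "mon_deg m = 0 \<longleftrightarrow> m = 0"
proof
  assume "mon_deg m = 0"
  then have "\<forall>v\<in>supp m. coef m v = 0" by (simp add: mon_deg_def)
  then have "coef m v = 0" for v by (cases "v \<in> supp m") (auto simp: in_keys_iff)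
  then show "m = 0" by (intro poly_mapping_eqI) simp
qed simp

lemma polys_0 [simp]: "0 \<in> polys V" and polys_1 [simp]: "1 \<in> polys V"
  by (auto simp: polys_iff)

lemma polys_add [simp]: "p \<in> polys V \<Longrightarrow> q \<in> polys V \<Longrightarrow> p + q \<in> polys V"
  using keys_add[of p q] by (auto simp: polys_iff)

lemma polys_uminus [simp]: "p \<in> polys V \<Longrightarrow> - p \<in> polys V"
  by (auto simp: polys_iff in_keys_iff)

lemma polys_mult [simp]: "p \<in> polys V \<Longrightarrow> q \<in> polys V \<Longrightarrow> p * q \<in> polys V"
  unfolding polys_iff by (auto simp: supp_mon_add elim!: supp_multE) blast+

lemma polys_sum: "(\<And>i. i \<in> A \<Longrightarrow> f i \<in> polys V) \<Longrightarrow> sum f A \<in> polys V"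
  by (induction A rule: infinite_finite_induct) auto

lemma polys_Var [simp]: "v \<in> V \<Longrightarrow> Var v \<in> polys V"
  by (simp add: polys_iff Var_def)

lemma polys_single_0 [simp]: "single 0 k \<in> polys V"
  by (simp add: polys_iff)

lemma forms_0 [simp]: "0 \<in> forms V e"
  by (simp add: forms_def)

lemma forms_add [simp]: "p \<in> forms V e \<Longrightarrow> q \<in> forms V e \<Longrightarrow> p + q \<in> forms V e"
  using keys_add[of p q] by (auto simp: forms_def)

lemma forms_uminus [simp]: "p \<in> forms V e \<Longrightarrow> - p \<in> forms V e"
  by (auto simp: forms_def in_keys_iff)

lemma forms_diff [simp]: "p \<in> forms V e \<Longrightarrow> q \<in> forms V e \<Longrightarrow> p - q \<in> forms V e"
  using forms_add[OF _ forms_uminus] by force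

lemma forms_mult: "p \<in> forms V a \<Longrightarrow> q \<in> forms V b \<Longrightarrow> p * q \<in> forms V (a + b)"
  by (auto simp: forms_def mon_deg_add elim!: supp_multE)

lemma forms_sum: "(\<And>i. i \<in> A \<Longrightarrow> f i \<in> forms V e) \<Longrightarrow> sum f A \<in> forms V e"
  by (induction A rule: infinite_finite_induct) auto

lemma forms_Var [simp]: "v \<in> V \<Longrightarrow> Var v \<in> forms V (Suc 0)"
  by (simp add: forms_def, simp add: Var_def)

lemma forms_single_0 [simp]: "single 0 k \<in> forms V 0"
  by (simp add: forms_def)

lemma forms_mult_0: "p \<in> forms V 0 \<Longrightarrow> q \<in> forms V b \<Longrightarrow> p * q \<in> forms V b"
  using forms_mult[of p V 0 q b] by simp

lemma forms_Var_mult: "v \<in> V \<Longrightarrow> p \<in> forms V e \<Longrightarrow> Var v * p \<in> forms V (Suc e)"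
  using forms_mult[OF forms_Var, of v V p e] by simp

lemma linear_forms_eq: "linear_forms V = forms V (Suc 0)"
  by (auto simp: linear_forms_def forms_homogeneous)

lemma forms_0_single:
  assumes "p \<in> forms V 0"
  shows "p = single 0 (coef p 0)"
proof (rule poly_mapping_eqI)
  fix m
  show "coef p m = coef (single 0 (coef p 0)) m"
    using assms by (cases "m = 0") (auto simp: forms_def lookup_single in_keys_iff mon_deg_eq_0)
qed

lemma poly_mapping_sum_single: "p = (\<Sum>m\<in>supp p. single m (coef p m))"
  by (rule poly_mapping_eqI) (simp add: lookup_sum lookup_single when_def in_keys_iff)

lemma coef_single_mult_add: 
  fixes p :: "('a, 'k::field) mpoly"
  shows "coef (single t c * p) (t + m) = c * coef p m"
proof -
  have "single t c * p = (\<Sum>n\<in>supp p. single (t + n) (c * coef p n))"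
    by (subst poly_mapping_sum_single[of p]) (simp add: sum_distrib_left mult_single)
  then show ?thesis
    by (simp add: lookup_sum lookup_single when_def in_keys_iff)
qed

lemma coef_single_mult_not: 
  fixes p :: "('a, 'k::field) mpoly"
  assumes "\<And>n. m \<noteq> t + n"
  shows "coef (single t c * p) m = 0"
proof (rule ccontr)
  assume "coef (single t c * p) m \<noteq> 0"
  then have "m \<in> supp (single t c * p)" by (simp add: in_keys_iff)
  then show False using assms by (elim supp_multE) (auto split: if_splits)
qed

lemma coef_const_mult [simp]: 
  fixes p :: "('a, 'k::field) mpoly"
  shows "coef (single 0 c * p) m = c * coef p m"
  using coef_single_mult_add[of 0 c p m] by simp

lemma mon_split: "coef m v > 0 \<Longrightarrow> m = single v (1::nat) + (m - single v 1)"
  by (rule poly_mapping_eqI) (auto simp: lookup_add lookup_minus lookup_single when_def)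

lemma coef_Var_mult: 
  fixes p :: "('a, 'k::field) mpoly"
  shows "coef (Var v * p) m = (if coef m v > 0 then coef p (m - single v 1) else 0)"
proof (cases "coef m v > 0")
  case True
  then show ?thesis
    using coef_single_mult_add[of "single v 1" 1 p "m - single v 1"]
    using True unfolding Var_def mon_split[OF True, symmetric] by simp
next
  case False
  have "m \<noteq> single v 1 + n" for n
    using False by (auto simp: lookup_add)
  then show ?thesis using False unfolding Var_def by (simp add: coef_single_mult_not)
qed

lemma power_neg_one_cases: "(- 1 :: 'r::ring_1) ^ n = 1 \<or> (- 1 :: 'r) ^ n = - 1"
  by (induction n) auto

section \<open>Projection onto homogeneous components\<close>

definition restr :: "('a \<Rightarrow> bool) \<Rightarrow> ('a \<Rightarrow>\<^sub>0 'b::zero) \<Rightarrow> ('a \<Rightarrow>\<^sub>0 'b)" where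
  "restr Q p = Abs_poly_mapping (\<lambda>m. if Q m then coef p m else 0)"

lemma coef_restr [simp]: "coef (restr Q p) m = (if Q m then coef p m else 0)"
proof -
  have "finite {m. (if Q m then coef p m else 0) \<noteq> 0}"
    by (rule finite_subset[OF _ finite_lookup[of p]]) auto
  then show ?thesis by (simp add: restr_def)
qed

lemma supp_restr: "supp (restr Q p) = {m \<in> supp p. Q m}"
  by (auto simp: in_keys_iff split: if_splits)

lemma restr_add: "restr Q (p + q :: 'a \<Rightarrow>\<^sub>0 'b::comm_monoid_add) = restr Q p + restr Q q"
  by (rule poly_mapping_eqI) (simp add: lookup_add)

lemma restr_sum: "restr Q (sum f A :: 'a \<Rightarrow>\<^sub>0 'b::comm_monoid_add) = (\<Sum>i\<in>A. restr Q (f i))"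
  by (rule poly_mapping_eqI) (simp add: lookup_sum)

definition hcomp :: "nat \<Rightarrow> ('a, 'k::field) mpoly \<Rightarrow> ('a, 'k) mpoly" where
  "hcomp e p = restr (\<lambda>m. mon_deg m = e) p"

lemma hcomp_forms: "p \<in> polys V \<Longrightarrow> hcomp e p \<in> forms V e"
  by (auto simp: hcomp_def forms_def polys_iff supp_restr)

lemma hcomp_add: "hcomp e (p + q) = hcomp e p + hcomp e q"
  by (simp add: hcomp_def restr_add)

lemma hcomp_sum: "hcomp e (sum f A) = (\<Sum>i\<in>A. hcomp e (f i))"
  by (simp add: hcomp_def restr_sum)

lemma hcomp_0 [simp]: "hcomp e 0 = 0"
  by (rule poly_mapping_eqI) (simp add: hcomp_def)

lemma hcomp_same: "p \<in> forms V e \<Longrightarrow> hcomp e p = p"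
  by (rule poly_mapping_eqI) (auto simp: hcomp_def forms_def in_keys_iff)

lemma hcomp_other: "p \<in> forms V d \<Longrightarrow> d \<noteq> e \<Longrightarrow> hcomp e p = 0"
  by (rule poly_mapping_eqI) (auto simp: hcomp_def forms_def in_keys_iff)

text \<open>Stated for all large \<open>M\<close>, so that the entries of a vector can be cut off at
  a common bound.\<close>

lemma hcomp_decomp:
  fixes p :: "('a, 'k::field) mpoly"
  obtains N where "\<And>M. N \<le> M \<Longrightarrow> p = (\<Sum>e<M. hcomp e p)"
proof
  fix M assume M: "Suc (Max (mon_deg ` supp p)) \<le> M"
  show "p = (\<Sum>e<M. hcomp e p)"
  proof (rule poly_mapping_eqI)
    fix m
    have "mon_deg m < M" if "coef p m \<noteq> 0"
    proof -
      have "mon_deg m \<le> Max (mon_deg ` supp p)"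
        using that by (intro Max_ge) (auto simp: in_keys_iff)
      then show ?thesis using M by linarith
    qed
    then show "coef p m = coef (\<Sum>e<M. hcomp e p) m"
      by (auto simp: lookup_sum hcomp_def)
  qed
qed

lemma hcomp_mult_forms:
  assumes "f \<in> forms V d" "p \<in> polys V"
  shows "hcomp (d + e) (f * p) = f * hcomp e p"
proof -
  obtain N where N: "\<And>M. N \<le> M \<Longrightarrow> p = (\<Sum>e<M. hcomp e p)" by (metis hcomp_decomp)
  define M where "M = max N (Suc e)"
  have "hcomp (d + e) (f * p) = hcomp (d + e) (\<Sum>i<M. f * hcomp i p)"
    using N[of M] by (simp add: M_def sum_distrib_left[symmetric])
  also have "\<dots> = (\<Sum>i<M. if i = e then f * hcomp e p else 0)"
    unfolding hcomp_sum
  proof (rule sum.cong)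
    fix i
    have "f * hcomp i p \<in> forms V (d + i)" using assms by (intro forms_mult hcomp_forms)
    then show "hcomp (d + e) (f * hcomp i p) = (if i = e then f * hcomp e p else 0)"
      by (auto simp: hcomp_same hcomp_other)
  qed simp
  also have "\<dots> = f * hcomp e p" by (simp add: M_def)
  finally show ?thesis .
qed

lemma hcomp_mult_forms_less:
  assumes "f \<in> forms V d" "p \<in> polys V" "e < d"
  shows "hcomp e (f * p) = 0"
proof (rule poly_mapping_eqI)
  fix m
  have "mon_deg m \<noteq> e" if "m \<in> supp (f * p)"
    using that assms by (elim supp_multE) (auto simp: forms_def mon_deg_add)
  then show "coef (hcomp e (f * p)) m = coef 0 m" by (auto simp: hcomp_def in_keys_iff)
qed

text \<open>Consider the monomials in which the exponent of a variable occurring in the linear form is maximal.\<close>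
lemma linear_form_cancel:
  fixes l p :: "('a, 'k::field) mpoly"
  assumes "l \<in> forms V (Suc 0)" "l \<noteq> 0" "l * p = 0"
  shows "p = 0"
proof (rule ccontr)
  assume "p \<noteq> 0"
  then have ne: "supp p \<noteq> {}" by simp
  obtain t where t: "t \<in> supp l" using assms(2) by fastforce
  have "mon_deg t = Suc 0" using t assms(1) by (auto simp: forms_def)
  then obtain w where "w \<in> supp t" by (metis ex_in_conv keys_eq_empty mon_deg_0 nat.distinct(1))
  have lin: "\<exists>v. s = single v 1" if "s \<in> supp l" for s
  proof -
    have "mon_deg s = Suc 0" using that assms(1) by (auto simp: forms_def)
    then obtain v where v: "coef s v > 0" by (metis gr0I mon_deg_0 nat.distinct(1) poly_mapping_eqI lookup_zero)
    have "mon_deg s = 1 + mon_deg (s - single v 1)"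
      by (subst mon_split[OF v]) (simp add: mon_deg_add)
    then have "s - single v 1 = 0"
      using \<open>mon_deg s = Suc 0\<close> by (simp add: mon_deg_eq_0)
    then show ?thesis using mon_split[OF v] by auto
  qed
  then obtain u where u: "t = single u 1" using t by blast
  define k where "k = Max ((\<lambda>m. coef m u) ` supp p)"
  have kmax: "coef m u \<le> k" if "m \<in> supp p" for m
    using that by (simp add: k_def)
  have "k \<in> (\<lambda>m. coef m u) ` supp p" unfolding k_def using ne by (intro Max_in) auto
  then obtain m where m: "m \<in> supp p" "coef m u = k" by auto
  have "l * p = (\<Sum>s\<in>supp l. single s (coef l s) * p)"
    by (subst poly_mapping_sum_single[of l]) (simp add: sum_distrib_right)
  then have "coef (l * p) (t + m) = (\<Sum>s\<in>supp l. coef (single s (coef l s) * p) (t + m))"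
    by (simp add: lookup_sum)
  also have "\<dots> = (\<Sum>s\<in>supp l. if s = t then coef l t * coef p m else 0)"
  proof (rule sum.cong)
    fix s assume s: "s \<in> supp l"
    then obtain v where v: "s = single v 1" using lin by blast
    show "coef (single s (coef l s) * p) (t + m) = (if s = t then coef l t * coef p m else 0)"
    proof (cases "s = t")
      case True
      then show ?thesis by (simp add: coef_single_mult_add)
    next
      case False
      then have "v \<noteq> u" using u v by auto
      show ?thesis
      proof (cases "\<exists>n. t + m = s + n")
        case True
        then obtain n where n: "t + m = s + n" by blast
        \<comment> \<open>A different variable \<open>v\<close> would have to meet a monomial
          \<open>n\<close> of \<open>p\<close> whose exponent at \<open>u\<close> is
          \<open>k + 1\<close>, above the maximum.\<close>
        have "coef (t + m) u = coef (s + n) u" using n by simp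
        then have "coef n u = Suc k" using u v m \<open>v \<noteq> u\<close> by (simp add: lookup_add lookup_single)
        then have "n \<notin> supp p" using kmax[of n] by auto
        then show ?thesis using n False by (simp add: coef_single_mult_add in_keys_iff)
      qed (use False in \<open>auto simp: coef_single_mult_not\<close>)
    qed
  qed simp
  also have "\<dots> = coef l t * coef p m" using t by simp
  finally show False using assms(3) t m by (simp add: in_keys_iff)
qed

section \<open>The Koszul complex\<close>

text \<open>Exchanging the two summations would only show that twice the sum vanishes. The induction
  cancels the pairs one by one and so covers characteristic 2.\<close>

lemma sum_antisymmetric:
  fixes f :: "'a \<Rightarrow> 'a \<Rightarrow> 'b::ab_group_add"
  assumes "finite A" "\<And>u v. u \<in> A \<Longrightarrow> v \<in> A \<Longrightarrow> u \<noteq> v \<Longrightarrow> f u v = - f v u"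
  shows "(\<Sum>v\<in>A. \<Sum>u\<in>A - {v}. f v u) = 0"
  using assms
proof (induction A rule: finite_induct)
  case (insert x A)
  have "(\<Sum>v\<in>insert x A. \<Sum>u\<in>insert x A - {v}. f v u)
      = (\<Sum>u\<in>A. f x u) + (\<Sum>v\<in>A. \<Sum>u\<in>insert x A - {v}. f v u)"
    using insert.hyps by simp
  also have "(\<Sum>v\<in>A. \<Sum>u\<in>insert x A - {v}. f v u) = (\<Sum>v\<in>A. f v x + (\<Sum>u\<in>A - {v}. f v u))"
  proof (rule sum.cong)
    fix v assume v: "v \<in> A"
    then have "insert x A - {v} = insert x (A - {v})" using insert.hyps by auto
    then show "(\<Sum>u\<in>insert x A - {v}. f v u) = f v x + (\<Sum>u\<in>A - {v}. f v u)"
      using insert.hyps by simp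
  qed simp
  also have "\<dots> = (\<Sum>v\<in>A. f v x)"
  proof -
    have "(\<Sum>v\<in>A. \<Sum>u\<in>A - {v}. f v u) = 0" by (rule insert.IH) (rule insert.prems; simp)
    then show ?thesis by (simp add: sum.distrib)
  qed
  also have "\<dots> = (\<Sum>v\<in>A. - f x v)"
    by (rule sum.cong) (use insert.hyps in \<open>auto intro!: insert.prems\<close>)
  finally show ?case by (simp add: sum_negf)
qed simp

text \<open>\<open>rk\<close> supplies the order of the variables on which the signs of the
  differential depend.\<close>

locale koszul =
  fixes V :: "'a set" and rk :: "'a \<Rightarrow> nat"
  assumes fin: "finite V" and inj: "inj_on rk V"
begin

definition sg :: "'a \<Rightarrow> 'a set \<Rightarrow> 'k::field" where
  "sg v \<sigma> = (- 1) ^ card {u \<in> \<sigma>. rk u < rk v}"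

text \<open>The Koszul differential in coordinates: \<open>w \<sigma>\<close> is the coefficient of
  the exterior basis element of \<open>\<sigma>\<close>, to which the basis element of
  \<open>insert v \<sigma>\<close> contributes with the factor \<open>Var v\<close> up to sign. One
  function holds the components of all exterior degrees.\<close>

definition kd :: "('a set \<Rightarrow> ('a, 'k::field) mpoly) \<Rightarrow> 'a set \<Rightarrow> ('a, 'k) mpoly" where
  "kd w \<sigma> = (\<Sum>v\<in>V - \<sigma>. single 0 (sg v \<sigma>) * (Var v * w (insert v \<sigma>)))"

lemma sg_cases: "(sg v \<sigma> :: 'k::field) = 1 \<or> (sg v \<sigma> :: 'k) = - 1"
  unfolding sg_def by (rule power_neg_one_cases)

lemma sg_square [simp]:
  fixes x :: "'k::field"
  shows "sg v \<sigma> * sg v \<sigma> = (1 :: 'k)" "sg v \<sigma> * (sg v \<sigma> * x) = x"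
  using sg_cases[of v \<sigma>, where 'k = 'k] by auto

text \<open>Of \<open>u\<close> and \<open>v\<close>, the one of smaller rank raises the count for
  the other by one, and not conversely. So inserting flips exactly one of the two signs.\<close>

lemma sg_swap:
  assumes "\<sigma> \<subseteq> V" "u \<in> V - \<sigma>" "v \<in> V - \<sigma>" "u \<noteq> v"
  shows "sg v \<sigma> * sg u (insert v \<sigma>) = - (sg u \<sigma> * sg v (insert u \<sigma>))"
proof -
  have f: "finite \<sigma>" using assms fin finite_subset by blast
  have card: "card {w \<in> insert b \<sigma>. rk w < rk a} = card {w \<in> \<sigma>. rk w < rk a} + (if rk b < rk a then 1 else 0)"
    if "b \<notin> \<sigma>" for a b
  proof -
    have "{w \<in> insert b \<sigma>. rk w < rk a} = (if rk b < rk a then insert b {w \<in> \<sigma>. rk w < rk a} else {w \<in> \<sigma>. rk w < rk a})"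
      by auto
    then show ?thesis using that f by simp
  qed
  have "rk u \<noteq> rk v" using assms inj by (auto simp: inj_on_def)
  then consider "rk u < rk v" "\<not> rk v < rk u" | "rk v < rk u" "\<not> rk u < rk v" by linarith
  then show ?thesis
    using card[of v u] card[of u v] assms by cases (simp_all only: sg_def, simp_all)
qed

lemma kd_cong: "(\<And>\<tau>. \<tau> \<subseteq> V \<Longrightarrow> w \<tau> = w' \<tau>) \<Longrightarrow> \<sigma> \<subseteq> V \<Longrightarrow> kd w \<sigma> = kd w' \<sigma>"
  unfolding kd_def by (rule sum.cong) auto

lemma kd_add: "kd (\<lambda>\<sigma>. a \<sigma> + b \<sigma>) \<sigma> = kd a \<sigma> + kd b \<sigma>"
  by (simp add: kd_def algebra_simps sum.distrib)

lemma kd_diff: "kd (\<lambda>\<sigma>. a \<sigma> - b \<sigma>) \<sigma> = kd a \<sigma> - kd b \<sigma>"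
  by (simp add: kd_def algebra_simps sum_subtractf)

lemma kd_mult: "kd (\<lambda>\<sigma>. c * a \<sigma>) \<sigma> = c * kd a \<sigma>"
  by (simp add: kd_def algebra_simps sum_distrib_left)

lemma kd_0 [simp]: "kd (\<lambda>\<sigma>. 0) \<sigma> = 0"
  by (simp add: kd_def)

lemma kd_sum: "kd (\<lambda>\<sigma>. \<Sum>c\<in>C. f c \<sigma>) \<sigma> = (\<Sum>c\<in>C. kd (f c) \<sigma>)"
  by (induction C rule: infinite_finite_induct) (simp_all add: kd_add)

lemma kd_forms:
  assumes "\<And>\<tau>. \<tau> \<subseteq> V \<Longrightarrow> w \<tau> \<in> forms V e" "\<sigma> \<subseteq> V"
  shows "kd w \<sigma> \<in> forms V (Suc e)"
  unfolding kd_def using assms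
  by (intro forms_sum forms_mult_0 forms_single_0 forms_Var_mult) auto

lemma coef_kd: "coef (kd w \<sigma>) m =
    (\<Sum>v\<in>V - \<sigma>. if coef m v > 0 then sg v \<sigma> * coef (w (insert v \<sigma>)) (m - single v 1) else 0)"
  unfolding kd_def by (auto simp: lookup_sum coef_Var_mult intro!: sum.cong)

lemma kd_kd:
  assumes "\<sigma> \<subseteq> V"
  shows "kd (kd w) \<sigma> = 0"
proof -
  let ?c = "\<lambda>v \<sigma>. single 0 (sg v \<sigma>) :: ('a, 'b) mpoly"
  define f where "f v u = ?c v \<sigma> * ?c u (insert v \<sigma>) * (Var v * Var u * w (insert u (insert v \<sigma>)))" for v u
  have "kd (kd w) \<sigma> = (\<Sum>v\<in>V - \<sigma>. \<Sum>u\<in>V - \<sigma> - {v}. f v u)"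
    unfolding kd_def f_def
  proof (rule sum.cong)
    fix v
    have "V - insert v \<sigma> = V - \<sigma> - {v}" by auto
    then show "?c v \<sigma> * (Var v * (\<Sum>u\<in>V - insert v \<sigma>. ?c u (insert v \<sigma>) * (Var u * w (insert u (insert v \<sigma>)))))
      = (\<Sum>u\<in>V - \<sigma> - {v}. ?c v \<sigma> * ?c u (insert v \<sigma>) * (Var v * Var u * w (insert u (insert v \<sigma>))))"
      by (simp add: sum_distrib_left mult_ac)
  qed simp
  also have "\<dots> = 0"
  proof (rule sum_antisymmetric)
    fix u v assume uv: "u \<in> V - \<sigma>" "v \<in> V - \<sigma>" "u \<noteq> v"
    have "?c u \<sigma> * ?c v (insert u \<sigma>) = - (?c v \<sigma> * ?c u (insert v \<sigma>))"
      using sg_swap[OF assms uv(2,1), where 'b = 'b] uv(3) by (simp add: mult_single single_uminus[symmetric])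
    moreover have "Var u * Var v * w (insert v (insert u \<sigma>)) = Var v * Var u * w (insert u (insert v \<sigma>))"
      by (simp only: insert_commute mult.commute)
    ultimately show "f u v = - f v u" by (simp only: f_def mult_minus_left)
  qed (use fin in simp)
  finally show ?thesis .
qed

text \<open>In each multidegree the Koszul complex computes the reduced homology of a simplex, which
  is contracted onto one of its vertices.\<close>
theorem koszul_exact:
  fixes z :: "'a set \<Rightarrow> ('a, 'k::field) mpoly"
  assumes z: "\<And>\<sigma>. \<sigma> \<subseteq> V \<Longrightarrow> z \<sigma> \<in> forms V (Suc e)"
    and dz: "\<And>\<sigma>. \<sigma> \<subseteq> V \<Longrightarrow> kd z \<sigma> = 0"
  obtains y where "\<And>\<sigma>. \<sigma> \<subseteq> V \<Longrightarrow> y \<sigma> \<in> forms V e" "\<And>\<sigma>. \<sigma> \<subseteq> V \<Longrightarrow> kd y \<sigma> = z \<sigma>"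
proof -
  define X where "X v = single v (1::nat)" for v :: 'a
  have coef_X: "coef (X u) v = (if u = v then 1 else 0)" for u v
    by (simp add: X_def lookup_single when_def)
  note coef_kd = coef_kd[folded X_def]
  have X[simp]: "mon_deg (X v) = 1" "supp (X v) = {v}" for v by (simp_all add: X_def)
  define mm where "mm \<sigma> = (\<Sum>v\<in>\<sigma>. X v)" for \<sigma> :: "'a set"
  \<comment> \<open>The apex of the contraction. It will be chosen from the total multidegree
    \<open>m + mm \<tau>\<close> alone, which the differential preserves, so that one apex serves
    all faces involved.\<close>
  define pv where "pv a = (SOME v. v \<in> supp a)" for a :: "'a \<Rightarrow>\<^sub>0 nat"
  have coef_mm: "coef (mm \<sigma>) v = (if v \<in> \<sigma> then 1 else 0)" if "\<sigma> \<subseteq> V" for \<sigma> v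
    using finite_subset[OF that fin] by (simp add: mm_def lookup_sum coef_X)
  \<comment> \<open>The cone construction: on a face containing the apex, the coefficient is taken
    from the face without the apex, at the monomial multiplied by the apex. On the other faces it is
    zero.\<close>
  define g where "g \<tau> m = (if pv (m + mm \<tau>) \<in> \<tau> then sg (pv (m + mm \<tau>)) (\<tau> - {pv (m + mm \<tau>)}) *
    coef (z (\<tau> - {pv (m + mm \<tau>)})) (m + X (pv (m + mm \<tau>))) else 0)" for \<tau> m
  define y where "y \<tau> = Abs_poly_mapping (g \<tau>)" for \<tau>
  have coef_y: "coef (y \<tau>) m = g \<tau> m" if "\<tau> \<subseteq> V" for \<tau> m
  proof -
    have "{m. g \<tau> m \<noteq> 0} \<subseteq> (\<Union>v\<in>\<tau>. (\<lambda>n. n - X v) ` supp (z (\<tau> - {v})))"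
    proof
      fix m assume "m \<in> {m. g \<tau> m \<noteq> 0}"
      then have "pv (m + mm \<tau>) \<in> \<tau>" "m + X (pv (m + mm \<tau>)) \<in> supp (z (\<tau> - {pv (m + mm \<tau>)}))"
        by (auto simp: g_def in_keys_iff split: if_splits)
      then show "m \<in> (\<Union>v\<in>\<tau>. (\<lambda>n. n - X v) ` supp (z (\<tau> - {v})))"
        by (auto intro!: bexI[of _ "pv (m + mm \<tau>)"] image_eqI[of _ _ "m + X (pv (m + mm \<tau>))"])
    qed
    then have "finite {m. g \<tau> m \<noteq> 0}"
      by (rule finite_subset) (use finite_subset[OF that fin] in auto)
    then show ?thesis by (simp add: y_def)
  qed
  have y: "y \<tau> \<in> forms V e" if t: "\<tau> \<subseteq> V" for \<tau>
  proof -
    have "supp m \<subseteq> V \<and> mon_deg m = e" if m: "m \<in> supp (y \<tau>)" for m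
    proof -
      have "g \<tau> m \<noteq> 0" using m coef_y[OF t] by (simp add: in_keys_iff)
      then have "pv (m + mm \<tau>) \<in> \<tau>" and *: "m + X (pv (m + mm \<tau>)) \<in> supp (z (\<tau> - {pv (m + mm \<tau>)}))"
        by (auto simp: g_def in_keys_iff split: if_splits)
      have "z (\<tau> - {pv (m + mm \<tau>)}) \<in> forms V (Suc e)" using t by (intro z) auto
      with * have "mon_deg (m + X (pv (m + mm \<tau>))) = Suc e" "supp (m + X (pv (m + mm \<tau>))) \<subseteq> V"
        by (auto simp: forms_def polys_iff)
      then show ?thesis by (simp add: mon_deg_add supp_mon_add)
    qed
    then show ?thesis by (auto simp: forms_def polys_iff)
  qed
  have "kd y \<sigma> = z \<sigma>" if s: "\<sigma> \<subseteq> V" for \<sigma>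
  proof (rule poly_mapping_eqI)
    fix m
    show "coef (kd y \<sigma>) m = coef (z \<sigma>) m"
    proof (cases "supp m \<subseteq> V \<and> mon_deg m = Suc e")
      case False
      moreover have "kd y \<sigma> \<in> forms V (Suc e)" "z \<sigma> \<in> forms V (Suc e)"
        using s y z by (auto intro: kd_forms)
      ultimately have "m \<notin> supp (kd y \<sigma>)" "m \<notin> supp (z \<sigma>)" by (auto simp: forms_def polys_iff)
      then show ?thesis by (simp add: in_keys_iff)
    next
      case True
      define v0 where "v0 = pv (m + mm \<sigma>)"
      \<comment> \<open>Positive degree enters here: it provides a variable to serve as apex. In
        degree 0 the empty face carries the base field as homology.\<close>
      have "m \<noteq> 0" using True by auto
      then obtain v where "v \<in> supp m" by (metis ex_in_conv keys_eq_empty)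
      then have "v \<in> supp (m + mm \<sigma>)" by (simp add: supp_mon_add)
      then have v0: "v0 \<in> supp (m + mm \<sigma>)" unfolding v0_def pv_def by (rule someI)
      have shift: "m - X v + mm (insert v \<sigma>) = m + mm \<sigma>" if "v \<in> V - \<sigma>" "coef m v > 0" for v
        using that s by (intro poly_mapping_eqI)
          (auto simp: lookup_add lookup_minus coef_X coef_mm)
      have gi: "g (insert v \<sigma>) (m - X v) = (if v0 \<in> insert v \<sigma> then sg v0 (insert v \<sigma> - {v0}) *
          coef (z (insert v \<sigma> - {v0})) (m - X v + X v0) else 0)"
        if "v \<in> V - \<sigma>" "coef m v > 0" for v
        using that unfolding g_def shift[OF that] v0_def by simp
      have "coef (kd y \<sigma>) m = (\<Sum>v\<in>V - \<sigma>. if coef m v > 0 then sg v \<sigma> * coef (y (insert v \<sigma>)) (m - X v) else 0)"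
        by (rule coef_kd)
      also have "\<dots> = (\<Sum>v\<in>V - \<sigma>. if coef m v > 0 then sg v \<sigma> * (if v0 \<in> insert v \<sigma> then sg v0 (insert v \<sigma> - {v0}) *
          coef (z (insert v \<sigma> - {v0})) (m - X v + X v0) else 0) else 0)"
        by (rule sum.cong) (use s in \<open>auto simp: coef_y gi\<close>)
      finally have dy: "coef (kd y \<sigma>) m = \<dots>" .
      show ?thesis
      proof (cases "v0 \<in> \<sigma>")
        case False
        then have pos: "coef m v0 > 0" using v0 s by (simp add: in_keys_iff lookup_add coef_mm)
        then have "v0 \<in> V" using True by (auto simp: in_keys_iff)
        have "coef (kd y \<sigma>) m = (\<Sum>v\<in>V - \<sigma>. if v = v0 then coef (z \<sigma>) m else 0)"
          unfolding dy
        proof (rule sum.cong)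
          fix v assume "v \<in> V - \<sigma>"
          moreover have "insert v0 \<sigma> - {v0} = \<sigma>" using False by auto
          moreover have "m - X v0 + X v0 = m" using pos
            by (intro poly_mapping_eqI) (auto simp: lookup_add lookup_minus coef_X)
          ultimately show "(if coef m v > 0 then sg v \<sigma> * (if v0 \<in> insert v \<sigma> then sg v0 (insert v \<sigma> - {v0}) *
            coef (z (insert v \<sigma> - {v0})) (m - X v + X v0) else 0) else 0) = (if v = v0 then coef (z \<sigma>) m else 0)"
            using False pos by auto
        qed simp
        then show ?thesis using False \<open>v0 \<in> V\<close> fin by simp
      next
        case v0in: True
        \<comment> \<open>With the apex in the face already, the cycle condition is read at the face
          without the apex and the monomial times the apex. It expresses the coefficient of
          \<open>z \<sigma>\<close> by the same summands that occur in the boundary of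
          \<open>y\<close>.\<close>
        define \<rho> where "\<rho> = \<sigma> - {v0}"
        have \<rho>: "\<rho> \<subseteq> V" "v0 \<notin> \<rho>" "\<sigma> = insert v0 \<rho>" "v0 \<in> V - \<rho>" using s v0in by (auto simp: \<rho>_def)
        have V\<rho>: "V - \<rho> = insert v0 (V - \<sigma>)" using \<rho> by auto
        have "0 = coef (kd z \<rho>) (m + X v0)" using dz[OF \<rho>(1)] by simp
        also have "\<dots> = sg v0 \<rho> * coef (z \<sigma>) m + (\<Sum>v\<in>V - \<sigma>. if coef m v > 0 then
            sg v \<rho> * coef (z (insert v \<rho>)) (m - X v + X v0) else 0)"
        proof -
          have "(if coef (m + X v0) v > 0 then sg v \<rho> * coef (z (insert v \<rho>)) (m + X v0 - X v) else 0)
            = (if coef m v > 0 then sg v \<rho> * coef (z (insert v \<rho>)) (m - X v + X v0) else 0)"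
            if "v \<in> V - \<sigma>" for v
          proof -
            have "v \<noteq> v0" using that v0in by auto
            then have c: "coef (m + X v0) v = coef m v" by (simp add: lookup_add coef_X)
            have "m + X v0 - X v = m - X v + X v0" if "coef m v > 0"
              using that \<open>v \<noteq> v0\<close> by (intro poly_mapping_eqI) (auto simp: lookup_add lookup_minus coef_X)
            then show ?thesis using c by auto
          qed
          then show ?thesis
            unfolding coef_kd V\<rho> using fin v0in \<rho>(3) by (simp add: lookup_add coef_X)
        qed
        finally have "sg v0 \<rho> * coef (z \<sigma>) m = - (\<Sum>v\<in>V - \<sigma>. if coef m v > 0 then
            sg v \<rho> * coef (z (insert v \<rho>)) (m - X v + X v0) else 0)" (is "_ = - ?S")
          by (simp only: eq_neg_iff_add_eq_0)
        then have "sg v0 \<rho> * (sg v0 \<rho> * coef (z \<sigma>) m) = - sg v0 \<rho> * ?S"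
          by simp
        then have e1: "coef (z \<sigma>) m = - sg v0 \<rho> * ?S"
          by (simp only: sg_square)
        have "coef (kd y \<sigma>) m = (\<Sum>v\<in>V - \<sigma>. - sg v0 \<rho> * (if coef m v > 0 then
            sg v \<rho> * coef (z (insert v \<rho>)) (m - X v + X v0) else 0))"
          unfolding dy
        proof (rule sum.cong)
          fix v assume v: "v \<in> V - \<sigma>"
          have eq: "insert v \<sigma> - {v0} = insert v \<rho>" using \<rho> v by auto
          have sw: "sg v \<rho> * sg v0 (insert v \<rho>) = - (sg v0 \<rho> * sg v \<sigma>)"
            unfolding \<rho>(3) by (rule sg_swap) (use \<rho> v in auto)
          have "sg v \<sigma> * sg v0 (insert v \<rho>) = - sg v0 \<rho> * (sg v \<rho> :: 'k)"
          proof -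
            have "sg v \<sigma> * sg v0 (insert v \<rho>) = sg v \<rho> * sg v \<sigma> * (sg v \<rho> * sg v0 (insert v \<rho>) :: 'k)"
              by (simp add: mult_ac)
            also have "\<dots> = - sg v0 \<rho> * (sg v \<rho> :: 'k)"
              unfolding sw by (simp add: mult_ac)
            finally show ?thesis .
          qed
          then have "sg v \<sigma> * (sg v0 (insert v \<rho>) * x) = - sg v0 \<rho> * (sg v \<rho> * x)" for x :: 'k
            by (simp add: mult.assoc[symmetric])
          then show "(if coef m v > 0 then sg v \<sigma> * (if v0 \<in> insert v \<sigma> then sg v0 (insert v \<sigma> - {v0}) *
            coef (z (insert v \<sigma> - {v0})) (m - X v + X v0) else 0) else 0)
            = - sg v0 \<rho> * (if coef m v > 0 then sg v \<rho> * coef (z (insert v \<rho>)) (m - X v + X v0) else 0)"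
            using v0in by (simp add: eq)
        qed simp
        then show ?thesis unfolding e1 by (simp add: sum_distrib_left)
      qed
    qed
  qed
  with y show thesis using that by blast
qed

end

section \<open>Ideals and linear forms\<close>

text \<open>The generated ideal, built one multiple at a time so that its elements admit induction.
  It agrees with \<open>genideal\<close> for generators in \<open>polys V\<close>.\<close>

inductive_set gen :: "'a set \<Rightarrow> ('a, 'k::field) mpoly set \<Rightarrow> ('a, 'k) mpoly set"
  for V :: "'a set" and S :: "('a, 'k) mpoly set" where
  gen_0 [simp]: "0 \<in> gen V S"
| gen_step: "p \<in> gen V S \<Longrightarrow> a \<in> polys V \<Longrightarrow> s \<in> S \<Longrightarrow> p + a * s \<in> gen V S"

lemma gen_base: "s \<in> S \<Longrightarrow> s \<in> gen V S"
  using gen_step[OF gen_0, of 1 V s S] by simp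

lemma gen_add [simp]: "p \<in> gen V S \<Longrightarrow> q \<in> gen V S \<Longrightarrow> p + q \<in> gen V S"
proof (induction p rule: gen.induct)
  case (gen_step p a s)
  then show ?case using gen.gen_step[of "p + q" V S a s] by (simp add: add_ac)
qed simp

lemma gen_mult: "p \<in> gen V S \<Longrightarrow> a \<in> polys V \<Longrightarrow> a * p \<in> gen V S"
proof (induction p rule: gen.induct)
  case (gen_step q b s)
  then show ?case using gen.gen_step[of "a * q" V S "a * b" s] by (simp add: algebra_simps)
qed simp

lemma gen_mult_right: "p \<in> gen V S \<Longrightarrow> a \<in> polys V \<Longrightarrow> p * a \<in> gen V S"
  using gen_mult[of p V S a] by (simp add: mult.commute)

lemma gen_uminus [simp]: "p \<in> gen V S \<Longrightarrow> - p \<in> gen V S"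
  using gen_mult[of p V S "- 1"] by simp

lemma gen_diff [simp]: "p \<in> gen V S \<Longrightarrow> q \<in> gen V S \<Longrightarrow> p - q \<in> gen V S"
  using gen_add[OF _ gen_uminus] by force

lemma gen_sum: "(\<And>i. i \<in> A \<Longrightarrow> f i \<in> gen V S) \<Longrightarrow> sum f A \<in> gen V S"
  by (induction A rule: infinite_finite_induct) auto

lemma gen_polys: "p \<in> gen V S \<Longrightarrow> S \<subseteq> polys V \<Longrightarrow> p \<in> polys V"
  by (induction p rule: gen.induct) auto

lemma gen_subset: "p \<in> gen V S \<Longrightarrow> (\<And>s. s \<in> S \<Longrightarrow> s \<in> gen V T) \<Longrightarrow> p \<in> gen V T"
  by (induction p rule: gen.induct) (auto intro!: gen_add intro: gen_mult)

lemma gen_mono: "p \<in> gen V S \<Longrightarrow> S \<subseteq> T \<Longrightarrow> p \<in> gen V T"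
  by (erule gen_subset) (rule gen_base, blast)

text \<open>A colon ideal comes with a possibly infinite set of linear forms, while the elimination
  of variables runs through a list.\<close>

lemma gen_finite_support: "p \<in> gen V S \<Longrightarrow> \<exists>F. finite F \<and> F \<subseteq> S \<and> p \<in> gen V F"
proof (induction p rule: gen.induct)
  case gen_0
  then show ?case by (intro exI[of _ "{}"]) auto
next
  case (gen_step p a s)
  then obtain F where "finite F" "F \<subseteq> S" "p \<in> gen V F" by blast
  with gen_step show ?case
    by (intro exI[of _ "insert s F"]) (auto intro: gen.gen_step gen_mono)
qed

lemma cring_poly_ring: "cring (poly_ring V :: ('a, 'k::field) mpoly ring)"
proof (rule cringI)
  show "abelian_group (poly_ring V :: ('a, 'k) mpoly ring)"
  proof (rule abelian_groupI)
    fix x :: "('a, 'k) mpoly" assume "x \<in> carrier (poly_ring V)"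
    then show "\<exists>y\<in>carrier (poly_ring V). y \<oplus>\<^bsub>poly_ring V\<^esub> x = \<zero>\<^bsub>poly_ring V\<^esub>"
      by (intro bexI[of _ "- x"]) (simp_all, simp add: poly_ring_def)
  qed (simp_all, simp_all add: poly_ring_def polys_def[symmetric] algebra_simps)
  show "comm_monoid (poly_ring V :: ('a, 'k) mpoly ring)"
    by (rule comm_monoidI) (simp_all, simp_all add: poly_ring_def polys_def[symmetric] algebra_simps)
qed (simp_all, simp_all add: poly_ring_def polys_def[symmetric] algebra_simps)

lemma genideal_eq_gen:
  fixes S :: "('a, 'k::field) mpoly set"
  assumes S: "S \<subseteq> polys V"
  shows "genideal (poly_ring V) S = gen V S"
proof
  let ?R = "poly_ring V :: ('a, 'k) mpoly ring"
  interpret cring ?R by (rule cring_poly_ring)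
  have ops: "x \<oplus>\<^bsub>?R\<^esub> y = x + y" "x \<otimes>\<^bsub>?R\<^esub> y = x * y" "\<zero>\<^bsub>?R\<^esub> = 0" for x y
    by (simp_all add: poly_ring_def)
  have neg: "\<ominus>\<^bsub>?R\<^esub> x = - x" if "x \<in> polys V" for x
    by (rule minus_equality) (use that in \<open>simp_all add: ops\<close>)
  have "ideal (gen V S) (poly_ring V)"
  proof (rule idealI)
    show "subgroup (gen V S) (add_monoid (poly_ring V))"
    proof (rule add.subgroupI)
      show "gen V S \<subseteq> carrier (poly_ring V)" using gen_polys[OF _ S] by auto
      show "\<ominus>\<^bsub>poly_ring V\<^esub> a \<in> gen V S" if "a \<in> gen V S" for a
        using that gen_polys[OF that S] by (simp add: neg)
      show "gen V S \<noteq> {}" using gen_0 by blast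
    qed (auto simp: ops)
  qed (auto simp: ops gen_mult gen_mult_right intro: ring_axioms)
  then show "genideal (poly_ring V) S \<subseteq> gen V S"
    by (rule genideal_minimal) (auto intro: gen_base)
  show "gen V S \<subseteq> genideal (poly_ring V) S"
  proof
    fix p assume "p \<in> gen V S"
    then show "p \<in> genideal (poly_ring V) S"
    proof (induction p rule: gen.induct)
      case gen_0
      then show ?case using additive_subgroup.zero_closed[OF ideal.axioms(1), OF genideal_ideal] S by (simp add: ops)
    next
      case (gen_step p a s)
      have I: "ideal (genideal (poly_ring V) S) (poly_ring V)" using S by (intro genideal_ideal) simp
      have "s \<in> genideal (poly_ring V) S" using genideal_self[of S] S gen_step by auto
      then have "a * s \<in> genideal (poly_ring V) S"
        using ideal.I_l_closed[OF I, of s a] gen_step by (simp add: ops)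
      then show ?case
        using additive_subgroup.a_closed[OF ideal.axioms(1)[OF I], of p "a * s"] gen_step by (simp add: ops)
    qed
  qed
qed

lemma gen_image_lessThan:
  fixes n :: nat
  assumes "p \<in> gen V (f ` {..<n})"
  shows "\<exists>a. (\<forall>c. a c \<in> polys V) \<and> p = (\<Sum>c<n. f c * a c)"
  using assms
proof (induction p rule: gen.induct)
  case gen_0
  then show ?case by (intro exI[of _ "\<lambda>_. 0"]) simp
next
  case (gen_step p b s)
  then obtain a i where a: "\<forall>c. a c \<in> polys V" "p = (\<Sum>c<n. f c * a c)" "s = f i" "i < n" by blast
  have "(\<Sum>c<n. f c * (a(i := a i + b)) c) = (\<Sum>c<n. f c * a c + (if c = i then f i * b else 0))"
    by (rule sum.cong) (auto simp: algebra_simps)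
  also have "\<dots> = p + (\<Sum>c<n. if c = i then f i * b else 0)" using a by (simp only: sum.distrib)
  also have "(\<Sum>c<n. if c = i then f i * b else 0) = b * s"
    using a by (subst sum.delta) (auto simp: mult.commute)
  finally show ?case using a gen_step.hyps by (intro exI[of _ "a(i := a i + b)"]) auto
qed

lemma gen_image_sum:
  fixes n :: nat
  assumes "\<And>c. c < n \<Longrightarrow> a c \<in> polys V"
  shows "(\<Sum>c<n. f c * a c) \<in> gen V (f ` {..<n})"
proof (rule gen_sum)
  fix c assume c: "c \<in> {..<n}"
  then have "f c \<in> gen V (f ` {..<n})" by (intro gen_base) simp
  then show "f c * a c \<in> gen V (f ` {..<n})"
    using gen_mult[of "f c" V _ "a c"] assms c by (simp add: mult.commute)
qed

lemma gen_hcomp: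
  assumes "p \<in> gen V L" "\<And>s. s \<in> L \<Longrightarrow> \<exists>d. s \<in> forms V d"
  shows "hcomp e p \<in> gen V L"
  using assms(1)
proof (induction p rule: gen.induct)
  case (gen_step p a s)
  obtain d where s: "s \<in> forms V d" using gen_step assms by blast
  have "hcomp e (s * a) \<in> gen V L"
  proof (cases "d \<le> e")
    case True
    then have "hcomp e (s * a) = hcomp (e - d) a * s"
      using hcomp_mult_forms[OF s gen_step(2), of "e - d"] by (simp add: mult.commute)
    then show ?thesis using gen_step by (auto intro!: gen_mult forms_polys[OF hcomp_forms] intro: gen_base)
  qed (use hcomp_mult_forms_less[OF s gen_step(2)] in simp)
  then show ?case using gen_step by (simp add: hcomp_add mult.commute)
qed simp

lemma gen_insertE:
  assumes "p \<in> gen V (insert l L)"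
  obtains a where "a \<in> polys V" "p - l * a \<in> gen V L"
  using assms
proof (induction p arbitrary: thesis rule: gen.induct)
  case gen_0
  then show ?case by (metis polys_0 gen.gen_0 mult_zero_right diff_zero)
next
  case (gen_step p b s)
  obtain a where a: "a \<in> polys V" "p - l * a \<in> gen V L" using gen_step.IH by blast
  show ?case
  proof (cases "s = l")
    case True
    with a gen_step show ?thesis by (intro gen_step.prems[of "a + b"]) (auto simp: algebra_simps)
  next
    case False
    have "p - l * a + b * s \<in> gen V L" using False gen_step a by (auto intro: gen.gen_step)
    with a gen_step show ?thesis by (intro gen_step.prems[of a]) (auto simp: algebra_simps)
  qed
qed

section \<open>Substitution of variables and quotients by linear forms\<close>

definition psubst :: "('a \<Rightarrow> ('a, 'k::field) mpoly) \<Rightarrow> ('a, 'k) mpoly \<Rightarrow> ('a, 'k) mpoly" where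
  "psubst f p = (\<Sum>m\<in>supp p. single 0 (coef p m) * (\<Prod>v\<in>supp m. f v ^ coef m v))"

lemma psubst_add: "psubst f (p + q) = psubst f p + psubst f q"
  unfolding psubst_def
  by (rule setsum_keys_plus_distrib) (simp_all add: single_add algebra_simps)

lemma psubst_0 [simp]: "psubst f 0 = 0"
  by (simp add: psubst_def)

lemma psubst_sum: "psubst f (sum g A) = (\<Sum>i\<in>A. psubst f (g i))"
  by (induction A rule: infinite_finite_induct) (simp_all add: psubst_add)

lemma psubst_single:
  "psubst f (single m c) = single 0 c * (\<Prod>v\<in>supp m. f v ^ coef m v)"
  by (simp add: psubst_def)

lemma psubst_const [simp]: "psubst f (single 0 c) = single 0 c"
  by (simp add: psubst_single)

lemma psubst_Var [simp]: "psubst f (Var v) = f v"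
  by (simp add: Var_def psubst_single)

lemma psubst_mult: "psubst f (p * q) = psubst f p * psubst f q"
proof -
  have ext: "(\<Prod>v\<in>supp m. f v ^ coef m v) = (\<Prod>v\<in>A. f v ^ coef m v)"
    if "finite A" "supp m \<subseteq> A" for m and A :: "'a set"
    by (rule prod.mono_neutral_left) (use that in \<open>auto simp: in_keys_iff\<close>)
  have mono: "psubst f (single m c * single n d)
      = psubst f (single m c) * psubst f (single n d)" for m n c d
  proof -
    let ?A = "supp m \<union> supp n"
    have "(\<Prod>v\<in>supp (m + n). f v ^ coef (m + n) v) = (\<Prod>v\<in>supp m. f v ^ coef m v) * (\<Prod>v\<in>supp n. f v ^ coef n v)"
      by (simp add: ext[of ?A] supp_mon_add lookup_add power_add prod.distrib)
    moreover have "single 0 (c * d) = single (0 :: 'a \<Rightarrow>\<^sub>0 nat) c * single 0 d"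
      by (simp add: mult_single)
    ultimately show ?thesis
      unfolding mult_single[of m c n d] psubst_single by (simp only: mult_ac)
  qed
  have pq: "p * q = (\<Sum>m\<in>supp p. \<Sum>n\<in>supp q. single m (coef p m) * single n (coef q n))"
    unfolding sum_product[symmetric] by (simp only: poly_mapping_sum_single[symmetric])
  have "psubst f (p * q) = (\<Sum>m\<in>supp p. psubst f (single m (coef p m))) *
      (\<Sum>n\<in>supp q. psubst f (single n (coef q n)))"
    unfolding pq psubst_sum mono by (simp only: sum_product)
  also have "\<dots> = psubst f p * psubst f q"
    by (simp only: psubst_sum[symmetric] poly_mapping_sum_single[symmetric])
  finally show ?thesis .
qed

lemma polys_induct [consumes 1, case_names const Var add mult]:
  assumes p: "p \<in> polys V"
    and const: "\<And>c. P (single 0 c)" and Var: "\<And>v. v \<in> V \<Longrightarrow> P (Var v)"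
    and add: "\<And>p q. p \<in> polys V \<Longrightarrow> q \<in> polys V \<Longrightarrow> P p \<Longrightarrow> P q \<Longrightarrow> P (p + q)"
    and mult: "\<And>p q. p \<in> polys V \<Longrightarrow> q \<in> polys V \<Longrightarrow> P p \<Longrightarrow> P q \<Longrightarrow> P (p * q)"
  shows "P p"
proof -
  have mono: "P (single m c)" if "supp m \<subseteq> V" "mon_deg m = n" for m c n
    using that
  proof (induction n arbitrary: m)
    case 0
    then show ?case using const by (simp add: mon_deg_eq_0)
  next
    case (Suc n)
    then have "m \<noteq> 0" by auto
    then obtain v where v: "v \<in> supp m" by (metis ex_in_conv keys_eq_empty)
    define m' where "m' = m - single v 1"
    have m: "m = single v 1 + m'" 
      using v mon_split[of m v] by (simp add: in_keys_iff m'_def)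
    have "mon_deg m = Suc (mon_deg m')" unfolding m by (simp add: mon_deg_add)
    moreover have "supp m' \<subseteq> V" "v \<in> V" using Suc(2) by (auto simp: m supp_mon_add)
    ultimately have "P (Var v * single m' c)"
      using Suc by (intro mult Var Suc.IH polys_Var) (auto simp: polys_iff[of "single _ _"])
    then show ?case by (simp add: Var_def mult_single m)
  qed
  have "P (\<Sum>m\<in>A. single m (coef p m)) \<and> (\<Sum>m\<in>A. single m (coef p m)) \<in> polys V"
    if "A \<subseteq> supp p" for A
    using finite_subset[OF that finite_keys] that
  proof (induction A rule: finite_induct)
    case empty
    then show ?case using const[of 0] by simp
  next
    case (insert m A)
    then have "supp m \<subseteq> V" using p by (auto simp: polys_iff)
    then have "P (single m (coef p m))" "single m (coef p m) \<in> polys V"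
      using mono by (auto simp: polys_iff)
    then show ?case using insert by (auto intro: add)
  qed
  from this[of "supp p"] show ?thesis by (simp add: poly_mapping_sum_single[symmetric])
qed

lemma forms_1_sum:
  assumes "p \<in> forms V (Suc 0)" "finite V"
  shows "p = (\<Sum>v\<in>V. single 0 (coef p (single v 1)) * Var v)"
proof (rule poly_mapping_eqI)
  fix m
  let ?X = "\<lambda>v. single v (1::nat)"
  have "coef (\<Sum>v\<in>V. single 0 (coef p (?X v)) * Var v) m
      = (\<Sum>v\<in>V. coef p (?X v) * (if ?X v = m then 1 else 0))"
    unfolding lookup_sum coef_const_mult by (simp add: Var_def lookup_single when_def)
  also have "\<dots> = coef p m"
  proof (cases "\<exists>v\<in>V. ?X v = m")
    case True
    then obtain v where v: "v \<in> V" "m = ?X v" by blast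
    have "?X u = m \<longleftrightarrow> u = v" for u
      unfolding v(2) by (metis lookup_single_eq lookup_single_not_eq zero_neq_one)
    then have "(\<Sum>v\<in>V. coef p (?X v) * (if ?X v = m then 1 else 0)) = (\<Sum>u\<in>V. if u = v then coef p m else 0)"
      by (intro sum.cong) (auto simp: v(2))
    then show ?thesis using v assms(2) by simp
  next
    case False
    have "m \<notin> supp p"
    proof
      assume m: "m \<in> supp p"
      then have d: "mon_deg m = Suc 0" "supp m \<subseteq> V" using assms by (auto simp: forms_def polys_iff)
      then obtain v where v: "v \<in> supp m" by (metis ex_in_conv keys_eq_empty mon_deg_0 nat.distinct(1))
      then have ms: "m = ?X v + (m - ?X v)" by (intro mon_split) (simp add: in_keys_iff)
      then have "mon_deg m = 1 + mon_deg (m - ?X v)" by (metis mon_deg_add mon_deg_single)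
      then have "m - ?X v = 0" using d by (simp add: mon_deg_eq_0)
      then show False using ms v d False by auto
    qed
    then show ?thesis using False by (auto simp: in_keys_iff)
  qed
  finally show "coef p m = coef (\<Sum>v\<in>V. single 0 (coef p (?X v)) * Var v) m" ..
qed

text \<open>Gaussian elimination: modulo linear forms, some of the variables are linear forms in the others,
  and substituting these is a retraction onto the quotient, which is thus a domain.\<close>
lemma linear_forms_retraction:
  fixes ls :: "('a, 'k::field) mpoly list"
  assumes "finite V" "set ls \<subseteq> forms V (Suc 0)"
  obtains \<phi> :: "('a, 'k) mpoly \<Rightarrow> ('a, 'k) mpoly" where
    "\<And>p q. \<phi> (p + q) = \<phi> p + \<phi> q" "\<And>p q. \<phi> (p * q) = \<phi> p * \<phi> q"
    "\<And>p. p \<in> polys V \<Longrightarrow> \<phi> p \<in> polys V"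
    "\<And>p. p \<in> forms V (Suc 0) \<Longrightarrow> \<phi> p \<in> forms V (Suc 0)"
    "\<And>p. p \<in> polys V \<Longrightarrow> p - \<phi> p \<in> gen V (set ls)" "\<And>l. l \<in> set ls \<Longrightarrow> \<phi> l = 0"
  using assms(2)
proof (induction ls arbitrary: thesis)
  case Nil
  show ?case by (rule Nil(1)[of id]) auto
next
  case (Cons l ls)
  from Cons.prems(2) have ls: "set ls \<subseteq> forms V (Suc 0)" and l: "l \<in> forms V (Suc 0)" by auto
  obtain \<phi> :: "('a, 'k) mpoly \<Rightarrow> ('a, 'k) mpoly" where
    \<phi>: "\<And>p q. \<phi> (p + q) = \<phi> p + \<phi> q" "\<And>p q. \<phi> (p * q) = \<phi> p * \<phi> q"
    "\<And>p. p \<in> polys V \<Longrightarrow> \<phi> p \<in> polys V"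
    "\<And>p. p \<in> forms V (Suc 0) \<Longrightarrow> \<phi> p \<in> forms V (Suc 0)"
    "\<And>p. p \<in> polys V \<Longrightarrow> p - \<phi> p \<in> gen V (set ls)" "\<And>l. l \<in> set ls \<Longrightarrow> \<phi> l = 0"
    using Cons.IH[OF _ ls] by blast
  have mono: "p \<in> gen V (set (l # ls))" if "p \<in> gen V (set ls)" for p
    by (rule gen_mono[OF that]) auto
  show ?case
  \<comment> \<open>If \<open>\<phi> l = 0\<close>, then \<open>l\<close> lies in the ideal of
    \<open>ls\<close> already, and \<open>\<phi>\<close> can be kept.\<close>
  proof (cases "\<phi> l = 0")
    case True
    show ?thesis by (rule Cons.prems(1)[of \<phi>]) (use \<phi> mono True in auto)
  next
    case False
    define q where "q = \<phi> l"
    have q: "q \<in> forms V (Suc 0)" using \<phi>(4) l by (simp add: q_def)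
    have "\<exists>v\<in>V. coef q (single v 1) \<noteq> 0"
    proof (rule ccontr)
      assume "\<not> ?thesis"
      then have "q = 0" using forms_1_sum[OF q assms(1)] by simp
      then show False using False by (simp add: q_def)
    qed
    then obtain u where u: "u \<in> V" "coef q (single u 1) \<noteq> 0" by blast
    define a where "a = coef q (single u 1)"
    \<comment> \<open>\<open>q\<close> scaled to coefficient 1 at \<open>u\<close>. Thus
      \<open>Var u - h\<close> is free of \<open>u\<close>, and substituting it for \<open>u\<close>
      solves \<open>q = 0\<close>.\<close>
    define h where "h = single 0 (1 / a) * q"
    define f where "f v = (if v = u then Var u - h else Var v)" for v
    have hq: "h \<in> forms V (Suc 0)" unfolding h_def by (rule forms_mult_0[OF forms_single_0 q])
    have fv: "f v \<in> forms V (Suc 0)" if "v \<in> V" for v using that hq by (auto simp: f_def)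
    have s1: "psubst f p = (\<Sum>v\<in>V. single 0 (coef p (single v 1)) * f v)"
      if "p \<in> forms V (Suc 0)" for p
      by (subst forms_1_sum[OF that assms(1)]) (simp add: psubst_sum psubst_mult)
    \<comment> \<open>The substitution changes each variable by a multiple of \<open>q\<close>, and
      this property passes to sums and products.\<close>
    have sp: "psubst f p \<in> polys V \<and> p - psubst f p \<in> gen V {q}" if "p \<in> polys V" for p
      using that
    proof (induction p rule: polys_induct)
      case (Var v)
      have "h \<in> gen V {q}" unfolding h_def by (intro gen_mult gen_base) auto
      then show ?case using Var fv[OF Var] by (auto simp: f_def intro: forms_polys)
    next
      case (add x y)
      have "x + y - psubst f (x + y) = (x - psubst f x) + (y - psubst f y)" by (simp add: psubst_add)
      then show ?case using add by (metis gen_add polys_add psubst_add)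
    next
      case (mult x y)
      have "x * y - psubst f (x * y) = x * (y - psubst f y) + psubst f y * (x - psubst f x)"
        by (simp add: psubst_mult algebra_simps)
      then show ?case using mult by (metis gen_add gen_mult polys_mult psubst_mult)
    qed simp
    have sq: "psubst f q = 0"
    proof -
      have "psubst f q = (\<Sum>v\<in>V. single 0 (coef q (single v 1)) * Var v
          - (if v = u then single 0 a * h else 0))"
        unfolding s1[OF q] by (rule sum.cong) (auto simp: f_def a_def algebra_simps)
      also have "\<dots> = q - single 0 a * h"
        using forms_1_sum[OF q assms(1), symmetric] u assms(1) by (simp add: sum_subtractf)
      also have "\<dots> = 0" using u unfolding h_def a_def by (simp add: mult.assoc[symmetric] mult_single)
      finally show ?thesis .
    qed
    have ql: "q \<in> gen V (set (l # ls))"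
    proof -
      have "q = l - (l - \<phi> l)" by (simp add: q_def)
      then show ?thesis using mono[OF \<phi>(5)[of l]] l by (metis gen_diff gen_base forms_polys list.set_intros(1))
    qed
    show ?thesis
    proof (rule Cons.prems(1)[of "psubst f \<circ> \<phi>"])
      fix p :: "('a, 'k) mpoly" assume p: "p \<in> forms V (Suc 0)"
      have "psubst f p \<in> forms V (Suc 0)" if "p \<in> forms V (Suc 0)" for p
        unfolding s1[OF that] using fv by (intro forms_sum forms_mult_0) auto
      then show "(psubst f \<circ> \<phi>) p \<in> forms V (Suc 0)" using \<phi>(4) p by simp
    next
      fix p :: "('a, 'k) mpoly" assume p: "p \<in> polys V"
      then have "\<phi> p - psubst f (\<phi> p) \<in> gen V {q}" using sp \<phi> by blast
      then have "\<phi> p - psubst f (\<phi> p) \<in> gen V (set (l # ls))" by (rule gen_subset) (use ql in auto)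
      then have "(p - \<phi> p) + (\<phi> p - psubst f (\<phi> p)) \<in> gen V (set (l # ls))"
        using \<phi>(5)[OF p] mono by (intro gen_add) auto
      then show "p - (psubst f \<circ> \<phi>) p \<in> gen V (set (l # ls))" by simp
    qed (use \<phi> sp sq q_def in \<open>auto simp: psubst_add psubst_mult\<close>)
  qed
qed

text \<open>On \<open>polys V\<close> the retraction has the ideal as its kernel. It maps
  \<open>l\<close> to a nonzero linear form, which can be cancelled in the polynomial ring.\<close>

lemma linear_forms_cancel:
  assumes "finite V" "set ls \<subseteq> forms V (Suc 0)"
    and l: "l \<in> forms V (Suc 0)" "l \<notin> gen V (set ls)"
    and p: "p \<in> polys V" "l * p \<in> gen V (set ls)"
  shows "p \<in> gen V (set ls)"
proof -
  obtain \<phi> where \<phi>: "\<And>p q. \<phi> (p + q) = \<phi> p + \<phi> q" "\<And>p q. \<phi> (p * q) = \<phi> p * \<phi> q"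
    "\<And>p. p \<in> polys V \<Longrightarrow> \<phi> p \<in> polys V"
    "\<And>p. p \<in> forms V (Suc 0) \<Longrightarrow> \<phi> p \<in> forms V (Suc 0)"
    "\<And>p. p \<in> polys V \<Longrightarrow> p - \<phi> p \<in> gen V (set ls)" "\<And>l. l \<in> set ls \<Longrightarrow> \<phi> l = 0"
    by (rule linear_forms_retraction[OF assms(1,2)]) blast
  have zero: "\<phi> x = 0" if "x \<in> gen V (set ls)" for x
    using that
  proof (induction x rule: gen.induct)
    case gen_0
    then show ?case using \<phi>(1)[of 0 0] by simp
  qed (use \<phi> in simp)
  have "\<phi> l \<noteq> 0" using \<phi>(5)[OF forms_polys[OF l(1)]] l(2) by auto
  moreover have "\<phi> l * \<phi> p = 0" using zero[OF p(2)] \<phi>(2) by simp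
  ultimately have "\<phi> p = 0" using linear_form_cancel[OF \<phi>(4)[OF l(1)]] by blast
  then show ?thesis using \<phi>(5)[OF p(1)] by simp
qed

section \<open>Koszul homology modulo linear forms\<close>

context koszul
begin

lemma kd_gen: "(\<And>\<tau>. \<tau> \<subseteq> V \<Longrightarrow> w \<tau> \<in> gen V L) \<Longrightarrow> \<sigma> \<subseteq> V \<Longrightarrow> kd w \<sigma> \<in> gen V L"
  unfolding kd_def by (intro gen_sum gen_mult) auto

text \<open>The quotient by linear forms has a linear resolution, so that its Koszul homology
  vanishes in positive internal degree.\<close>
lemma koszul_linear_quotient:
  fixes ls :: "('a, 'k::field) mpoly list"
  assumes "set ls \<subseteq> forms V (Suc 0)"
    and "\<And>\<sigma>. \<sigma> \<subseteq> V \<Longrightarrow> w \<sigma> \<in> forms V (Suc e)"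
    and "\<And>\<sigma>. \<sigma> \<subseteq> V \<Longrightarrow> kd w \<sigma> \<in> gen V (set ls)"
  shows "\<exists>y. \<forall>\<sigma>\<subseteq>V. y \<sigma> \<in> forms V e \<and> w \<sigma> - kd y \<sigma> \<in> gen V (set ls)"
  using assms
proof (induction ls arbitrary: w e)
  case Nil
  have "p = 0" if "p \<in> gen V {}" for p :: "('a, 'k) mpoly"
    using that by (cases rule: gen.cases) auto
  then have "\<And>\<sigma>. \<sigma> \<subseteq> V \<Longrightarrow> kd w \<sigma> = 0" using Nil(3) by simp
  from koszul_exact[OF Nil(2) this] show ?case by (metis set_empty diff_self gen_0)
next
  case (Cons l ls)
  have ls: "set ls \<subseteq> forms V (Suc 0)" and l: "l \<in> forms V (Suc 0)" using Cons.prems(1) by auto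
  show ?case
  proof (cases "l \<in> gen V (set ls)")
    case True
    have "p \<in> gen V (set ls)" if "p \<in> gen V (set (l # ls))" for p
      by (rule gen_subset[OF that]) (use True in \<open>auto intro: gen_base\<close>)
    then have "\<exists>y. \<forall>\<sigma>\<subseteq>V. y \<sigma> \<in> forms V e \<and> w \<sigma> - kd y \<sigma> \<in> gen V (set ls)"
      using Cons.prems ls by (intro Cons.IH) auto
    then show ?thesis using gen_mono[of _ V "set ls" "set (l # ls)"] by (metis set_subset_Cons)
  next
    case False
    \<comment> \<open>Modulo \<open>ls\<close> the boundary of \<open>w\<close> is a multiple of
      \<open>l\<close>. Passing to the component of degree \<open>e + 2\<close> makes the cofactor a
      form.\<close>
    have "\<exists>c\<in>forms V (Suc e). kd w \<sigma> - l * c \<in> gen V (set ls)" if s: "\<sigma> \<subseteq> V" for \<sigma>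
    proof -
      obtain a where a: "a \<in> polys V" "kd w \<sigma> - l * a \<in> gen V (set ls)"
        using Cons.prems(3)[OF s] by (auto elim: gen_insertE)
      have "hcomp (Suc (Suc e)) (kd w \<sigma> - l * a + l * a) = kd w \<sigma>"
        using hcomp_same[OF kd_forms, OF Cons.prems(2) s] by simp
      then have "kd w \<sigma> = hcomp (Suc (Suc e)) (kd w \<sigma> - l * a) + l * hcomp (Suc e) a"
        unfolding hcomp_add using hcomp_mult_forms[OF l a(1), of "Suc e"] by simp
      then have "kd w \<sigma> - l * hcomp (Suc e) a = hcomp (Suc (Suc e)) (kd w \<sigma> - l * a)"
        by (metis add_diff_cancel_right')
      moreover have "hcomp (Suc (Suc e)) (kd w \<sigma> - l * a) \<in> gen V (set ls)"
        using ls by (intro gen_hcomp[OF a(2)]) blast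
      ultimately show ?thesis using hcomp_forms[OF a(1), of "Suc e"] by (intro bexI) simp_all
    qed
    then obtain c where c: "\<And>\<sigma>. \<sigma> \<subseteq> V \<Longrightarrow> c \<sigma> \<in> forms V (Suc e)"
      "\<And>\<sigma>. \<sigma> \<subseteq> V \<Longrightarrow> kd w \<sigma> - l * c \<sigma> \<in> gen V (set ls)" by metis
    \<comment> \<open>Applying the differential once more puts \<open>l * kd c \<sigma>\<close> into
      the ideal, and \<open>l\<close> is a nonzerodivisor modulo \<open>ls\<close>.\<close>
    have dc: "kd c \<sigma> \<in> gen V (set ls)" if s: "\<sigma> \<subseteq> V" for \<sigma>
    proof -
      have "kd (\<lambda>\<sigma>. kd w \<sigma> - l * c \<sigma>) \<sigma> \<in> gen V (set ls)" by (rule kd_gen[OF c(2) s])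
      then have "- (l * kd c \<sigma>) \<in> gen V (set ls)" by (simp add: kd_diff kd_mult kd_kd[OF s])
      then have "l * kd c \<sigma> \<in> gen V (set ls)" using gen_uminus by fastforce
      have "kd c \<sigma> \<in> polys V"
        by (rule forms_polys[OF kd_forms]) (use c(1) s in auto)
      then show ?thesis using \<open>l * kd c \<sigma> \<in> gen V (set ls)\<close>
        by (rule linear_forms_cancel[OF fin ls l False])
    qed
    \<comment> \<open>The induction hypothesis is used twice. It makes the cofactor \<open>c\<close>
      a boundary of \<open>d\<close> modulo \<open>ls\<close>, so that \<open>w - l * d\<close>
      becomes a cycle modulo \<open>ls\<close>; then it makes that cycle a boundary.\<close>
    obtain d where d: "\<forall>\<sigma>\<subseteq>V. d \<sigma> \<in> forms V e \<and> c \<sigma> - kd d \<sigma> \<in> gen V (set ls)"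
      using Cons.IH[OF ls c(1) dc] by blast
    have A: "kd (\<lambda>\<sigma>. w \<sigma> - l * d \<sigma>) \<sigma> \<in> gen V (set ls)" if s: "\<sigma> \<subseteq> V" for \<sigma>
    proof -
      have "kd (\<lambda>\<sigma>. w \<sigma> - l * d \<sigma>) \<sigma> = (kd w \<sigma> - l * c \<sigma>) + l * (c \<sigma> - kd d \<sigma>)"
        by (simp add: kd_diff kd_mult algebra_simps)
      then show ?thesis using c(2)[OF s] d s l by (metis gen_add gen_mult forms_polys)
    qed
    have B: "w \<sigma> - l * d \<sigma> \<in> forms V (Suc e)" if "\<sigma> \<subseteq> V" for \<sigma>
      using that Cons.prems(2) d forms_mult[OF l, of "d \<sigma>" e] by simp
    obtain y where y: "\<forall>\<sigma>\<subseteq>V. y \<sigma> \<in> forms V e \<and> w \<sigma> - l * d \<sigma> - kd y \<sigma> \<in> gen V (set ls)"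
      using Cons.IH[OF ls B A] by blast
    have "w \<sigma> - kd y \<sigma> \<in> gen V (set (l # ls))" if s: "\<sigma> \<subseteq> V" for \<sigma>
    proof -
      have "w \<sigma> - kd y \<sigma> = (w \<sigma> - l * d \<sigma> - kd y \<sigma>) + d \<sigma> * l" by simp
      moreover have "w \<sigma> - l * d \<sigma> - kd y \<sigma> \<in> gen V (set (l # ls))"
        by (rule gen_mono[of _ _ "set ls"]) (use y s in auto)
      moreover have "d \<sigma> \<in> polys V" using d s by (auto intro: forms_polys)
      ultimately show ?thesis by (simp only: gen_step list.set_intros)
    qed
    then show ?thesis using y by blast
  qed
qed

section \<open>Koszul homology of the column module of a matrix\<close>

definition mul :: "nat \<Rightarrow> (nat \<Rightarrow> nat \<Rightarrow> ('a, 'k::field) mpoly) \<Rightarrow> (nat \<Rightarrow> ('a, 'k) mpoly) \<Rightarrow> nat \<Rightarrow> ('a, 'k) mpoly" where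
  "mul b A v r = (\<Sum>c<b. A r c * v c)"

text \<open>If all entries of the \<open>n\<close> by \<open>b\<close> matrix \<open>A\<close> are forms of one degree, then this says that the Koszul
  homology of the module generated by its columns lives in the linear strand.\<close>
definition acyclic_image :: "nat \<Rightarrow> nat \<Rightarrow> (nat \<Rightarrow> nat \<Rightarrow> ('a, 'k::field) mpoly) \<Rightarrow> bool" where
  "acyclic_image n b A \<longleftrightarrow> (\<forall>e w. (\<forall>\<sigma>\<subseteq>V. \<forall>c<b. w \<sigma> c \<in> forms V (Suc e)) \<longrightarrow>
     (\<forall>\<sigma>\<subseteq>V. \<forall>r<n. kd (\<lambda>\<tau>. mul b A (w \<tau>) r) \<sigma> = 0) \<longrightarrow>
     (\<exists>y. (\<forall>\<sigma>\<subseteq>V. \<forall>c<b. y \<sigma> c \<in> forms V e) \<and>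
        (\<forall>\<sigma>\<subseteq>V. \<forall>r<n. mul b A (w \<sigma>) r = kd (\<lambda>\<tau>. mul b A (y \<tau>) r) \<sigma>)))"

lemma acyclic_imageE:
  assumes "acyclic_image n b A"
    and "\<And>\<sigma> c. \<sigma> \<subseteq> V \<Longrightarrow> c < b \<Longrightarrow> w \<sigma> c \<in> forms V (Suc e)"
    and "\<And>\<sigma> r. \<sigma> \<subseteq> V \<Longrightarrow> r < n \<Longrightarrow> kd (\<lambda>\<tau>. mul b A (w \<tau>) r) \<sigma> = 0"
  obtains y where "\<And>\<sigma> c. \<sigma> \<subseteq> V \<Longrightarrow> c < b \<Longrightarrow> y \<sigma> c \<in> forms V e"
    "\<And>\<sigma> r. \<sigma> \<subseteq> V \<Longrightarrow> r < n \<Longrightarrow> mul b A (w \<sigma>) r = kd (\<lambda>\<tau>. mul b A (y \<tau>) r) \<sigma>"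
proof -
  have "\<exists>y. (\<forall>\<sigma>\<subseteq>V. \<forall>c<b. y \<sigma> c \<in> forms V e) \<and>
        (\<forall>\<sigma>\<subseteq>V. \<forall>r<n. mul b A (w \<sigma>) r = kd (\<lambda>\<tau>. mul b A (y \<tau>) r) \<sigma>)"
    by (rule assms(1)[unfolded acyclic_image_def, THEN spec, of e, THEN spec, of w, THEN mp, THEN mp])
      (use assms(2,3) in simp_all)
  then show thesis by (elim exE conjE) (rule that; simp)
qed

lemma kd_mul: "kd (\<lambda>\<tau>. mul b A (w \<tau>) r) \<sigma> = mul b A (\<lambda>c. kd (\<lambda>\<tau>. w \<tau> c) \<sigma>) r"
  by (simp add: mul_def kd_sum kd_mult)

lemma mul_add: "mul b A (\<lambda>c. v c + w c) r = mul b A v r + mul b A w r"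
  by (simp add: mul_def algebra_simps sum.distrib)

lemma mul_diff: "mul b A (\<lambda>c. v c - w c) r = mul b A v r - mul b A w r"
  by (simp add: mul_def algebra_simps sum_subtractf)

lemma mul_cong: "(\<And>c. c < b \<Longrightarrow> v c = w c) \<Longrightarrow> mul b A v r = mul b A w r"
  by (simp add: mul_def)

lemma mul_forms:
  assumes "\<And>c. c < b \<Longrightarrow> A r c \<in> forms V d" "\<And>c. c < b \<Longrightarrow> v c \<in> forms V e"
  shows "mul b A v r \<in> forms V (d + e)"
  unfolding mul_def using assms by (intro forms_sum forms_mult) auto

lemma hcomp_mul:
  assumes "\<And>c. c < b \<Longrightarrow> A r c \<in> forms V d" "\<And>c. c < b \<Longrightarrow> v c \<in> polys V"
  shows "hcomp (d + e) (mul b A v r) = mul b A (\<lambda>c. hcomp e (v c)) r"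
  unfolding mul_def hcomp_sum using assms by (auto intro!: sum.cong hcomp_mult_forms)

text \<open>Adding \<open>f k\<close> to the ideal of the earlier generators enlarges it by a
  shifted copy of a quotient by linear forms, whose homology is known from
  \<open>koszul_linear_quotient\<close>. The long exact sequence is chased on coefficient
  vectors.\<close>

lemma linear_quotients_acyclic:
  fixes f :: "nat \<Rightarrow> ('a, 'k::field) mpoly"
  assumes f: "\<And>i. i < n \<Longrightarrow> f i \<in> forms V d"
    and lq: "\<And>i. i < n \<Longrightarrow> \<exists>L\<subseteq>forms V (Suc 0). {g \<in> polys V. g * f i \<in> gen V (f ` {..<i})} = gen V L"
  shows "acyclic_image 1 n (\<lambda>r. f)"
  using assms
proof (induction n)
  case 0
  show ?case unfolding acyclic_image_def
    by (intro allI impI exI[of _ "\<lambda>_ _. 0"]) (simp add: mul_def)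
next
  case (Suc k)
  let ?F = "\<lambda>r::nat. f" and ?J = "gen V (f ` {..<k})"
  have fk: "f k \<in> forms V d" using Suc.prems by simp
  \<comment> \<open>All \<open>f i\<close> have the same degree \<open>d\<close>, so a form in
    \<open>?J\<close> has coefficients that are forms of one common degree.\<close>
  have Jhom: "\<exists>a. (\<forall>c. a c \<in> forms V e) \<and> p = mul k ?F a 0" if pJ: "p \<in> ?J" and pf: "p \<in> forms V (d + e)" for p e
  proof -
    obtain a where a: "\<forall>c. a c \<in> polys V" "p = mul k ?F a 0"
      using gen_image_lessThan[OF pJ] by (auto simp: mul_def)
    have "p = hcomp (d + e) (mul k ?F a 0)" using a(2) hcomp_same[OF pf] by simp
    also have "\<dots> = mul k ?F (\<lambda>c. hcomp e (a c)) 0"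
      by (rule hcomp_mul) (use Suc.prems a in auto)
    finally show ?thesis using a hcomp_forms by (intro exI[of _ "\<lambda>c. hcomp e (a c)"]) auto
  qed
  obtain L where L: "L \<subseteq> forms V (Suc 0)" "{g \<in> polys V. g * f k \<in> ?J} = gen V L"
    using Suc.prems(2)[of k] by auto
  have IH: "acyclic_image 1 k ?F" using Suc by simp
  show ?case unfolding acyclic_image_def
  proof (intro allI impI)
    fix e and w :: "'a set \<Rightarrow> nat \<Rightarrow> ('a, 'k) mpoly"
    assume w: "\<forall>\<sigma>\<subseteq>V. \<forall>c<Suc k. w \<sigma> c \<in> forms V (Suc e)"
      and dw: "\<forall>\<sigma>\<subseteq>V. \<forall>r<1. kd (\<lambda>\<tau>. mul (Suc k) ?F (w \<tau>) r) \<sigma> = 0"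
    \<comment> \<open>\<open>w\<close> is split into its part in \<open>?J\<close> and the
      coefficient of \<open>f k\<close>. The latter will be a cycle modulo the colon ideal.\<close>
    define s where "s \<sigma> = mul k ?F (w \<sigma>) 0" for \<sigma>
    define u where "u \<sigma> = w \<sigma> k" for \<sigma>
    have mulS: "mul (Suc k) ?F v r = mul k ?F v 0 + f k * v k" for v r by (simp add: mul_def)
    have sJ: "s \<sigma> \<in> ?J" if "\<sigma> \<subseteq> V" for \<sigma>
      unfolding s_def mul_def using w that
      by (intro gen_image_sum) (metis forms_polys less_SucI)
    have uf: "u \<sigma> \<in> forms V (Suc e)" if "\<sigma> \<subseteq> V" for \<sigma> using w that by (simp add: u_def)
    have su: "kd s \<sigma> + f k * kd u \<sigma> = 0" if "\<sigma> \<subseteq> V" for \<sigma>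
      using dw that by (simp add: mulS s_def[symmetric] u_def[symmetric] kd_add kd_mult)
    have uL: "kd u \<sigma> \<in> gen V L" if s: "\<sigma> \<subseteq> V" for \<sigma>
    proof -
      have "kd u \<sigma> * f k = - kd s \<sigma>"
        using su[OF s] by (simp add: eq_neg_iff_add_eq_0 mult.commute add.commute)
      moreover have "kd s \<sigma> \<in> ?J" by (rule kd_gen[OF _ s]) (rule sJ)
      ultimately have "kd u \<sigma> * f k \<in> ?J" by (simp only: gen_uminus)
      moreover have "kd u \<sigma> \<in> polys V" by (rule forms_polys[OF kd_forms[OF _ s]]) (rule uf)
      ultimately show ?thesis using L(2) by blast
    qed
    \<comment> \<open>\<open>L\<close> may be infinite, but there are only finitely many faces, so
      finitely many linear forms generate all boundaries in question.\<close>
    have "\<forall>\<sigma>\<in>Pow V. \<exists>F. finite F \<and> F \<subseteq> L \<and> kd u \<sigma> \<in> gen V F"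
      using gen_finite_support[OF uL] by blast
    then obtain F where F: "\<And>\<sigma>. \<sigma> \<subseteq> V \<Longrightarrow> finite (F \<sigma>) \<and> F \<sigma> \<subseteq> L \<and> kd u \<sigma> \<in> gen V (F \<sigma>)"
      by (metis PowI)
    have "finite (\<Union>\<sigma>\<in>Pow V. F \<sigma>)" using fin F by auto
    then have "\<exists>ls. set ls = (\<Union>\<sigma>\<in>Pow V. F \<sigma>)" by (rule finite_list)
    then obtain ls where ls: "set ls = (\<Union>\<sigma>\<in>Pow V. F \<sigma>)" ..
    have lsL: "set ls \<subseteq> L" using F ls by auto
    have "kd u \<sigma> \<in> gen V (set ls)" if "\<sigma> \<subseteq> V" for \<sigma>
      by (rule gen_mono[of _ _ "F \<sigma>"]) (use F that ls in auto)
    then obtain y1 where y1: "\<forall>\<sigma>\<subseteq>V. y1 \<sigma> \<in> forms V e \<and> u \<sigma> - kd y1 \<sigma> \<in> gen V (set ls)"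
      using koszul_linear_quotient[of ls u e] lsL L(1) uf by blast
    \<comment> \<open>The remainder \<open>u \<sigma> - kd y1 \<sigma>\<close> lies in the colon
      ideal, so its multiple by \<open>f k\<close> can be rewritten in the earlier
      generators.\<close>
    have "\<exists>a. (\<forall>c. a c \<in> forms V (Suc e)) \<and> f k * (u \<sigma> - kd y1 \<sigma>) = mul k ?F a 0" if s: "\<sigma> \<subseteq> V" for \<sigma>
    proof -
      have "u \<sigma> - kd y1 \<sigma> \<in> gen V L" by (rule gen_mono[OF _ lsL]) (use y1 s in auto)
      then have "u \<sigma> - kd y1 \<sigma> \<in> {g \<in> polys V. g * f k \<in> ?J}" by (simp only: L(2))
      then have "f k * (u \<sigma> - kd y1 \<sigma>) \<in> ?J" by (simp add: mult.commute[of "f k"])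
      moreover have "u \<sigma> - kd y1 \<sigma> \<in> forms V (Suc e)"
        using s uf y1 kd_forms[of y1 e \<sigma>] by auto
      ultimately show ?thesis using Jhom forms_mult[OF fk] by blast
    qed
    then obtain a where a: "\<And>\<sigma> c. \<sigma> \<subseteq> V \<Longrightarrow> a \<sigma> c \<in> forms V (Suc e)"
      "\<And>\<sigma>. \<sigma> \<subseteq> V \<Longrightarrow> f k * (u \<sigma> - kd y1 \<sigma>) = mul k ?F (a \<sigma>) 0" by metis
    \<comment> \<open>Moving that multiple to the first \<open>k\<close> coefficients leaves a cycle
      with values in \<open>?J\<close>, to which the induction hypothesis applies.\<close>
    define w' where "w' \<sigma> c = w \<sigma> c + a \<sigma> c" for \<sigma> c
    have w': "mul k ?F (w' \<sigma>) r = s \<sigma> + f k * u \<sigma> - f k * kd y1 \<sigma>" if "\<sigma> \<subseteq> V" for \<sigma> r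
    proof -
      have "mul k ?F (w' \<sigma>) r = s \<sigma> + mul k ?F (a \<sigma>) 0"
        by (simp add: w'_def s_def mul_def algebra_simps sum.distrib)
      then show ?thesis using a(2)[OF that] by (simp add: algebra_simps)
    qed
    have dw': "kd (\<lambda>\<tau>. mul k ?F (w' \<tau>) r) \<sigma> = 0" if "\<sigma> \<subseteq> V" for \<sigma> r
    proof -
      have "kd (\<lambda>\<tau>. mul k ?F (w' \<tau>) r) \<sigma> = kd (\<lambda>\<sigma>. s \<sigma> + f k * u \<sigma> - f k * kd y1 \<sigma>) \<sigma>"
        by (rule kd_cong[OF w' that])
      then show ?thesis using su[OF that] that by (simp add: kd_diff kd_add kd_mult kd_kd)
    qed
    have wf': "w' \<sigma> c \<in> forms V (Suc e)" if "\<sigma> \<subseteq> V" "c < k" for \<sigma> c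
      using w a that by (auto simp: w'_def)
    obtain y2 where y2: "\<And>\<sigma> c. \<sigma> \<subseteq> V \<Longrightarrow> c < k \<Longrightarrow> y2 \<sigma> c \<in> forms V e"
      "\<And>\<sigma> r. \<sigma> \<subseteq> V \<Longrightarrow> r < 1 \<Longrightarrow> mul k ?F (w' \<sigma>) r = kd (\<lambda>\<tau>. mul k ?F (y2 \<tau>) r) \<sigma>"
      by (rule acyclic_imageE[OF IH, of w' e]) (use wf' dw' in auto)
    define y where "y \<sigma> c = (if c = k then y1 \<sigma> else y2 \<sigma> c)" for \<sigma> c
    show "\<exists>y. (\<forall>\<sigma>\<subseteq>V. \<forall>c<Suc k. y \<sigma> c \<in> forms V e) \<and>
        (\<forall>\<sigma>\<subseteq>V. \<forall>r<1. mul (Suc k) ?F (w \<sigma>) r = kd (\<lambda>\<tau>. mul (Suc k) ?F (y \<tau>) r) \<sigma>)"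
    proof (intro exI[of _ y] conjI allI impI)
      fix \<sigma> and c :: nat assume "\<sigma> \<subseteq> V" "c < Suc k"
      then show "y \<sigma> c \<in> forms V e" using y1 y2 by (auto simp: y_def)
    next
      fix \<sigma> and r :: nat assume s: "\<sigma> \<subseteq> V" and "r < 1"
      have m: "mul (Suc k) ?F (y \<tau>) r = mul k ?F (y2 \<tau>) 0 + f k * y1 \<tau>" for \<tau>
        unfolding mulS by (simp add: y_def mul_def)
      have "kd (\<lambda>\<tau>. mul (Suc k) ?F (y \<tau>) r) \<sigma> = mul k ?F (w' \<sigma>) 0 + f k * kd y1 \<sigma>"
        using y2(2)[OF s] by (simp add: m kd_add kd_mult)
      also have "\<dots> = mul (Suc k) ?F (w \<sigma>) r"
        by (simp add: w'[OF s] mulS s_def u_def)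
      finally show "mul (Suc k) ?F (w \<sigma>) r = kd (\<lambda>\<tau>. mul (Suc k) ?F (y \<tau>) r) \<sigma>" ..
    qed
  qed
qed

end

section \<open>Linear resolutions\<close>

lemma sum_fun_apply: "(\<Sum>i\<in>A. f i) x = (\<Sum>i\<in>A. f i x)"
  by (induction A rule: infinite_finite_induct) simp_all

context koszul
begin

lemma mul_0: "(\<And>c. c < b \<Longrightarrow> v c = 0) \<Longrightarrow> mul b A v r = 0"
  by (simp add: mul_def)

lemma mul_sum: "mul b A (\<lambda>c. \<Sum>i\<in>I. f i c) r = (\<Sum>i\<in>I. mul b A (f i) r)"
  by (induction I rule: infinite_finite_induct) (simp_all add: mul_add mul_0)

lemma mul_mul:
  assumes "\<And>c'. c' < b' \<Longrightarrow> mul b A (\<lambda>c. B c c') r = 0"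
  shows "mul b A (mul b' B u) r = 0"
proof -
  have "mul b A (mul b' B u) r = (\<Sum>c<b. \<Sum>c'<b'. A r c * B c c' * u c')"
    by (simp add: mul_def sum_distrib_left mult.assoc)
  also have "\<dots> = (\<Sum>c'<b'. \<Sum>c<b. A r c * B c c' * u c')"
    by (rule sum.swap)
  also have "\<dots> = (\<Sum>c'<b'. mul b A (\<lambda>c. B c c') r * u c')"
    by (simp add: mul_def sum_distrib_right)
  finally show ?thesis using assms by simp
qed

lemma hcomp_kernel:
  assumes "\<And>r c. r < n \<Longrightarrow> c < b \<Longrightarrow> A r c \<in> forms V d"
    and "\<And>c. c < b \<Longrightarrow> v c \<in> polys V" "\<And>r. r < n \<Longrightarrow> mul b A v r = 0" "r < n"
  shows "mul b A (\<lambda>c. hcomp e (v c)) r = 0"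
proof -
  have "mul b A (\<lambda>c. hcomp e (v c)) r = hcomp (d + e) (mul b A v r)"
    using assms by (intro hcomp_mul[symmetric]) auto
  then show ?thesis using assms by simp
qed

text \<open>Every cycle is lifted to the free module, and its boundary there is a cycle in the next syzygy
  module with one layer of faces less.\<close>
lemma linear_complex_acyclic:
  fixes A :: "nat \<Rightarrow> nat \<Rightarrow> nat \<Rightarrow> ('a, 'k::field) mpoly"
  assumes lin: "\<And>i r c. r < N (Suc i) \<Longrightarrow> c < N (Suc (Suc i)) \<Longrightarrow> A (Suc i) r c \<in> forms V (Suc 0)"
    and exact: "\<And>i v. (\<And>c. c < N (Suc i) \<Longrightarrow> v c \<in> polys V) \<Longrightarrow>
      (\<And>r. r < N i \<Longrightarrow> mul (N (Suc i)) (A i) v r = 0) \<Longrightarrow>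
      \<exists>u. (\<forall>c<N (Suc (Suc i)). u c \<in> polys V) \<and>
        (\<forall>r<N (Suc i). v r = mul (N (Suc (Suc i))) (A (Suc i)) u r)"
    and complex: "\<And>i u r. (\<And>c. c < N (Suc (Suc i)) \<Longrightarrow> u c \<in> polys V) \<Longrightarrow> r < N i \<Longrightarrow>
      mul (N (Suc i)) (A i) (mul (N (Suc (Suc i))) (A (Suc i)) u) r = 0"
  shows "acyclic_image (N i) (N (Suc i)) (A i)"
proof -
  \<comment> \<open>Induction on a strict bound \<open>k\<close> for the size of the faces carrying
    \<open>w\<close>, for all positions \<open>i\<close> of the complex simultaneously.\<close>
  have main: "\<exists>y. (\<forall>\<sigma>\<subseteq>V. \<forall>c<N (Suc i). y \<sigma> c \<in> forms V e) \<and>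
        (\<forall>\<sigma>\<subseteq>V. \<forall>r<N i. mul (N (Suc i)) (A i) (w \<sigma>) r = kd (\<lambda>\<tau>. mul (N (Suc i)) (A i) (y \<tau>) r) \<sigma>)"
    if "\<And>\<sigma> c. \<sigma> \<subseteq> V \<Longrightarrow> c < N (Suc i) \<Longrightarrow> w \<sigma> c \<in> forms V (Suc e)"
      and "\<And>\<sigma> r. \<sigma> \<subseteq> V \<Longrightarrow> r < N i \<Longrightarrow> kd (\<lambda>\<tau>. mul (N (Suc i)) (A i) (w \<tau>) r) \<sigma> = 0"
      and "\<And>\<sigma> c. \<sigma> \<subseteq> V \<Longrightarrow> c < N (Suc i) \<Longrightarrow> k \<le> card \<sigma> \<Longrightarrow> w \<sigma> c = 0" for i e k w
    using that
  proof (induction k arbitrary: i e w)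
    case 0
    have "mul (N (Suc i)) (A i) (w \<sigma>) r = 0" if "\<sigma> \<subseteq> V" for \<sigma> r
      by (rule mul_0) (use 0(3) that in auto)
    moreover have "mul (N (Suc i)) (A i) (\<lambda>c. 0) r = 0" for r by (rule mul_0) simp
    ultimately show ?case by (intro exI[of _ "\<lambda>\<sigma> c. 0"]) simp
  next
    case (Suc k)
    let ?n = "N i" and ?b = "N (Suc i)" and ?b' = "N (Suc (Suc i))"
    note w = Suc.prems(1) and dw = Suc.prems(2) and supp = Suc.prems(3)
    have dwf: "kd (\<lambda>\<tau>. w \<tau> c) \<sigma> \<in> forms V (Suc (Suc e))" if "\<sigma> \<subseteq> V" "c < ?b" for \<sigma> c
      by (rule kd_forms) (use w that in auto)
    \<comment> \<open>The boundary of \<open>w\<close> is killed by \<open>A i\<close>, so exactness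
      lifts it. The degree gained by the differential is absorbed by the linear entries of
      \<open>A (Suc i)\<close>, so \<open>u\<close> has the same degree as \<open>w\<close>. On
      faces of size at least \<open>k\<close> the boundary vanishes, and \<open>u\<close> is chosen
      zero there to keep the smaller bound.\<close>
    have "\<exists>u. (\<forall>c<?b'. u c \<in> forms V (Suc e)) \<and> (k \<le> card \<sigma> \<longrightarrow> (\<forall>c. u c = 0)) \<and>
      (\<forall>c<?b. kd (\<lambda>\<tau>. w \<tau> c) \<sigma> = mul ?b' (A (Suc i)) u c)" if s: "\<sigma> \<subseteq> V" for \<sigma>
    proof (cases "k \<le> card \<sigma>")
      case True
      have "kd (\<lambda>\<tau>. w \<tau> c) \<sigma> = 0" if "c < ?b" for c
        unfolding kd_def
      proof (rule sum.neutral, rule ballI)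
        fix v assume v: "v \<in> V - \<sigma>"
        have "w (insert v \<sigma>) c = 0"
          using s v True fin finite_subset[OF s fin] that by (intro supp) auto
        then show "single 0 (sg v \<sigma>) * (Var v * w (insert v \<sigma>) c) = 0" by simp
      qed
      moreover have "mul ?b' (A (Suc i)) (\<lambda>c. 0) c = 0" for c by (rule mul_0) simp
      ultimately show ?thesis by (intro exI[of _ "\<lambda>c. 0"]) simp
    next
      case False
      have "\<exists>u. (\<forall>c<?b'. u c \<in> polys V) \<and> (\<forall>c<?b. kd (\<lambda>\<tau>. w \<tau> c) \<sigma> = mul ?b' (A (Suc i)) u c)"
        by (rule exact) (use dw[OF s] forms_polys[OF dwf[OF s]] in \<open>auto simp: kd_mul\<close>)
      then obtain u where u: "\<And>c. c < ?b' \<Longrightarrow> u c \<in> polys V"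
        "\<And>c. c < ?b \<Longrightarrow> kd (\<lambda>\<tau>. w \<tau> c) \<sigma> = mul ?b' (A (Suc i)) u c" by blast
      have "kd (\<lambda>\<tau>. w \<tau> c) \<sigma> = mul ?b' (A (Suc i)) (\<lambda>c. hcomp (Suc e) (u c)) c" if c: "c < ?b" for c
      proof -
        have "kd (\<lambda>\<tau>. w \<tau> c) \<sigma> = hcomp (Suc 0 + Suc e) (mul ?b' (A (Suc i)) u c)"
          using hcomp_same[OF dwf[OF s c]] u(2)[OF c] by simp
        also have "\<dots> = mul ?b' (A (Suc i)) (\<lambda>c. hcomp (Suc e) (u c)) c"
          by (rule hcomp_mul) (use lin c u in auto)
        finally show ?thesis .
      qed
      then show ?thesis using False hcomp_forms[OF u(1)]
        by (intro exI[of _ "\<lambda>c. hcomp (Suc e) (u c)"]) auto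
    qed
    then obtain u where u: "\<And>\<sigma> c. \<sigma> \<subseteq> V \<Longrightarrow> c < ?b' \<Longrightarrow> u \<sigma> c \<in> forms V (Suc e)"
      "\<And>\<sigma> c. \<sigma> \<subseteq> V \<Longrightarrow> k \<le> card \<sigma> \<Longrightarrow> u \<sigma> c = 0"
      "\<And>\<sigma> c. \<sigma> \<subseteq> V \<Longrightarrow> c < ?b \<Longrightarrow> kd (\<lambda>\<tau>. w \<tau> c) \<sigma> = mul ?b' (A (Suc i)) (u \<sigma>) c" by metis
    have "kd (\<lambda>\<tau>. mul ?b' (A (Suc i)) (u \<tau>) c) \<sigma> = 0" if "\<sigma> \<subseteq> V" "c < ?b" for \<sigma> c
    proof -
      have "kd (\<lambda>\<tau>. mul ?b' (A (Suc i)) (u \<tau>) c) \<sigma> = kd (kd (\<lambda>\<tau>. w \<tau> c)) \<sigma>"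
        by (rule kd_cong[OF _ that(1)]) (simp add: u(3) that)
      then show ?thesis by (simp only: kd_kd[OF that(1)])
    qed
    then have "\<exists>y. (\<forall>\<sigma>\<subseteq>V. \<forall>c<?b'. y \<sigma> c \<in> forms V e) \<and>
        (\<forall>\<sigma>\<subseteq>V. \<forall>r<?b. mul ?b' (A (Suc i)) (u \<sigma>) r = kd (\<lambda>\<tau>. mul ?b' (A (Suc i)) (y \<tau>) r) \<sigma>)"
      by (intro Suc.IH) (use u in auto)
    then obtain y where y: "\<forall>\<sigma>\<subseteq>V. \<forall>c<?b'. y \<sigma> c \<in> forms V e"
      "\<forall>\<sigma>\<subseteq>V. \<forall>r<?b. mul ?b' (A (Suc i)) (u \<sigma>) r = kd (\<lambda>\<tau>. mul ?b' (A (Suc i)) (y \<tau>) r) \<sigma>"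
      by (elim exE conjE) (rule that)
    note y = y[rule_format]
    \<comment> \<open>After this correction \<open>w'\<close> is a Koszul cycle in the free module,
      hence a boundary. \<open>A i\<close> does not see the correction, because consecutive maps
      compose to zero.\<close>
    define w' where "w' \<sigma> c = w \<sigma> c - mul ?b' (A (Suc i)) (y \<sigma>) c" for \<sigma> c
    have w'f: "w' \<sigma> c \<in> forms V (Suc e)" if "\<sigma> \<subseteq> V" "c < ?b" for \<sigma> c
    proof -
      have "mul ?b' (A (Suc i)) (y \<sigma>) c \<in> forms V (Suc 0 + e)"
        by (rule mul_forms) (use that y lin in auto)
      then show ?thesis using w that by (simp add: w'_def)
    qed
    have w'0: "kd (\<lambda>\<tau>. w' \<tau> c) \<sigma> = 0" if "\<sigma> \<subseteq> V" "c < ?b" for \<sigma> c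
      using u(3)[OF that] y(2)[OF that] by (simp add: w'_def kd_diff)
    have "\<exists>s. \<forall>\<sigma>\<subseteq>V. s \<sigma> \<in> forms V e \<and> kd s \<sigma> = w' \<sigma> c" if "c < ?b" for c
      using koszul_exact[of "\<lambda>\<tau>. w' \<tau> c" e] w'f w'0 that by metis
    then obtain s where s: "\<And>c \<sigma>. c < ?b \<Longrightarrow> \<sigma> \<subseteq> V \<Longrightarrow> s c \<sigma> \<in> forms V e"
      "\<And>c \<sigma>. c < ?b \<Longrightarrow> \<sigma> \<subseteq> V \<Longrightarrow> kd (s c) \<sigma> = w' \<sigma> c" by metis
    show ?case
    proof (intro exI[of _ "\<lambda>\<sigma> c. s c \<sigma>"] conjI allI impI)
      fix \<sigma> r assume sr: "\<sigma> \<subseteq> V" "r < ?n"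
      have "kd (\<lambda>\<tau>. mul ?b (A i) (\<lambda>c. s c \<tau>) r) \<sigma> = mul ?b (A i) (\<lambda>c. w' \<sigma> c) r"
        unfolding kd_mul by (rule mul_cong) (use s sr in auto)
      also have "\<dots> = mul ?b (A i) (w \<sigma>) r - mul ?b (A i) (mul ?b' (A (Suc i)) (y \<sigma>)) r"
        unfolding w'_def by (rule mul_diff)
      also have "mul ?b (A i) (mul ?b' (A (Suc i)) (y \<sigma>)) r = 0"
        using sr y(1) forms_polys by (intro complex) blast+
      finally show "mul ?b (A i) (w \<sigma>) r = kd (\<lambda>\<tau>. mul ?b (A i) (\<lambda>c. s c \<tau>) r) \<sigma>" by simp
    qed (use s in auto)
  qed
  show ?thesis unfolding acyclic_image_def
  proof (intro allI impI)
    fix e and w :: "'a set \<Rightarrow> nat \<Rightarrow> ('a, 'k) mpoly"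
    assume w: "\<forall>\<sigma>\<subseteq>V. \<forall>c<N (Suc i). w \<sigma> c \<in> forms V (Suc e)"
      and dw: "\<forall>\<sigma>\<subseteq>V. \<forall>r<N i. kd (\<lambda>\<tau>. mul (N (Suc i)) (A i) (w \<tau>) r) \<sigma> = 0"
    show "\<exists>y. (\<forall>\<sigma>\<subseteq>V. \<forall>c<N (Suc i). y \<sigma> c \<in> forms V e) \<and>
        (\<forall>\<sigma>\<subseteq>V. \<forall>r<N i. mul (N (Suc i)) (A i) (w \<sigma>) r = kd (\<lambda>\<tau>. mul (N (Suc i)) (A i) (y \<tau>) r) \<sigma>)"
    \<comment> \<open>No face has more than \<open>card V\<close> elements, so the bound holds
      vacuously.\<close>
    proof (rule main[of i w e "Suc (card V)"])
      fix \<sigma> c assume "\<sigma> \<subseteq> V" "Suc (card V) \<le> card \<sigma>"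
      then show "w \<sigma> c = 0" using card_mono[OF fin, of \<sigma>] by simp
    qed (use w dw in auto)
  qed
qed

text \<open>Linear independence of the columns over the base field. It excludes syzygies of degree
  0, so that every syzygy module starts in degree 1.\<close>

definition no_constants :: "nat \<Rightarrow> nat \<Rightarrow> (nat \<Rightarrow> nat \<Rightarrow> ('a, 'k::field) mpoly) \<Rightarrow> bool" where
  "no_constants n b A \<longleftrightarrow> (\<forall>v. (\<forall>c<b. v c \<in> forms V 0) \<longrightarrow> (\<forall>r<n. mul b A v r = 0) \<longrightarrow> (\<forall>c<b. v c = 0))"

text \<open>The linear syzygies form a finite-dimensional vector space over the base field. A basis,
  taken as the columns of \<open>B\<close>, spans them all and by its independence gives
  \<open>B\<close> the property \<open>no_constants\<close>.\<close>

lemma linear_syzygies_basis: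
  fixes A :: "nat \<Rightarrow> nat \<Rightarrow> ('a, 'k::field) mpoly"
  obtains b' and B :: "nat \<Rightarrow> nat \<Rightarrow> ('a, 'k) mpoly" where
    "\<And>c c'. c < b \<Longrightarrow> c' < b' \<Longrightarrow> B c c' \<in> forms V (Suc 0)"
    "\<And>c' r. c' < b' \<Longrightarrow> r < n \<Longrightarrow> mul b A (\<lambda>c. B c c') r = 0"
    "\<And>v. (\<And>c. c < b \<Longrightarrow> v c \<in> forms V (Suc 0)) \<Longrightarrow> (\<And>r. r < n \<Longrightarrow> mul b A v r = 0) \<Longrightarrow>
      \<exists>u. (\<forall>c<b'. u c \<in> forms V 0) \<and> (\<forall>c<b. v c = mul b' B u c)"
    "no_constants b b' B"
proof -
  define scale :: "'k \<Rightarrow> (nat \<Rightarrow> ('a, 'k) mpoly) \<Rightarrow> (nat \<Rightarrow> ('a, 'k) mpoly)"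
    where "scale k v = (\<lambda>c. single 0 k * v c)" for k v
  interpret vs: vector_space scale
    by unfold_locales (auto simp: scale_def fun_eq_iff algebra_simps single_add mult_single)
  \<comment> \<open>Vectors are functions on all natural numbers; setting the entries beyond
    \<open>b\<close> to zero makes them determined by the first \<open>b\<close> entries.\<close>
  define Z where "Z = {v. (\<forall>c<b. v c \<in> forms V (Suc 0)) \<and> (\<forall>c\<ge>b. v c = 0) \<and> (\<forall>r<n. mul b A v r = 0)}"
  obtain S where S: "S \<subseteq> Z" "vs.independent S" "Z \<subseteq> vs.span S"
    by (rule vs.maximal_independent_subset[of Z]) (rule that)
  let ?X = "\<lambda>x. single x (1::nat)"
  \<comment> \<open>Unit vectors times variables span all vectors of linear forms, which bounds the
    dimension.\<close>
  define el where "el = (\<lambda>(i, x). (\<lambda>c. if c = i then Var x else 0) :: nat \<Rightarrow> ('a, 'k) mpoly)"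
  define T where "T = el ` ({..<b} \<times> V)"
  have "v \<in> vs.span T" if v: "v \<in> Z" for v
  proof -
    have "v = (\<Sum>i<b. \<Sum>x\<in>V. scale (coef (v i) (?X x)) (el (i, x)))"
    proof
      fix c
      have "(\<Sum>i<b. \<Sum>x\<in>V. scale (coef (v i) (?X x)) (el (i, x))) c
          = (\<Sum>i<b. if i = c then (\<Sum>x\<in>V. single 0 (coef (v c) (?X x)) * Var x) else 0)"
        unfolding sum_fun_apply by (rule sum.cong) (auto simp: scale_def el_def)
      also have "\<dots> = v c"
        using v forms_1_sum[OF _ fin, of "v c"] by (auto simp: Z_def)
      finally show "v c = (\<Sum>i<b. \<Sum>x\<in>V. scale (coef (v i) (?X x)) (el (i, x))) c" ..
    qed
    also have "\<dots> \<in> vs.span T"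
      by (intro vs.span_sum vs.span_scale vs.span_base) (auto simp: T_def)
    finally show ?thesis .
  qed
  then have "S \<subseteq> vs.span T" using S by blast
  moreover have "finite T" unfolding T_def using fin by blast
  ultimately have finS: "finite S" using vs.independent_span_bound[OF _ S(2)] by blast
  then obtain f where f: "bij_betw f {..<card S} S" 
    by (metis ex_bij_betw_nat_finite lessThan_atLeast0)
  define B where "B c c' = f c' c" for c c'
  have fZ: "f c' \<in> Z" if "c' < card S" for c' using f that S(1) by (auto simp: bij_betw_def)
  have comb: "(\<Sum>a\<in>S. scale (k a) a) c = mul (card S) B (\<lambda>c'. single 0 (k (f c'))) c" for k c
  proof -
    have "(\<Sum>a\<in>S. scale (k a) a) = (\<Sum>c'<card S. scale (k (f c')) (f c'))"
      by (rule sum.reindex_bij_betw[OF f, symmetric])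
    then show ?thesis by (simp add: sum_fun_apply mul_def scale_def B_def mult.commute)
  qed
  show thesis
  proof (rule that[of "card S" B])
    fix v assume v: "\<And>c. c < b \<Longrightarrow> v c \<in> forms V (Suc 0)" "\<And>r. r < n \<Longrightarrow> mul b A v r = 0"
    define v' where "v' c = (if c < b then v c else 0)" for c
    have "mul b A v' r = mul b A v r" for r by (rule mul_cong) (simp add: v'_def)
    then have "v' \<in> Z" using v by (auto simp: Z_def v'_def)
    then have "v' \<in> vs.span S" using S by blast
    then obtain k where k: "v' = (\<Sum>a\<in>S. scale (k a) a)"
      unfolding vs.span_finite[OF finS] by blast
    have "v c = mul (card S) B (\<lambda>c'. single 0 (k (f c'))) c" if "c < b" for c
      using that comb[of k c] by (simp add: v'_def flip: k)
    then show "\<exists>u. (\<forall>c<card S. u c \<in> forms V 0) \<and> (\<forall>c<b. v c = mul (card S) B u c)"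
      by (intro exI[of _ "\<lambda>c'. single 0 (k (f c'))"]) auto
  next
    show "no_constants b (card S) B"
      unfolding no_constants_def
    proof (intro allI impI)
      fix u :: "nat \<Rightarrow> ('a, 'k) mpoly" and c'
      assume u: "\<forall>c<card S. u c \<in> forms V 0" "\<forall>r<b. mul (card S) B u r = 0" and c': "c' < card S"
      define k where "k a = coef (u (the_inv_into {..<card S} f a)) 0" for a
      have kf: "k (f c) = coef (u c) 0" if "c < card S" for c
        using that f by (simp add: k_def the_inv_into_f_f bij_betw_def)
      have "(\<Sum>a\<in>S. scale (k a) a) = 0"
      proof
        fix c
        have "(\<Sum>a\<in>S. scale (k a) a) c = mul (card S) B u c"
          unfolding comb by (rule mul_cong) (use u kf forms_0_single in metis)
        also have "\<dots> = 0"
        proof (cases "c < b")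
          case False
          then have "B c c' = 0" if "c' < card S" for c' using fZ[OF that] by (auto simp: Z_def B_def)
          then show ?thesis by (simp add: mul_def)
        qed (use u in simp)
        finally show "(\<Sum>a\<in>S. scale (k a) a) c = 0 c" by simp
      qed
      then have "k (f c') = 0"
        using S(2) finS f c' unfolding vs.dependent_finite[OF finS] by (auto simp: bij_betw_def)
      then show "u c' = 0" using kf[OF c'] forms_0_single[of "u c'" V] u c' by simp
    qed
  qed (use fZ in \<open>auto simp: Z_def B_def\<close>)
qed

text \<open>The free module has no Koszul homology in positive degree, so cycles with values in the
  kernel of \<open>A\<close> are controlled by cycles in its image, where acyclicity is known. At
  the empty face this shows that the linear syzygies generate all syzygies; for general chains it
  shows that \<open>B\<close> is acyclic again.\<close>

lemma acyclic_image_next: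
  fixes A :: "nat \<Rightarrow> nat \<Rightarrow> ('a, 'k::field) mpoly"
  assumes A: "\<And>r c. r < n \<Longrightarrow> c < b \<Longrightarrow> A r c \<in> forms V d"
    and acyc: "acyclic_image n b A" and nc: "no_constants n b A"
  obtains b' and B :: "nat \<Rightarrow> nat \<Rightarrow> ('a, 'k) mpoly" where
    "\<And>c c'. c < b \<Longrightarrow> c' < b' \<Longrightarrow> B c c' \<in> forms V (Suc 0)"
    "\<And>c' r. c' < b' \<Longrightarrow> r < n \<Longrightarrow> mul b A (\<lambda>c. B c c') r = 0"
    "\<And>v. (\<And>c. c < b \<Longrightarrow> v c \<in> polys V) \<Longrightarrow> (\<And>r. r < n \<Longrightarrow> mul b A v r = 0) \<Longrightarrow>
      \<exists>u. (\<forall>c<b'. u c \<in> polys V) \<and> (\<forall>c<b. v c = mul b' B u c)"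
    "acyclic_image b b' B" "no_constants b b' B"
proof -
  obtain b' and B :: "nat \<Rightarrow> nat \<Rightarrow> ('a, 'k) mpoly" where
    B: "\<And>c c'. c < b \<Longrightarrow> c' < b' \<Longrightarrow> B c c' \<in> forms V (Suc 0)"
      "\<And>c' r. c' < b' \<Longrightarrow> r < n \<Longrightarrow> mul b A (\<lambda>c. B c c') r = 0"
    and base: "\<And>v. (\<And>c. c < b \<Longrightarrow> v c \<in> forms V (Suc 0)) \<Longrightarrow> (\<And>r. r < n \<Longrightarrow> mul b A v r = 0) \<Longrightarrow>
      \<exists>u. (\<forall>c<b'. u c \<in> forms V 0) \<and> (\<forall>c<b. v c = mul b' B u c)"
    and ncB: "no_constants b b' B"
    using linear_syzygies_basis[where b = b and n = n and A = A] by blast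
  have AB: "mul b A (mul b' B u) r = 0" if "r < n" for u r
    by (rule mul_mul) (use B(2) that in auto)
  \<comment> \<open>In the free module \<open>z\<close> is the boundary of some \<open>w\<close>.
    \<open>A\<close> maps \<open>w\<close> to a cycle, hence to the boundary of \<open>A\<close>
    applied to some \<open>y\<close>. Then \<open>w - kd y\<close> has the same boundary
    \<open>z\<close> and lies in the kernel.\<close>
  have correct: "\<exists>w'. (\<forall>\<sigma>\<subseteq>V. \<forall>c<b. w' \<sigma> c \<in> forms V (Suc e) \<and> kd (\<lambda>\<tau>. w' \<tau> c) \<sigma> = z \<sigma> c) \<and>
      (\<forall>\<sigma>\<subseteq>V. \<forall>r<n. mul b A (w' \<sigma>) r = 0)"
    if z: "\<And>\<sigma> c. \<sigma> \<subseteq> V \<Longrightarrow> c < b \<Longrightarrow> z \<sigma> c \<in> forms V (Suc (Suc e))"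
      and dz: "\<And>\<sigma> c. \<sigma> \<subseteq> V \<Longrightarrow> c < b \<Longrightarrow> kd (\<lambda>\<tau>. z \<tau> c) \<sigma> = 0"
      and Az: "\<And>\<sigma> r. \<sigma> \<subseteq> V \<Longrightarrow> r < n \<Longrightarrow> mul b A (z \<sigma>) r = 0" for z e
  proof -
    have "\<exists>w. \<forall>\<sigma>\<subseteq>V. w \<sigma> \<in> forms V (Suc e) \<and> kd w \<sigma> = z \<sigma> c" if "c < b" for c
      using koszul_exact[of "\<lambda>\<tau>. z \<tau> c" "Suc e"] z dz that by metis
    then obtain w where w: "\<And>c \<sigma>. c < b \<Longrightarrow> \<sigma> \<subseteq> V \<Longrightarrow> w c \<sigma> \<in> forms V (Suc e)"
      "\<And>c \<sigma>. c < b \<Longrightarrow> \<sigma> \<subseteq> V \<Longrightarrow> kd (w c) \<sigma> = z \<sigma> c" by metis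
    have "kd (\<lambda>\<tau>. mul b A (\<lambda>c. w c \<tau>) r) \<sigma> = 0" if "\<sigma> \<subseteq> V" "r < n" for \<sigma> r
    proof -
      have "kd (\<lambda>\<tau>. mul b A (\<lambda>c. w c \<tau>) r) \<sigma> = mul b A (z \<sigma>) r"
        unfolding kd_mul by (rule mul_cong) (use w that in auto)
      then show ?thesis using Az that by simp
    qed
    then obtain y where y: "\<And>\<sigma> c. \<sigma> \<subseteq> V \<Longrightarrow> c < b \<Longrightarrow> y \<sigma> c \<in> forms V e"
      "\<And>\<sigma> r. \<sigma> \<subseteq> V \<Longrightarrow> r < n \<Longrightarrow> mul b A (\<lambda>c. w c \<sigma>) r = kd (\<lambda>\<tau>. mul b A (y \<tau>) r) \<sigma>"
      using acyclic_imageE[OF acyc, of "\<lambda>\<sigma> c. w c \<sigma>" e] w(1) by blast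
    show ?thesis
    proof (intro exI[of _ "\<lambda>\<sigma> c. w c \<sigma> - kd (\<lambda>\<tau>. y \<tau> c) \<sigma>"] conjI allI impI)
      fix \<sigma> c assume s: "\<sigma> \<subseteq> V" "c < b"
      have "kd (\<lambda>\<tau>. y \<tau> c) \<sigma> \<in> forms V (Suc e)" by (rule kd_forms) (use y s in auto)
      then show "w c \<sigma> - kd (\<lambda>\<tau>. y \<tau> c) \<sigma> \<in> forms V (Suc e)" using w s by simp
      show "kd (\<lambda>\<tau>. w c \<tau> - kd (\<lambda>\<tau>. y \<tau> c) \<tau>) \<sigma> = z \<sigma> c"
        using w(2)[OF s(2,1)] kd_kd[OF s(1), of "\<lambda>\<tau>. y \<tau> c"] by (simp add: kd_diff)
    next
      fix \<sigma> r assume "\<sigma> \<subseteq> V" "r < n"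
      then show "mul b A (\<lambda>c. w c \<sigma> - kd (\<lambda>\<tau>. y \<tau> c) \<sigma>) r = 0"
        using y(2)[of \<sigma> r] by (simp add: mul_diff kd_mul)
    qed
  qed
  \<comment> \<open>That syzygies of degree \<open>e + 1\<close> come from \<open>B\<close> is kept
    as a hypothesis here, because this very fact is proved by an induction that uses
    \<open>lift\<close>.\<close>
  have lift: "\<exists>t. (\<forall>\<sigma>\<subseteq>V. \<forall>c<b'. t \<sigma> c \<in> forms V e) \<and> (\<forall>\<sigma>\<subseteq>V. \<forall>c<b. z \<sigma> c = kd (\<lambda>\<tau>. mul b' B (t \<tau>) c) \<sigma>)"
    if z: "\<And>\<sigma> c. \<sigma> \<subseteq> V \<Longrightarrow> c < b \<Longrightarrow> z \<sigma> c \<in> forms V (Suc (Suc e))"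
      and dz: "\<And>\<sigma> c. \<sigma> \<subseteq> V \<Longrightarrow> c < b \<Longrightarrow> kd (\<lambda>\<tau>. z \<tau> c) \<sigma> = 0"
      and Az: "\<And>\<sigma> r. \<sigma> \<subseteq> V \<Longrightarrow> r < n \<Longrightarrow> mul b A (z \<sigma>) r = 0"
      and gen: "\<And>v. (\<And>c. c < b \<Longrightarrow> v c \<in> forms V (Suc e)) \<Longrightarrow> (\<And>r. r < n \<Longrightarrow> mul b A v r = 0) \<Longrightarrow>
        \<exists>u. (\<forall>c<b'. u c \<in> forms V e) \<and> (\<forall>c<b. v c = mul b' B u c)" for z e
  proof -
    have "\<exists>w'. (\<forall>\<sigma>\<subseteq>V. \<forall>c<b. w' \<sigma> c \<in> forms V (Suc e) \<and> kd (\<lambda>\<tau>. w' \<tau> c) \<sigma> = z \<sigma> c) \<and>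
      (\<forall>\<sigma>\<subseteq>V. \<forall>r<n. mul b A (w' \<sigma>) r = 0)"
      by (rule correct) (use z dz Az in auto)
    then obtain w' where "\<forall>\<sigma>\<subseteq>V. \<forall>c<b. w' \<sigma> c \<in> forms V (Suc e) \<and> kd (\<lambda>\<tau>. w' \<tau> c) \<sigma> = z \<sigma> c"
      "\<forall>\<sigma>\<subseteq>V. \<forall>r<n. mul b A (w' \<sigma>) r = 0" by (elim exE conjE) (rule that)
    then have w': "\<And>\<sigma> c. \<sigma> \<subseteq> V \<Longrightarrow> c < b \<Longrightarrow> w' \<sigma> c \<in> forms V (Suc e)"
      "\<And>\<sigma> c. \<sigma> \<subseteq> V \<Longrightarrow> c < b \<Longrightarrow> kd (\<lambda>\<tau>. w' \<tau> c) \<sigma> = z \<sigma> c"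
      "\<And>\<sigma> r. \<sigma> \<subseteq> V \<Longrightarrow> r < n \<Longrightarrow> mul b A (w' \<sigma>) r = 0" by simp_all
    have "\<exists>u. (\<forall>c<b'. u c \<in> forms V e) \<and> (\<forall>c<b. w' \<sigma> c = mul b' B u c)" if "\<sigma> \<subseteq> V" for \<sigma>
      by (rule gen) (use w' that in auto)
    then obtain t where t: "\<And>\<sigma> c. \<sigma> \<subseteq> V \<Longrightarrow> c < b' \<Longrightarrow> t \<sigma> c \<in> forms V e"
      "\<And>\<sigma> c. \<sigma> \<subseteq> V \<Longrightarrow> c < b \<Longrightarrow> w' \<sigma> c = mul b' B (t \<sigma>) c" by metis
    have "z \<sigma> c = kd (\<lambda>\<tau>. mul b' B (t \<tau>) c) \<sigma>" if "\<sigma> \<subseteq> V" "c < b" for \<sigma> c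
    proof -
      have "kd (\<lambda>\<tau>. mul b' B (t \<tau>) c) \<sigma> = kd (\<lambda>\<tau>. w' \<tau> c) \<sigma>"
        by (rule kd_cong) (use t that in auto)
      then show ?thesis using w'(2)[OF that] by simp
    qed
    with t(1) show ?thesis by blast
  qed
  have gen: "\<exists>u. (\<forall>c<b'. u c \<in> forms V e) \<and> (\<forall>c<b. v c = mul b' B u c)"
    if "\<And>c. c < b \<Longrightarrow> v c \<in> forms V (Suc e)" "\<And>r. r < n \<Longrightarrow> mul b A v r = 0" for e v
    using that
  proof (induction e arbitrary: v)
    case 0
    then show ?case by (rule base)
  next
    case (Suc e)
    \<comment> \<open>A syzygy placed on the empty face is a cycle automatically, because the
      differential at any face reads only nonempty ones. Writing it as a boundary of syzygies lowers
      the degree by one.\<close>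
    define z where "z \<sigma> c = (if \<sigma> = {} then v c else 0)" for \<sigma> :: "'a set" and c
    have "\<exists>t. (\<forall>\<sigma>\<subseteq>V. \<forall>c<b'. t \<sigma> c \<in> forms V e) \<and> (\<forall>\<sigma>\<subseteq>V. \<forall>c<b. z \<sigma> c = kd (\<lambda>\<tau>. mul b' B (t \<tau>) c) \<sigma>)"
    proof (rule lift)
      fix \<sigma> :: "'a set" and r :: nat assume "r < n"
      then show "mul b A (z \<sigma>) r = 0"
        using Suc.prems(2) by (cases "\<sigma> = {}") (simp_all add: z_def[abs_def] mul_0)
    next
      fix \<sigma> :: "'a set" and c
      show "kd (\<lambda>\<tau>. z \<tau> c) \<sigma> = 0" by (simp add: kd_def z_def)
    qed (use Suc in \<open>auto simp: z_def\<close>)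
    then obtain t where t: "\<forall>\<sigma>\<subseteq>V. \<forall>c<b'. t \<sigma> c \<in> forms V e"
      "\<forall>\<sigma>\<subseteq>V. \<forall>c<b. z \<sigma> c = kd (\<lambda>\<tau>. mul b' B (t \<tau>) c) \<sigma>" by (elim exE conjE) (rule that)
    note t = t[rule_format]
    show ?case
    proof (intro exI[of _ "\<lambda>c. kd (\<lambda>\<tau>. t \<tau> c) {}"] conjI allI impI)
      fix c assume "c < b'"
      then show "kd (\<lambda>\<tau>. t \<tau> c) {} \<in> forms V (Suc e)" by (intro kd_forms) (use t in auto)
    next
      fix c assume "c < b"
      then show "v c = mul b' B (\<lambda>c. kd (\<lambda>\<tau>. t \<tau> c) {}) c"
        using t(2)[of "{}" c] by (simp add: z_def kd_mul)
    qed
  qed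
  have all: "\<exists>u. (\<forall>c<b'. u c \<in> polys V) \<and> (\<forall>c<b. v c = mul b' B u c)"
    if v: "\<And>c. c < b \<Longrightarrow> v c \<in> polys V" "\<And>r. r < n \<Longrightarrow> mul b A v r = 0" for v
  proof -
    \<comment> \<open>Each homogeneous component of a syzygy is a syzygy, and the one of degree 0
      vanishes by \<open>no_constants\<close>.\<close>
    have comp: "\<exists>u. (\<forall>c<b'. u c \<in> polys V) \<and> (\<forall>c<b. hcomp e (v c) = mul b' B u c)" for e
    proof (cases e)
      case 0
      have ker: "mul b A (\<lambda>c. hcomp 0 (v c)) r = 0" if "r < n" for r
        by (rule hcomp_kernel[OF A v]) (use that in auto)
      have "hcomp 0 (v c) = 0" if "c < b" for c
        using nc[unfolded no_constants_def, THEN spec, of "\<lambda>c. hcomp 0 (v c)"] ker that hcomp_forms[OF v(1)]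
        by blast
      then show ?thesis using 0 by (intro exI[of _ "\<lambda>c. 0"]) (simp add: mul_0)
    next
      case (Suc e')
      have "\<exists>u. (\<forall>c<b'. u c \<in> forms V e') \<and> (\<forall>c<b. hcomp e (v c) = mul b' B u c)"
      proof (rule gen)
        show "mul b A (\<lambda>c. hcomp e (v c)) r = 0" if "r < n" for r
          by (rule hcomp_kernel[OF A v]) (use that in auto)
      qed (use Suc hcomp_forms[OF v(1)] in auto)
      then show ?thesis using forms_polys by blast
    qed
    then obtain u where u: "\<And>e c. c < b' \<Longrightarrow> u e c \<in> polys V"
      "\<And>e c. c < b \<Longrightarrow> hcomp e (v c) = mul b' B (u e) c" by metis
    have "\<forall>c. \<exists>N. \<forall>M\<ge>N. v c = (\<Sum>e<M. hcomp e (v c))" by (metis hcomp_decomp)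
    then obtain N where N: "\<And>c M. N c \<le> M \<Longrightarrow> v c = (\<Sum>e<M. hcomp e (v c))" by metis
    define M where "M = Max (N ` {..<b})"
    have "v c = mul b' B (\<lambda>c. \<Sum>e<M. u e c) c" if "c < b" for c
    proof -
      have "N c \<le> M" unfolding M_def by (rule Max_ge) (use that in auto)
      then have "v c = (\<Sum>e<M. hcomp e (v c))" by (rule N)
      also have "\<dots> = (\<Sum>e<M. mul b' B (u e) c)" using u(2) that by simp
      also have "\<dots> = mul b' B (\<lambda>c. \<Sum>e<M. u e c) c" by (rule mul_sum[symmetric])
      finally show ?thesis .
    qed
    then show ?thesis using u(1) by (intro exI[of _ "\<lambda>c. \<Sum>e<M. u e c"]) (auto intro: polys_sum)
  qed
  have "acyclic_image b b' B"
    unfolding acyclic_image_def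
  proof (intro allI impI)
    fix e and w :: "'a set \<Rightarrow> nat \<Rightarrow> ('a, 'k) mpoly"
    assume w: "\<forall>\<sigma>\<subseteq>V. \<forall>c<b'. w \<sigma> c \<in> forms V (Suc e)"
      and dw: "\<forall>\<sigma>\<subseteq>V. \<forall>r<b. kd (\<lambda>\<tau>. mul b' B (w \<tau>) r) \<sigma> = 0"
    show "\<exists>y. (\<forall>\<sigma>\<subseteq>V. \<forall>c<b'. y \<sigma> c \<in> forms V e) \<and>
        (\<forall>\<sigma>\<subseteq>V. \<forall>r<b. mul b' B (w \<sigma>) r = kd (\<lambda>\<tau>. mul b' B (y \<tau>) r) \<sigma>)"
    proof (rule lift)
      fix \<sigma> c assume "\<sigma> \<subseteq> V" "c < b"
      then have "mul b' B (w \<sigma>) c \<in> forms V (Suc 0 + Suc e)"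
        by (intro mul_forms) (use w B in auto)
      then show "mul b' B (w \<sigma>) c \<in> forms V (Suc (Suc e))" by simp
    qed (use dw AB gen in auto)
  qed
  with B all ncB show thesis by (intro that[of b' B]) auto
qed

lemma acyclic_linear_complex:
  fixes A :: "nat \<Rightarrow> nat \<Rightarrow> ('a, 'k::field) mpoly"
  assumes A: "\<And>r c. r < n \<Longrightarrow> c < b \<Longrightarrow> A r c \<in> forms V d"
    and acyc: "acyclic_image n b A" and nc: "no_constants n b A"
  obtains N and C :: "nat \<Rightarrow> nat \<Rightarrow> nat \<Rightarrow> ('a, 'k) mpoly" where "N 0 = n" "N (Suc 0) = b" "C 0 = A"
    "\<And>i r c. r < N (Suc i) \<Longrightarrow> c < N (Suc (Suc i)) \<Longrightarrow> C (Suc i) r c \<in> forms V (Suc 0)"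
    "\<And>i v. (\<And>c. c < N (Suc i) \<Longrightarrow> v c \<in> polys V) \<Longrightarrow>
      (\<And>r. r < N i \<Longrightarrow> mul (N (Suc i)) (C i) v r = 0) \<Longrightarrow>
      \<exists>u. (\<forall>c<N (Suc (Suc i)). u c \<in> polys V) \<and>
        (\<forall>r<N (Suc i). v r = mul (N (Suc (Suc i))) (C (Suc i)) u r)"
    "\<And>i u r. r < N i \<Longrightarrow> mul (N (Suc i)) (C i) (mul (N (Suc (Suc i))) (C (Suc i)) u) r = 0"
proof -
  define P where "P = (\<lambda>(n, b, A :: nat \<Rightarrow> nat \<Rightarrow> ('a, 'k) mpoly).
    (\<exists>d. \<forall>r<n. \<forall>c<b. A r c \<in> forms V d) \<and> acyclic_image n b A \<and> no_constants n b A)"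
  define Q where "Q = (\<lambda>(n, b, A :: nat \<Rightarrow> nat \<Rightarrow> ('a, 'k) mpoly) (n', b', B :: nat \<Rightarrow> nat \<Rightarrow> ('a, 'k) mpoly). n' = b \<and>
    (\<forall>c<b. \<forall>c'<b'. B c c' \<in> forms V (Suc 0)) \<and> (\<forall>c'<b'. \<forall>r<n. mul b A (\<lambda>c. B c c') r = 0) \<and>
    (\<forall>v. (\<forall>c<b. v c \<in> polys V) \<longrightarrow> (\<forall>r<n. mul b A v r = 0) \<longrightarrow>
      (\<exists>u. (\<forall>c<b'. u c \<in> polys V) \<and> (\<forall>c<b. v c = mul b' B u c))))"
  \<comment> \<open>A state consists of the number of rows, the number of columns and the matrix.
    The clause for \<open>i = 0\<close> pins the initial state, which the choice would otherwise
    leave open.\<close>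
  have "\<exists>f. \<forall>i. (P (f i) \<and> (i = 0 \<longrightarrow> f i = (n, b, A))) \<and> Q (f i) (f (Suc i))"
  proof (rule dependent_nat_choice)
    show "\<exists>x. P x \<and> (0 = (0::nat) \<longrightarrow> x = (n, b, A))" using A acyc nc by (auto simp: P_def)
  next
    fix x and i :: nat assume x: "P x \<and> (i = 0 \<longrightarrow> x = (n, b, A))"
    obtain m q D where nbA: "x = (m, q, D)" by (cases x) auto
    from x nbA obtain d where d: "\<And>r c. r < m \<Longrightarrow> c < q \<Longrightarrow> D r c \<in> forms V d"
      "acyclic_image m q D" "no_constants m q D" by (auto simp: P_def)
    obtain q' and B :: "nat \<Rightarrow> nat \<Rightarrow> ('a, 'k) mpoly" where B:
      "\<And>c c'. c < q \<Longrightarrow> c' < q' \<Longrightarrow> B c c' \<in> forms V (Suc 0)"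
      "\<And>c' r. c' < q' \<Longrightarrow> r < m \<Longrightarrow> mul q D (\<lambda>c. B c c') r = 0"
      "\<And>v. (\<And>c. c < q \<Longrightarrow> v c \<in> polys V) \<Longrightarrow> (\<And>r. r < m \<Longrightarrow> mul q D v r = 0) \<Longrightarrow>
        \<exists>u. (\<forall>c<q'. u c \<in> polys V) \<and> (\<forall>c<q. v c = mul q' B u c)"
      "acyclic_image q q' B" "no_constants q q' B"
      using acyclic_image_next[OF d] by blast
    show "\<exists>y. (P y \<and> (Suc i = 0 \<longrightarrow> y = (n, b, A))) \<and> Q x y"
      unfolding nbA by (intro exI[of _ "(q, q', B)"]) (use B in \<open>auto simp: P_def Q_def\<close>)
  qed
  then obtain f where f: "f 0 = (n, b, A)" "\<And>i. Q (f i) (f (Suc i))" by blast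
  define N where "N i = fst (f i)" for i
  define C where "C i = snd (snd (f i))" for i
  have NS: "N (Suc i) = fst (snd (f i))" for i
    using f(2)[of i] by (auto simp: N_def Q_def split: prod.splits)
  have fi: "f i = (N i, N (Suc i), C i)" for i by (simp add: NS) (simp add: N_def C_def)
  have Q: "Q (N i, N (Suc i), C i) (N (Suc i), N (Suc (Suc i)), C (Suc i))" for i
    using f(2)[of i] unfolding fi .
  show thesis
  proof (rule that[of N C])
    show "N 0 = n" "N (Suc 0) = b" "C 0 = A" using f(1) by (simp_all add: NS) (simp_all add: N_def C_def)
    show "mul (N (Suc i)) (C i) (mul (N (Suc (Suc i))) (C (Suc i)) u) r = 0" if "r < N i" for i u r
      by (rule mul_mul) (use Q[of i] that in \<open>auto simp: Q_def\<close>)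
  qed (use Q in \<open>simp_all add: Q_def\<close>)
qed

section \<open>Resolutions by matrices and complexes of coefficient functions\<close>

lemma mult_mat_vec_mul:
  assumes "M \<in> carrier_mat n b" "v \<in> carrier_vec b" "r < n"
  shows "(M *\<^sub>v v) $ r = mul b (\<lambda>r c. M $$ (r, c)) (\<lambda>c. v $ c) r"
  using assms by (auto simp: mul_def scalar_prod_def lessThan_atLeast0 intro!: sum.cong)

lemma scalar_prod_mul:
  assumes "v \<in> carrier_vec b"
  shows "g \<bullet> v = mul b (\<lambda>r c. g $ c) (\<lambda>c. v $ c) r"
  using assms by (auto simp: mul_def scalar_prod_def lessThan_atLeast0)

lemma free_mod_vec: "(\<And>c. c < n \<Longrightarrow> u c \<in> polys V) \<Longrightarrow> vec n u \<in> free_mod V n"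
  by (simp add: free_mod_def)

lemma free_modD:
  assumes "v \<in> free_mod V n"
  shows "v \<in> carrier_vec n" "c < n \<Longrightarrow> v $ c \<in> polys V"
  using assms by (auto simp: free_mod_def)

lemma linear_resolution_acyclic:
  fixes I :: "('a, 'k::field) mpoly set"
  assumes "has_linear_resolution V q I"
  obtains b and f :: "nat \<Rightarrow> ('a, 'k) mpoly" where
    "\<And>c. c < b \<Longrightarrow> f c \<in> forms V q" "acyclic_image 1 b (\<lambda>r. f)" "gen V (f ` {..<b}) = I"
proof -
  obtain b d g and \<phi> :: "nat \<Rightarrow> ('a, 'k) mpoly mat" where
    res: "graded_free_resolution V I b d g \<phi>" and d: "\<forall>i. \<forall>c<b i. d i c = int q + int i"
    using assms unfolding has_linear_resolution_def minimal_graded_free_resolution_def by blast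
  have g: "g \<in> free_mod V (b 0)" "\<And>c. c < b 0 \<Longrightarrow> homogeneous_of_degree (d 0 c) (g $ c)"
    and \<phi>: "\<And>i. \<phi> i \<in> carrier_mat (b i) (b (Suc i))"
      "\<And>i r c. r < b i \<Longrightarrow> c < b (Suc i) \<Longrightarrow> \<phi> i $$ (r, c) \<in> polys V"
      "\<And>i r c. r < b i \<Longrightarrow> c < b (Suc i) \<Longrightarrow> homogeneous_of_degree (d (Suc i) c - d i r) (\<phi> i $$ (r, c))"
    and I: "(\<lambda>v. g \<bullet> v) ` free_mod V (b 0) = I"
    and ex0: "{v \<in> free_mod V (b 0). g \<bullet> v = 0} = (\<lambda>w. \<phi> 0 *\<^sub>v w) ` free_mod V (b 1)"
    and exS: "\<And>i. {v \<in> free_mod V (b (Suc i)). \<phi> i *\<^sub>v v = 0\<^sub>v (b i)}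
          = (\<lambda>w. \<phi> (Suc i) *\<^sub>v w) ` free_mod V (b (Suc (Suc i)))"
    using res by (auto simp: graded_free_resolution_def)
  \<comment> \<open>The augmentation \<open>g\<close> becomes a matrix with one row at index 0, and
    the differentials move up by one. Exactness then has the same form at every index.\<close>
  define N where "N i = (case i of 0 \<Rightarrow> 1 | Suc i \<Rightarrow> b i)" for i
  define A where "A i = (case i of 0 \<Rightarrow> (\<lambda>r c. g $ c) | Suc i \<Rightarrow> (\<lambda>r c. \<phi> i $$ (r, c)))" for i
  have N: "N 0 = 1" "N (Suc i) = b i" for i by (simp_all add: N_def)
  have A: "A 0 = (\<lambda>r c. g $ c)" "A (Suc i) = (\<lambda>r c. \<phi> i $$ (r, c))" for i by (simp_all add: A_def)
  have gf: "g $ c \<in> forms V q" if "c < b 0" for c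
    using g(2)[OF that] free_modD(2)[OF g(1) that] d that by (simp add: forms_homogeneous)
  have ker: "(\<forall>r<N i. mul (N (Suc i)) (A i) v r = 0) \<longleftrightarrow>
      vec (b i) v \<in> (\<lambda>w. \<phi> i *\<^sub>v w) ` free_mod V (b (Suc i))"
    if v: "\<And>c. c < b i \<Longrightarrow> v c \<in> polys V" for i v
  proof (cases i)
    case 0
    have "g \<bullet> vec (b i) v = mul (b i) (A 0) v 0"
      using scalar_prod_mul[of "vec (b i) v" "b i" g 0] by (simp add: A mul_def)
    moreover have "vec (b 0) v \<in> free_mod V (b 0)" using v 0 by (intro free_mod_vec) auto
    then have "g \<bullet> vec (b 0) v = 0 \<longleftrightarrow> vec (b 0) v \<in> (\<lambda>w. \<phi> 0 *\<^sub>v w) ` free_mod V (b 1)"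
      unfolding ex0[symmetric] by simp
    ultimately show ?thesis using 0 by (simp add: N)
  next
    case (Suc j)
    have "(\<phi> j *\<^sub>v vec (b i) v) $ r = mul (b i) (A i) v r" if "r < b j" for r
      using mult_mat_vec_mul[OF \<phi>(1)[of j], of "vec (b i) v" r] that Suc by (simp add: A mul_def)
    moreover have "dim_vec (\<phi> j *\<^sub>v vec (b i) v) = b j" using \<phi>(1)[of j] by auto
    ultimately have "(\<forall>r<N i. mul (N (Suc i)) (A i) v r = 0) \<longleftrightarrow> \<phi> j *\<^sub>v vec (b i) v = 0\<^sub>v (b j)"
      using Suc by (auto simp: N vec_eq_iff)
    moreover have "vec (b i) v \<in> free_mod V (b i)" using v by (intro free_mod_vec) auto
    ultimately show ?thesis using exS[of j] Suc by auto
  qed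
  have im: "vec (b i) v = \<phi> i *\<^sub>v w \<longleftrightarrow> (\<forall>r<b i. v r = mul (b (Suc i)) (A (Suc i)) (\<lambda>c. w $ c) r)"
    if "w \<in> free_mod V (b (Suc i))" for i v w
  proof -
    have "dim_vec (\<phi> i *\<^sub>v w) = b i" using \<phi>(1)[of i] by auto
    then show ?thesis
      using mult_mat_vec_mul[OF \<phi>(1)[of i] free_modD(1)[OF that]] by (auto simp: vec_eq_iff A)
  qed
  have "acyclic_image (N 0) (N (Suc 0)) (A 0)"
  proof (rule linear_complex_acyclic)
    fix i r c assume "r < N (Suc i)" "c < N (Suc (Suc i))"
    then show "A (Suc i) r c \<in> forms V (Suc 0)"
      using \<phi>(2,3)[of r i c] d by (simp add: N A forms_homogeneous)
  next
    fix i v assume v: "\<And>c. c < N (Suc i) \<Longrightarrow> v c \<in> polys V"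
      and k: "\<And>r. r < N i \<Longrightarrow> mul (N (Suc i)) (A i) v r = 0"
    have "vec (b i) v \<in> (\<lambda>w. \<phi> i *\<^sub>v w) ` free_mod V (b (Suc i))"
      using ker[of i v] v k by (auto simp: N)
    then obtain w where w: "w \<in> free_mod V (b (Suc i))" "vec (b i) v = \<phi> i *\<^sub>v w" by blast
    show "\<exists>u. (\<forall>c<N (Suc (Suc i)). u c \<in> polys V) \<and>
        (\<forall>r<N (Suc i). v r = mul (N (Suc (Suc i))) (A (Suc i)) u r)"
      using w(2) free_modD(2)[OF w(1)] unfolding im[OF w(1)] N by (intro exI[of _ "\<lambda>c. w $ c"]) auto
  next
    fix i r and u :: "nat \<Rightarrow> ('a, 'k) mpoly" assume u: "\<And>c. c < N (Suc (Suc i)) \<Longrightarrow> u c \<in> polys V" and r: "r < N i"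
    let ?v = "mul (N (Suc (Suc i))) (A (Suc i)) u"
    have w: "vec (b (Suc i)) u \<in> free_mod V (b (Suc i))" using u by (intro free_mod_vec) (auto simp: N)
    have "vec (b i) ?v = \<phi> i *\<^sub>v vec (b (Suc i)) u"
      unfolding im[OF w] by (simp add: N mul_def)
    moreover have "?v c \<in> polys V" if "c < b i" for c
      using that u \<phi>(2) unfolding mul_def A N by (intro polys_sum polys_mult) auto
    ultimately show "mul (N (Suc i)) (A i) ?v r = 0"
      using ker[of i ?v] w r by blast
  qed
  then have "acyclic_image 1 (b 0) (\<lambda>r c. g $ c)" by (simp add: N A)
  moreover have "gen V ((\<lambda>c. g $ c) ` {..<b 0}) = I"
  proof (intro subset_antisym subsetI)
    fix p assume "p \<in> gen V ((\<lambda>c. g $ c) ` {..<b 0})"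
    then obtain a where a: "\<forall>c. a c \<in> polys V" "p = (\<Sum>c<b 0. g $ c * a c)"
      using gen_image_lessThan by blast
    have "p = g \<bullet> vec (b 0) a"
      using scalar_prod_mul[of "vec (b 0) a" "b 0" g 0] a by (simp add: mul_def)
    then show "p \<in> I" using I free_mod_vec[of "b 0" a] a by blast
  next
    fix p assume "p \<in> I"
    then obtain v where v: "v \<in> free_mod V (b 0)" "p = g \<bullet> v" using I by blast
    then have "p = (\<Sum>c<b 0. g $ c * v $ c)"
      using scalar_prod_mul[OF free_modD(1)[OF v(1)], of g 0] by (simp add: mul_def)
    then show "p \<in> gen V ((\<lambda>c. g $ c) ` {..<b 0})"
      using gen_image_sum[of "b 0" "\<lambda>c. v $ c" V "\<lambda>c. g $ c"] free_modD(2)[OF v(1)] by simp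
  qed
  ultimately show thesis using gf by (intro that[of "b 0" "\<lambda>c. g $ c"]) auto
qed

lemma acyclic_linear_resolution:
  fixes f :: "nat \<Rightarrow> ('a, 'k::field) mpoly"
  assumes f: "\<And>c. c < b \<Longrightarrow> f c \<in> forms V q"
    and acyc: "acyclic_image 1 b (\<lambda>r. f)" and nc: "no_constants 1 b (\<lambda>r. f)"
  shows "has_linear_resolution V q (gen V (f ` {..<b}))"
proof -
  obtain N and C :: "nat \<Rightarrow> nat \<Rightarrow> nat \<Rightarrow> ('a, 'k) mpoly" where N: "N 0 = 1" "N (Suc 0) = b" "C 0 = (\<lambda>r. f)"
    and lin: "\<And>i r c. r < N (Suc i) \<Longrightarrow> c < N (Suc (Suc i)) \<Longrightarrow> C (Suc i) r c \<in> forms V (Suc 0)"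
    and exact: "\<And>i v. (\<And>c. c < N (Suc i) \<Longrightarrow> v c \<in> polys V) \<Longrightarrow>
      (\<And>r. r < N i \<Longrightarrow> mul (N (Suc i)) (C i) v r = 0) \<Longrightarrow>
      \<exists>u. (\<forall>c<N (Suc (Suc i)). u c \<in> polys V) \<and>
        (\<forall>r<N (Suc i). v r = mul (N (Suc (Suc i))) (C (Suc i)) u r)"
    and complex: "\<And>i u r. r < N i \<Longrightarrow> mul (N (Suc i)) (C i) (mul (N (Suc (Suc i))) (C (Suc i)) u) r = 0"
    by (rule acyclic_linear_complex[of 1 b "\<lambda>r. f" q]) (use f acyc nc in auto)
  define g where "g = vec b f"
  \<comment> \<open>\<open>C 0\<close> is the row of generators, so the first differential is the
    matrix at index 1.\<close>
  define \<phi> where "\<phi> i = mat (N (Suc i)) (N (Suc (Suc i))) (\<lambda>(r, c). C (Suc i) r c)" for i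
  define d where "d i c = int q + int i" for i c :: nat
  have g: "g \<in> free_mod V (N (Suc 0))" unfolding g_def N
    by (rule free_mod_vec) (use f forms_polys in blast)
  have gv: "g \<bullet> v = mul (N (Suc 0)) (C 0) (\<lambda>c. v $ c) 0" if "v \<in> free_mod V (N (Suc 0))" for v
    using scalar_prod_mul[OF free_modD(1)[OF that], of g 0] by (simp add: g_def N mul_def)
  have \<phi>c: "\<phi> i \<in> carrier_mat (N (Suc i)) (N (Suc (Suc i)))" for i by (simp add: \<phi>_def)
  have \<phi>v: "(\<phi> i *\<^sub>v v) $ r = mul (N (Suc (Suc i))) (C (Suc i)) (\<lambda>c. v $ c) r"
    if "v \<in> free_mod V (N (Suc (Suc i)))" "r < N (Suc i)" for v i r
    using mult_mat_vec_mul[OF \<phi>c free_modD(1)[OF that(1)] that(2)] that(2) by (simp add: \<phi>_def mul_def)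
  have \<phi>dim: "dim_vec (\<phi> i *\<^sub>v v) = N (Suc i)" for i v by (simp add: \<phi>_def)
  have \<phi>pol: "\<phi> i *\<^sub>v v \<in> free_mod V (N (Suc i))" if "v \<in> free_mod V (N (Suc (Suc i)))" for v i
  proof -
    have "(\<phi> i *\<^sub>v v) $ r \<in> polys V" if r: "r < N (Suc i)" for r
      unfolding \<phi>v[OF \<open>v \<in> free_mod V (N (Suc (Suc i)))\<close> r] mul_def
      using lin[of r i] r free_modD(2)[OF \<open>v \<in> free_mod V (N (Suc (Suc i)))\<close>]
      by (intro polys_sum polys_mult) (auto intro: forms_polys)
    then show ?thesis using \<phi>dim[of i v] unfolding free_mod_def
      by (intro CollectI conjI allI impI carrier_vecI) simp_all
  qed
  have ker: "{v \<in> free_mod V (N (Suc i)). \<forall>r<N i. mul (N (Suc i)) (C i) (\<lambda>c. v $ c) r = 0}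
      = (\<lambda>w. \<phi> i *\<^sub>v w) ` free_mod V (N (Suc (Suc i)))" for i
  proof (intro subset_antisym subsetI)
    fix v assume "v \<in> {v \<in> free_mod V (N (Suc i)). \<forall>r<N i. mul (N (Suc i)) (C i) (\<lambda>c. v $ c) r = 0}"
    then have v: "v \<in> free_mod V (N (Suc i))" "\<And>r. r < N i \<Longrightarrow> mul (N (Suc i)) (C i) (\<lambda>c. v $ c) r = 0"
      by auto
    obtain u where u: "\<forall>c<N (Suc (Suc i)). u c \<in> polys V"
        "\<forall>r<N (Suc i). v $ r = mul (N (Suc (Suc i))) (C (Suc i)) u r"
      using exact[of i "\<lambda>c. v $ c"] free_modD(2)[OF v(1)] v(2) by blast
    have w: "vec (N (Suc (Suc i))) u \<in> free_mod V (N (Suc (Suc i)))" using u by (intro free_mod_vec) auto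
    have "v = \<phi> i *\<^sub>v vec (N (Suc (Suc i))) u"
    proof (rule eq_vecI)
      fix r assume "r < dim_vec (\<phi> i *\<^sub>v vec (N (Suc (Suc i))) u)"
      then have r: "r < N (Suc i)" using \<phi>dim by simp
      show "v $ r = (\<phi> i *\<^sub>v vec (N (Suc (Suc i))) u) $ r"
        unfolding \<phi>v[OF w r] using u(2) r by (auto simp: mul_def)
    qed (use free_modD(1)[OF v(1)] \<phi>dim in auto)
    then show "v \<in> (\<lambda>w. \<phi> i *\<^sub>v w) ` free_mod V (N (Suc (Suc i)))" using w by blast
  next
    fix v assume "v \<in> (\<lambda>w. \<phi> i *\<^sub>v w) ` free_mod V (N (Suc (Suc i)))"
    then obtain w where w: "w \<in> free_mod V (N (Suc (Suc i)))" "v = \<phi> i *\<^sub>v w" by blast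
    have "mul (N (Suc i)) (C i) (\<lambda>c. v $ c) r = 0" if "r < N i" for r
    proof -
      have "mul (N (Suc i)) (C i) (\<lambda>c. v $ c) r
          = mul (N (Suc i)) (C i) (mul (N (Suc (Suc i))) (C (Suc i)) (\<lambda>c. w $ c)) r"
        by (rule mul_cong) (simp add: w(2) \<phi>v[OF w(1)])
      then show ?thesis using complex[OF that] by simp
    qed
    then show "v \<in> {v \<in> free_mod V (N (Suc i)). \<forall>r<N i. mul (N (Suc i)) (C i) (\<lambda>c. v $ c) r = 0}"
      using \<phi>pol w by auto
  qed
  have image: "(\<lambda>v. g \<bullet> v) ` free_mod V (N (Suc 0)) = gen V (f ` {..<b})"
  proof (intro subset_antisym subsetI)
    fix p assume "p \<in> gen V (f ` {..<b})"
    then obtain a where a: "\<forall>c. a c \<in> polys V" "p = (\<Sum>c<b. f c * a c)"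
      using gen_image_lessThan by blast
    have w: "vec b a \<in> free_mod V (N (Suc 0))" unfolding N using a by (intro free_mod_vec) auto
    have "p = g \<bullet> vec b a" unfolding gv[OF w] using a by (simp add: mul_def N)
    then show "p \<in> (\<lambda>v. g \<bullet> v) ` free_mod V (N (Suc 0))" using w by blast
  next
    fix p assume "p \<in> (\<lambda>v. g \<bullet> v) ` free_mod V (N (Suc 0))"
    then obtain v where v: "v \<in> free_mod V (N (Suc 0))" "p = g \<bullet> v" by blast
    then have "p = (\<Sum>c<b. f c * v $ c)" using gv by (simp add: mul_def N)
    then show "p \<in> gen V (f ` {..<b})"
      using gen_image_sum[of b "\<lambda>c. v $ c" V f] free_modD(2)[OF v(1)] by (simp add: N)
  qed
  \<comment> \<open>Minimality of the resolution: the entries of all differentials are linear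
    forms.\<close>
  have irr: "p \<in> irrelevant_ideal V" if "p \<in> forms V (Suc 0)" for p :: "('a, 'k) mpoly"
  proof -
    have "p \<in> gen V (Var ` V)"
      by (subst forms_1_sum[OF that fin], intro gen_sum gen_mult gen_base) auto
    then show ?thesis unfolding irrelevant_ideal_def by (subst genideal_eq_gen) auto
  qed
  have "minimal_graded_free_resolution V (gen V (f ` {..<b})) (\<lambda>i. N (Suc i)) d g \<phi>"
    unfolding minimal_graded_free_resolution_def graded_free_resolution_def
  proof (intro conjI allI impI)
    fix c assume "c < N (Suc 0)"
    then show "homogeneous_of_degree (d 0 c) (g $ c)"
      using f[of c] by (simp add: g_def N d_def forms_homogeneous)
  next
    fix i r c assume rc: "r < N (Suc i)" "c < N (Suc (Suc i))"
    then have "\<phi> i $$ (r, c) \<in> forms V (Suc 0)" using lin by (simp add: \<phi>_def)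
    then show "\<phi> i $$ (r, c) \<in> carrier (poly_ring V)"
      "homogeneous_of_degree (d (Suc i) c - d i r) (\<phi> i $$ (r, c))" "\<phi> i $$ (r, c) \<in> irrelevant_ideal V"
      using irr by (simp_all add: forms_homogeneous d_def)
  next
    show "{v \<in> free_mod V (N (Suc 0)). g \<bullet> v = 0} = (\<lambda>w. \<phi> 0 *\<^sub>v w) ` free_mod V (N (Suc 1))"
    proof -
      have "{v \<in> free_mod V (N (Suc 0)). g \<bullet> v = 0}
          = {v \<in> free_mod V (N (Suc 0)). \<forall>r<N 0. mul (N (Suc 0)) (C 0) (\<lambda>c. v $ c) r = 0}"
        by (rule Collect_cong) (use gv in \<open>auto simp: N(1)\<close>)
      then show ?thesis using ker[of 0] by (simp only: One_nat_def)
    qed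
  next
    fix i
    have "\<phi> i *\<^sub>v v = 0\<^sub>v (N (Suc i)) \<longleftrightarrow> (\<forall>r<N (Suc i). mul (N (Suc (Suc i))) (C (Suc i)) (\<lambda>c. v $ c) r = 0)"
      if "v \<in> free_mod V (N (Suc (Suc i)))" for v
      using \<phi>v[OF that] \<phi>dim[of i v] by (auto simp: vec_eq_iff)
    then show "{v \<in> free_mod V (N (Suc (Suc i))). \<phi> i *\<^sub>v v = 0\<^sub>v (N (Suc i))}
          = (\<lambda>w. \<phi> (Suc i) *\<^sub>v w) ` free_mod V (N (Suc (Suc (Suc i))))"
      unfolding ker[of "Suc i", symmetric] by blast
  qed (use g image \<phi>c in auto)
  then show ?thesis unfolding has_linear_resolution_def d_def by blast
qed

end

section \<open>Edge ideals\<close>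

definition face_mon :: "'a set \<Rightarrow> ('a, 'k::field) mpoly" where
  "face_mon e = (\<Prod>v\<in>e. Var v)"

definition face_exp :: "'a set \<Rightarrow> 'a \<Rightarrow>\<^sub>0 nat" where
  "face_exp e = (\<Sum>v\<in>e. single v 1)"

lemma face_mon_eq: "face_mon e = single (face_exp e) 1"
  unfolding face_mon_def face_exp_def
  by (induction e rule: infinite_finite_induct) (simp_all add: Var_def mult_single)

lemma coef_face_exp: "finite e \<Longrightarrow> coef (face_exp e) v = (if v \<in> e then 1 else 0)"
  by (simp add: face_exp_def lookup_sum lookup_single when_def)

lemma supp_face_exp: "finite e \<Longrightarrow> supp (face_exp e) = e"
  by (auto simp: in_keys_iff coef_face_exp split: if_splits)

lemma mon_deg_face_exp: "finite e \<Longrightarrow> mon_deg (face_exp e) = card e"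
  by (simp add: mon_deg_def supp_face_exp coef_face_exp)

lemma face_exp_inject: "finite e \<Longrightarrow> finite e' \<Longrightarrow> face_exp e = face_exp e' \<longleftrightarrow> e = e'"
  by (metis supp_face_exp)

lemma face_mon_forms:
  assumes "finite e" "e \<subseteq> V"
  shows "face_mon e \<in> forms V (card e)"
  using assms by (simp add: forms_def polys_iff face_mon_eq supp_face_exp mon_deg_face_exp)

lemma face_mon_pair: "i \<noteq> j \<Longrightarrow> face_mon {i, j} = Var i * Var j"
  by (simp add: face_mon_def)

lemma face_exp_le:
  assumes "finite e" "e \<subseteq> supp m"
  shows "m = face_exp e + (m - face_exp e)"
  using assms by (intro poly_mapping_eqI) (auto simp: lookup_add lookup_minus coef_face_exp in_keys_iff)

text \<open>A squarefree monomial divides \<open>m\<close> exactly if its vertices occur in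
  \<open>m\<close>, so membership in the ideal is decided on the supports of single
  monomials.\<close>

lemma gen_face_mon_iff:
  assumes F: "\<And>e. e \<in> F \<Longrightarrow> finite e \<and> e \<subseteq> V"
  shows "p \<in> gen V (face_mon ` F) \<longleftrightarrow> p \<in> polys V \<and> (\<forall>m\<in>supp p. \<exists>e\<in>F. e \<subseteq> supp m)"
proof
  assume p: "p \<in> gen V (face_mon ` F)"
  have "face_mon ` F \<subseteq> polys V" using F by (auto intro!: forms_polys[OF face_mon_forms])
  moreover have "\<forall>m\<in>supp p. \<exists>e\<in>F. e \<subseteq> supp m"
    using p
  proof (induction p rule: gen.induct)
    case (gen_step p a s)
    then obtain e where e: "e \<in> F" "s = face_mon e" by blast
    have "e \<subseteq> supp m" if "m \<in> supp (a * s)" for m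
      using that F[OF e(1)] unfolding e(2)
      by (elim supp_multE) (auto simp: face_mon_eq supp_mon_add supp_face_exp)
    then show ?case using gen_step.IH e(1) keys_add[of p "a * s"] by blast
  qed simp
  ultimately show "p \<in> polys V \<and> (\<forall>m\<in>supp p. \<exists>e\<in>F. e \<subseteq> supp m)"
    using gen_polys[OF p] by blast
next
  assume p: "p \<in> polys V \<and> (\<forall>m\<in>supp p. \<exists>e\<in>F. e \<subseteq> supp m)"
  have "(\<Sum>m\<in>supp p. single m (coef p m)) \<in> gen V (face_mon ` F)"
  proof (rule gen_sum)
    fix m assume m: "m \<in> supp p"
    then obtain e where e: "e \<in> F" "e \<subseteq> supp m" using p by blast
    have m_eq: "m = face_exp e + (m - face_exp e)" using F e by (intro face_exp_le) auto
    have "single (m - face_exp e) (coef p m) * face_mon e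
        = single (face_exp e + (m - face_exp e)) (coef p m)"
      by (simp add: face_mon_eq mult_single add.commute)
    moreover have "supp (m - face_exp e) \<subseteq> supp m" by (auto simp: in_keys_iff lookup_minus)
    then have "supp (m - face_exp e) \<subseteq> V" using m p by (auto simp: polys_iff)
    then have "single (m - face_exp e) (coef p m) \<in> polys V" by (simp add: polys_iff)
    then have "single (m - face_exp e) (coef p m) * face_mon e \<in> gen V (face_mon ` F)"
      using e by (intro gen_mult gen_base) auto
    ultimately show "single m (coef p m) \<in> gen V (face_mon ` F)"
      using m_eq by simp
  qed
  then show "p \<in> gen V (face_mon ` F)" by (simp add: poly_mapping_sum_single[symmetric])
qed

lemma (in koszul) has_linear_quotients_acyclic:
  fixes fs :: "('a, 'k::field) mpoly list"
  assumes fs: "set fs \<subseteq> forms V q"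
    and lq: "\<forall>i<length fs. \<exists>L. L \<subseteq> linear_forms V \<and>
        colon_ideal V (genideal (poly_ring V) (set (take i fs))) (fs ! i) = genideal (poly_ring V) L"
  shows "acyclic_image 1 (length fs) (\<lambda>r c. fs ! c)"
proof (rule linear_quotients_acyclic)
  fix i assume i: "i < length fs"
  then show "fs ! i \<in> forms V q" using fs by auto
  obtain L where L: "L \<subseteq> forms V (Suc 0)"
    "colon_ideal V (genideal (poly_ring V) (set (take i fs))) (fs ! i) = genideal (poly_ring V) L"
    using lq i by (auto simp: linear_forms_eq)
  have "set (take i fs) \<subseteq> polys V" "L \<subseteq> polys V"
    using fs L(1) set_take_subset[of i fs] forms_polys by blast+
  then have "{g \<in> polys V. g * fs ! i \<in> gen V (set (take i fs))} = gen V L"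
    using L(2) by (simp add: colon_ideal_def genideal_eq_gen)
  moreover have "set (take i fs) = (!) fs ` {..<i}"
    using nth_image[of i fs] i by (simp add: lessThan_atLeast0)
  ultimately show "\<exists>L\<subseteq>forms V (Suc 0). {g \<in> polys V. g * fs ! i \<in> gen V ((!) fs ` {..<i})} = gen V L"
    using L(1) by auto
qed

section \<open>Edge ideals of shellable graphs, and degrees of minimal generators\<close>

locale fin_graph =
  fixes V :: "'a set" and E :: "'a set set"
  assumes graph: "simple_graph V E"
begin

lemma finV: "finite V" using graph by (simp add: simple_graph_def)

lemma edge: "e \<in> E \<Longrightarrow> finite e \<and> e \<subseteq> V" "e \<in> E \<Longrightarrow> card e = 2"
  using graph finite_subset by (auto simp: simple_graph_def)

lemma edge_forms: "e \<in> E \<Longrightarrow> face_mon e \<in> forms V 2"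
  using face_mon_forms[of e V] edge by auto

lemma edge_ideal_eq: "(edge_ideal V E :: ('a, 'k::field) mpoly set) = gen V (face_mon ` E)"
proof -
  have "{Var i * Var j | i j. {i, j} \<in> E \<and> i \<noteq> j} = (face_mon ` E :: ('a, 'k) mpoly set)"
  proof (intro subset_antisym subsetI)
    fix x :: "('a, 'k) mpoly" assume "x \<in> face_mon ` E"
    then obtain e where e: "e \<in> E" "x = face_mon e" by blast
    then obtain i j where ij: "e = {i, j}" "i \<noteq> j" using edge(2)[of e] by (auto simp: card_2_iff)
    then have "x = Var i * Var j" using e by (simp add: face_mon_pair)
    then show "x \<in> {Var i * Var j | i j. {i, j} \<in> E \<and> i \<noteq> j}" using e ij by blast
  qed (auto simp flip: face_mon_pair)
  moreover have "face_mon ` E \<subseteq> (polys V :: ('a, 'k) mpoly set)"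
    using edge_forms forms_polys by blast
  ultimately show ?thesis by (simp add: edge_ideal_def genideal_eq_gen)
qed

text \<open>A monomial \<open>m\<close> lies in the colon ideal exactly if some earlier edge is
  contained in \<open>Fs ! i\<close> together with the support of \<open>m\<close>. The shelling
  condition replaces that edge by an earlier one with a single vertex outside \<open>Fs ! i\<close>,
  and this vertex must then occur in \<open>m\<close>.\<close>

lemma shellable_colon:
  assumes Fs: "set Fs = E" "i < length Fs"
    and sh: "\<And>j. j < i \<Longrightarrow> \<exists>k<i. card (Fs ! i - Fs ! k) = 1 \<and> Fs ! k \<subseteq> Fs ! j \<union> Fs ! i"
  shows "{g \<in> polys V. g * face_mon (Fs ! i) \<in> gen V ((\<lambda>c. face_mon (Fs ! c)) ` {..<i})}
    = gen V (face_mon ` {{v} | v. \<exists>k<i. Fs ! k - Fs ! i = {v}})" (is "?L = gen V (face_mon ` ?N)")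
proof -
  have ed: "Fs ! k \<in> E" if "k \<le> i" for k using that Fs by auto
  have 1: "finite e \<and> e \<subseteq> V" if "e \<in> (!) Fs ` {..<i}" for e
  proof -
    obtain k where "k < i" "e = Fs ! k" using \<open>e \<in> (!) Fs ` {..<i}\<close> by blast
    then show ?thesis using edge(1)[OF ed[of k]] by simp
  qed
  have 2: "\<And>e. e \<in> ?N \<Longrightarrow> finite e \<and> e \<subseteq> V"
  proof -
    fix e assume "e \<in> ?N"
    then obtain v k where "e = {v}" "k < i" "v \<in> Fs ! k" by blast
    then show "finite e \<and> e \<subseteq> V" using edge(1)[OF ed[of k]] by auto
  qed
  have fi: "finite (Fs ! i)" using ed edge by blast
  show ?thesis
  proof (intro subset_antisym subsetI)
    fix g :: "('a, 'b) mpoly" assume "g \<in> ?L"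
    then have g: "g \<in> polys V" and "g * face_mon (Fs ! i) \<in> gen V (face_mon ` ((!) Fs ` {..<i}))"
      by (simp_all add: image_image)
    then have gm: "\<exists>e\<in>(!) Fs ` {..<i}. e \<subseteq> supp m" if "m \<in> supp (g * face_mon (Fs ! i))" for m
      using that gen_face_mon_iff[of "(!) Fs ` {..<i}" V "g * face_mon (Fs ! i)"] 1 by blast
    have "\<exists>e\<in>?N. e \<subseteq> supp m" if m: "m \<in> supp g" for m
    proof -
      have "face_exp (Fs ! i) + m \<in> supp (g * face_mon (Fs ! i))"
        using m coef_single_mult_add[of "face_exp (Fs ! i)" 1 g m]
        by (simp add: in_keys_iff face_mon_eq mult.commute[of g])
      from gm[OF this] obtain j where j: "j < i" "Fs ! j \<subseteq> Fs ! i \<union> supp m"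
        unfolding supp_mon_add supp_face_exp[OF fi] by blast
      obtain k where k: "k < i" "card (Fs ! i - Fs ! k) = 1" "Fs ! k \<subseteq> Fs ! j \<union> Fs ! i"
        using sh[OF j(1)] by blast
      have "card (Fs ! k - Fs ! i) = card (Fs ! i - Fs ! k)"
        using edge[OF ed[of k]] edge[OF ed[of i]] k(1)
        by (metis card_Diff_subset_Int finite_Int inf_commute le_refl less_imp_le_nat)
      then obtain v where "Fs ! k - Fs ! i = {v}" using k(2) by (metis card_1_singletonE)
      then have "{v} \<in> ?N" "{v} \<subseteq> supp m" using k j by blast+
      then show ?thesis by blast
    qed
    then show "g \<in> gen V (face_mon ` ?N)" using gen_face_mon_iff[of ?N V g] 2 g by blast
  next
    fix g :: "('a, 'b) mpoly" assume "g \<in> gen V (face_mon ` ?N)"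
    then have g: "g \<in> polys V" and gm: "\<And>m. m \<in> supp g \<Longrightarrow> \<exists>e\<in>?N. e \<subseteq> supp m"
      using gen_face_mon_iff[of ?N V g] 2 by blast+
    have "\<exists>e\<in>(!) Fs ` {..<i}. e \<subseteq> supp m" if "m \<in> supp (g * face_mon (Fs ! i))" for m
    proof -
      obtain a where a: "a \<in> supp g" "m = a + face_exp (Fs ! i)"
        using \<open>m \<in> supp (g * face_mon (Fs ! i))\<close> by (elim supp_multE) (auto simp: face_mon_eq)
      obtain v k where "k < i" "Fs ! k - Fs ! i = {v}" "v \<in> supp a" using gm[OF a(1)] by blast
      then have "Fs ! k \<subseteq> supp m" by (auto simp: a(2) supp_mon_add supp_face_exp[OF fi])
      then show ?thesis using \<open>k < i\<close> by blast
    qed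
    moreover have "g * face_mon (Fs ! i) \<in> polys V"
      using g edge_forms[OF ed[of i]] forms_polys by (intro polys_mult) auto
    ultimately have "g * face_mon (Fs ! i) \<in> gen V (face_mon ` ((!) Fs ` {..<i}))"
      using gen_face_mon_iff[of "(!) Fs ` {..<i}" V "g * face_mon (Fs ! i)"] 1 by blast
    then show "g \<in> ?L" using g by (simp add: image_image)
  qed
qed

text \<open>The common source of linear quotients and of the linear resolution: both are built on
  the edge monomials in shelling order.\<close>

lemma shellable_linear_quotients:
  assumes "edgewise_strongly_shellable V E"
  obtains Fs where "distinct Fs" "set Fs = E"
    "\<And>i. i < length Fs \<Longrightarrow> \<exists>L\<subseteq>forms V (Suc 0).
      {g \<in> polys V. g * face_mon (Fs ! i) \<in> gen V ((\<lambda>c. face_mon (Fs ! c)) ` {..<i})} = (gen V L :: ('a, 'k::field) mpoly set)"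
proof -
  obtain Fs where Fs: "distinct Fs" "set Fs = E" and sh: "\<forall>j<length Fs. \<forall>i<j. \<exists>k<j.
          card (Fs ! j - Fs ! k) = 1 \<and>
          Fs ! i \<inter> Fs ! j \<subseteq> Fs ! k \<and> Fs ! k \<subseteq> Fs ! i \<union> Fs ! j"
    using assms unfolding edgewise_strongly_shellable_def strongly_shellable_def by blast
  have "\<exists>L\<subseteq>forms V (Suc 0).
      {g \<in> polys V. g * face_mon (Fs ! i) \<in> gen V ((\<lambda>c. face_mon (Fs ! c)) ` {..<i})} = (gen V L :: ('a, 'k) mpoly set)"
    if i: "i < length Fs" for i
  proof (intro exI conjI)
    show "face_mon ` {{v} | v. \<exists>k<i. Fs ! k - Fs ! i = {v}} \<subseteq> (forms V (Suc 0) :: ('a, 'k) mpoly set)"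
    proof
      fix x :: "('a, 'k) mpoly" assume "x \<in> face_mon ` {{v} | v. \<exists>k<i. Fs ! k - Fs ! i = {v}}"
      then obtain v k where x: "x = face_mon {v}" "k < i" "v \<in> Fs ! k" by blast
      have "Fs ! k \<in> E" using x i Fs by auto
      then have "v \<in> V" using x edge by blast
      then show "x \<in> forms V (Suc 0)" using face_mon_forms[of "{v}" V] x by simp
    qed
    show "{g \<in> polys V. g * face_mon (Fs ! i) \<in> gen V ((\<lambda>c. face_mon (Fs ! c)) ` {..<i})}
      = (gen V (face_mon ` {{v} | v. \<exists>k<i. Fs ! k - Fs ! i = {v}}) :: ('a, 'k) mpoly set)"
    proof (rule shellable_colon[OF Fs(2) i])
      fix j assume "j < i"
      then show "\<exists>k<i. card (Fs ! i - Fs ! k) = 1 \<and> Fs ! k \<subseteq> Fs ! j \<union> Fs ! i" using sh i by blast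
    qed
  qed
  with Fs show thesis by (rule that)
qed

lemma shellable_has_linear_quotients:
  assumes "edgewise_strongly_shellable V E"
  shows "has_linear_quotients V (edge_ideal V E :: ('a, 'k::field) mpoly set)"
proof -
  obtain Fs where Fs: "distinct Fs" "set Fs = E" and lq:
    "\<And>i. i < length Fs \<Longrightarrow> \<exists>L\<subseteq>forms V (Suc 0).
      {g \<in> polys V. g * face_mon (Fs ! i) \<in> gen V ((\<lambda>c. face_mon (Fs ! c)) ` {..<i})} = (gen V L :: ('a, 'k) mpoly set)"
    using shellable_linear_quotients[OF assms] by blast
  define fs where "fs = (map face_mon Fs :: ('a, 'k) mpoly list)"
  have fsE: "set fs = face_mon ` E" by (simp add: fs_def Fs)
  have pol: "set fs \<subseteq> polys V" unfolding fsE by (auto intro!: forms_polys[OF edge_forms])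
  show ?thesis unfolding has_linear_quotients_def
  proof (intro exI[of _ fs] conjI allI impI)
    show "minimal_homogeneous_generators V (edge_ideal V E) fs"
      unfolding minimal_homogeneous_generators_def homogeneous_generators_def
    proof (intro conjI allI impI)
      show "\<forall>f\<in>set fs. \<exists>d. homogeneous_of_degree d f"
      proof
        fix f assume "f \<in> set fs"
        then have "f \<in> forms V 2" using edge_forms by (auto simp: fsE)
        then show "\<exists>d. homogeneous_of_degree d f" unfolding forms_homogeneous by blast
      qed
      show "genideal (poly_ring V) (set fs) = edge_ideal V E"
        using genideal_eq_gen[OF pol] by (simp add: fsE edge_ideal_eq)
    next
      fix i assume i: "i < length fs"
      let ?r = "set (take i Fs @ drop (Suc i) Fs)"
      have Fi: "Fs ! i \<in> E" using i Fs by (auto simp: fs_def)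
      have "distinct (take i Fs @ Fs ! i # drop (Suc i) Fs)"
        using i Fs(1) by (simp add: id_take_nth_drop[symmetric] fs_def)
      then have r: "Fs ! i \<notin> ?r" by auto
      have rE: "?r \<subseteq> E" using Fs(2) set_take_subset set_drop_subset by fastforce
      have rs: "set (take i fs @ drop (Suc i) fs) = face_mon ` ?r"
        by (simp add: fs_def take_map drop_map image_Un)
      \<comment> \<open>No edge properly contains another, so no generator is redundant.\<close>
      have "face_mon (Fs ! i) \<notin> (gen V (face_mon ` ?r) :: ('a, 'k) mpoly set)"
      proof
        assume "face_mon (Fs ! i) \<in> (gen V (face_mon ` ?r) :: ('a, 'k) mpoly set)"
        moreover have "\<And>e. e \<in> ?r \<Longrightarrow> finite e \<and> e \<subseteq> V" using rE edge by blast
        ultimately have "\<forall>m\<in>supp (face_mon (Fs ! i) :: ('a, 'k) mpoly). \<exists>e\<in>?r. e \<subseteq> supp m"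
          using gen_face_mon_iff[of ?r V "face_mon (Fs ! i) :: ('a, 'k) mpoly"] by blast
        moreover have "face_exp (Fs ! i) \<in> supp (face_mon (Fs ! i) :: ('a, 'k) mpoly)"
          by (simp add: face_mon_eq)
        ultimately obtain e where e: "e \<in> ?r" "e \<subseteq> Fs ! i"
          using edge(1)[OF Fi] supp_face_exp by metis
        then have "e = Fs ! i" using rE edge[OF Fi] edge[of e] by (intro card_subset_eq) auto
        then show False using e r by simp
      qed
      moreover have "face_mon (Fs ! i) \<in> (edge_ideal V E :: ('a, 'k) mpoly set)"
        unfolding edge_ideal_eq using Fi by (intro gen_base) auto
      moreover have "genideal (poly_ring V) (set (take i fs @ drop (Suc i) fs)) = gen V (face_mon ` ?r)"
        unfolding rs using rE pol fsE by (intro genideal_eq_gen) blast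
      ultimately show "genideal (poly_ring V) (set (take i fs @ drop (Suc i) fs)) \<noteq> edge_ideal V E" by blast
    qed (use pol in simp)
  next
    fix i assume i: "i < length fs"
    have t: "set (take i fs) = (\<lambda>c. face_mon (Fs ! c)) ` {..<i}"
      using i nth_image[of i fs] by (auto simp: fs_def lessThan_atLeast0 image_iff)
    have tp: "set (take i fs) \<subseteq> polys V" using pol set_take_subset by fast
    obtain L where L: "L \<subseteq> forms V (Suc 0)"
      "{g \<in> polys V. g * face_mon (Fs ! i) \<in> gen V ((\<lambda>c. face_mon (Fs ! c)) ` {..<i})} = (gen V L :: ('a, 'k) mpoly set)"
      using lq[of i] i by (auto simp: fs_def)
    have "L \<subseteq> polys V" using L(1) forms_polys by blast
    then show "\<exists>L\<subseteq>linear_forms V. colon_ideal V (genideal (poly_ring V) (set (take i fs))) (fs ! i) = genideal (poly_ring V) L"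
      using L i unfolding colon_ideal_def t genideal_eq_gen[OF tp[unfolded t]]
      by (intro exI[of _ L]) (simp add: genideal_eq_gen linear_forms_eq fs_def)
  qed
qed

lemma shellable_has_linear_resolution:
  assumes "edgewise_strongly_shellable V E"
  shows "has_linear_resolution V 2 (edge_ideal V E :: ('a, 'k::field) mpoly set)"
proof -
  obtain rk :: "'a \<Rightarrow> nat" where "inj_on rk V" using finite_imp_inj_to_nat_seg[OF finV] by blast
  then interpret koszul V rk using finV by unfold_locales
  obtain Fs where Fs: "distinct Fs" "set Fs = E" and lq:
    "\<And>i. i < length Fs \<Longrightarrow> \<exists>L\<subseteq>forms V (Suc 0).
      {g \<in> polys V. g * face_mon (Fs ! i) \<in> gen V ((\<lambda>c. face_mon (Fs ! c)) ` {..<i})} = (gen V L :: ('a, 'k) mpoly set)"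
    using shellable_linear_quotients[OF assms] by blast
  let ?n = "length Fs" and ?f = "\<lambda>c. face_mon (Fs ! c) :: ('a, 'k) mpoly"
  have ed: "Fs ! c \<in> E" if "c < ?n" for c using that Fs by auto
  have f: "?f c \<in> forms V 2" if "c < ?n" for c using ed[OF that] by (rule edge_forms)
  \<comment> \<open>Distinct squarefree monomials are linearly independent: the coefficient at
    \<open>face_exp (Fs ! c)\<close> isolates the entry \<open>v c\<close>.\<close>
  have "no_constants 1 ?n (\<lambda>r. ?f)"
    unfolding no_constants_def
  proof (intro allI impI)
    fix v :: "nat \<Rightarrow> ('a, 'k) mpoly" and c
    assume v: "\<forall>c<?n. v c \<in> forms V 0" "\<forall>r<1. mul ?n (\<lambda>r. ?f) v r = 0" and c: "c < ?n"
    have coef_term: "coef (?f i * v i) (face_exp (Fs ! c)) = (if i = c then coef (v c) 0 else 0)" if i: "i < ?n" for i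
    proof -
      have "v i = single 0 (coef (v i) 0)"
        by (rule forms_0_single[of _ V]) (use v i in auto)
      then have "?f i * v i = ?f i * single 0 (coef (v i) 0)" by (rule arg_cong)
      also have "\<dots> = single (face_exp (Fs ! i)) (coef (v i) 0)"
        by (simp add: face_mon_eq mult_single)
      finally have "?f i * v i = single (face_exp (Fs ! i)) (coef (v i) 0)" .
      moreover have "face_exp (Fs ! i) = face_exp (Fs ! c) \<longleftrightarrow> i = c"
        using edge(1)[OF ed[OF i]] edge(1)[OF ed[OF c]] Fs(1) i c by (simp add: face_exp_inject nth_eq_iff_index_eq)
      ultimately show ?thesis by (simp add: lookup_single when_def)
    qed
    have "0 = coef (\<Sum>i<?n. ?f i * v i) (face_exp (Fs ! c))" using v(2) by (simp add: mul_def)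
    also have "\<dots> = (\<Sum>i<?n. if i = c then coef (v c) 0 else 0)"
      unfolding lookup_sum by (rule sum.cong) (use coef_term in auto)
    also have "\<dots> = coef (v c) 0" using c by simp
    finally show "v c = 0" using forms_0_single[of "v c" V] v(1) c by simp
  qed
  moreover have "acyclic_image 1 ?n (\<lambda>r. ?f)" by (rule linear_quotients_acyclic[OF f lq])
  ultimately have "has_linear_resolution V 2 (gen V (?f ` {..<?n}))"
    by (intro acyclic_linear_resolution[OF f])
  moreover have "?f ` {..<?n} = face_mon ` E"
    using Fs(2) by (auto simp: set_conv_nth)
  ultimately show ?thesis by (simp add: edge_ideal_eq)
qed

text \<open>The ideal has no nonzero element of degree below 2, and a generator of degree above 2
  cannot help to produce the edge monomials. Minimality therefore leaves only degree 2.\<close>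

lemma linear_quotients_degree:
  fixes fs :: "('a, 'k::field) mpoly list"
  assumes "minimal_homogeneous_generators V (edge_ideal V E) fs" "f \<in> set fs"
  shows "f \<in> forms V 2"
proof -
  have pol: "set fs \<subseteq> polys V" and hom: "\<And>f. f \<in> set fs \<Longrightarrow> \<exists>d. homogeneous_of_degree d f"
    and I: "gen V (set fs) = gen V (face_mon ` E)"
    and min: "\<And>i. i < length fs \<Longrightarrow> genideal (poly_ring V) (set (take i fs @ drop (Suc i) fs)) \<noteq> gen V (face_mon ` E)"
    using assms(1) genideal_eq_gen[of "set fs" V]
    by (auto simp: minimal_homogeneous_generators_def homogeneous_generators_def edge_ideal_eq)
  obtain i where i: "i < length fs" "f = fs ! i" using assms(2) by (metis in_set_conv_nth)
  define R where "R = set (take i fs @ drop (Suc i) fs)"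
  have fsR: "set fs = insert f R"
    unfolding R_def i(2) by (subst id_take_nth_drop[OF i(1)]) auto
  have "genideal (poly_ring V) R = gen V R" using pol fsR by (intro genideal_eq_gen) auto
  then have minR: "gen V R \<noteq> gen V (face_mon ` E)" using min[OF i(1)] by (simp add: R_def)
  have notin: "\<not> face_mon ` E \<subseteq> gen V R"
  proof
    assume sub: "face_mon ` E \<subseteq> gen V R"
    have "gen V (face_mon ` E) \<subseteq> gen V R"
      by (rule subsetI, erule gen_subset) (use sub in blast)
    moreover have "gen V R \<subseteq> gen V (set fs)" using fsR gen_mono by blast
    ultimately show False using minR I by blast
  qed
  \<comment> \<open>Degrees are integers in the definition of homogeneity, and the zero polynomial
    is homogeneous of negative degrees as well; hence its separate treatment.\<close>
  have hforms: "\<exists>d. p \<in> forms V d" if p: "p \<in> set fs" for p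
  proof (cases "p = 0")
    case False
    then obtain m where m: "m \<in> supp p" by (metis ex_in_conv keys_eq_empty)
    obtain d where d: "homogeneous_of_degree d p" using hom[OF p] by blast
    then have "d = int (mon_deg m)" using m by (auto simp: homogeneous_of_degree_def)
    then show ?thesis using d p pol unfolding forms_homogeneous by blast
  qed (auto intro: forms_0)
  obtain d where d: "f \<in> forms V d" using hforms[OF assms(2)] by blast
  have "f \<noteq> 0"
  proof
    assume "f = 0"
    then have "gen V (set fs) \<subseteq> gen V R" unfolding fsR by (auto intro: gen_subset gen_base)
    then show False using notin I gen_base by blast
  qed
  then obtain m where m: "m \<in> supp f" by (metis ex_in_conv keys_eq_empty)
  have "f \<in> gen V (face_mon ` E)" using I gen_base[OF assms(2)] by blast
  then obtain e where e: "e \<in> E" "e \<subseteq> supp m" using m edge(1) by (auto simp: gen_face_mon_iff)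
  have "mon_deg m = mon_deg (face_exp e) + mon_deg (m - face_exp e)"
    by (subst face_exp_le[OF _ e(2)]) (use edge(1)[OF e(1)] in \<open>auto simp: mon_deg_add\<close>)
  then have "d \<ge> 2" using m d edge[OF e(1)] by (auto simp: mon_deg_face_exp forms_def)
  moreover have "\<not> d > 2"
  proof
    assume d2: "d > 2"
    \<comment> \<open>The component of degree 2 of a multiple of \<open>f\<close> is zero, so taking
      components removes \<open>f\<close> from any representation of an edge monomial.\<close>
    have "face_mon e' \<in> gen V R" if e': "e' \<in> E" for e'
    proof -
      have "(face_mon e' :: ('a, 'k) mpoly) \<in> gen V (face_mon ` E)" by (rule gen_base) (use e' in blast)
      then have "face_mon e' \<in> gen V (insert f R)" by (simp only: I[symmetric] fsR)
      then obtain a where a: "a \<in> polys V" "face_mon e' - f * a \<in> gen V R" by (rule gen_insertE) (rule that)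
      have "hcomp 2 (face_mon e' - f * a) \<in> gen V R"
        using hforms fsR by (intro gen_hcomp[OF a(2)]) blast
      moreover have "hcomp 2 (face_mon e' - f * a + f * a) = hcomp 2 (face_mon e' - f * a) + hcomp 2 (f * a)"
        by (rule hcomp_add)
      ultimately show ?thesis
        using hcomp_mult_forms_less[OF d a(1) d2] hcomp_same[OF edge_forms[OF e']]
        by (metis add.right_neutral diff_add_cancel)
    qed
    then show False using notin by blast
  qed
  ultimately have "d = 2" by simp
  then show ?thesis using d by simp
qed

end

section \<open>Chordless cycles of the complement\<close>

lemma cycle_edge_positions:
  assumes "distinct cs" "i < length cs" "j < length cs" "{cs ! i, cs ! j} \<in> cycle_edges cs"
  shows "j = Suc i mod length cs \<or> i = Suc j mod length cs"
proof -
  obtain k where k: "k < length cs" "{cs ! i, cs ! j} = {cs ! k, cs ! (Suc k mod length cs)}"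
    using assms(4) unfolding cycle_edges_def by blast
  have "Suc k mod length cs < length cs" by (rule mod_less_divisor) (use k(1) in linarith)
  then show ?thesis
    using k assms(1-3) by (auto simp: doubleton_eq_iff nth_eq_iff_index_eq simp del: mod_Suc)
qed

lemma card_2_subset_pair: "card e = 2 \<Longrightarrow> e \<subseteq> {a, b} \<Longrightarrow> e = {a, b}"
  by (auto simp: card_2_iff)

text \<open>On a chordless cycle in the complement with vertex set \<open>W\<close>, the squarefree monomials of degree
  \<open>\<bar>W\<bar>\<close> carry a Koszul cycle that would be a boundary only if some function on \<open>W\<close> took equal values at
  the ends of every edge of the cycle but one.\<close>
lemma (in fin_graph) acyclic_chordal:
  fixes f :: "nat \<Rightarrow> ('a, 'k::field) mpoly"
  assumes "koszul V rk"
    and f: "\<And>c. c < b \<Longrightarrow> f c \<in> forms V 2"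
    and acyc: "koszul.acyclic_image V rk 1 b (\<lambda>r. f)"
    and gen: "gen V (f ` {..<b}) = gen V (face_mon ` E)"
  shows "chordal V (complement_edges V E)"
  unfolding chordal_def
proof (intro allI impI, rule ccontr)
  interpret koszul V rk by fact
  let ?H = "complement_edges V E"
  fix cs assume cs: "graph_cycle V ?H cs \<and> 3 < length cs"
    and "\<not> (\<exists>u\<in>set cs. \<exists>v\<in>set cs. {u, v} \<in> ?H \<and> {u, v} \<notin> cycle_edges cs)"
  then have nochord: "{u, v} \<in> cycle_edges cs" if "u \<in> set cs" "v \<in> set cs" "{u, v} \<in> ?H" for u v
    using that by blast
  define W where "W = set cs"
  define m where "m = length cs"
  have m: "4 \<le> m" and dist: "distinct cs" and WV: "W \<subseteq> V" and cyc: "cycle_edges cs \<subseteq> ?H"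
    using cs by (auto simp: graph_cycle_def W_def m_def)
  have csW: "cs ! i \<in> W" if "i < m" for i using that by (simp add: W_def m_def)
  have inj: "cs ! i = cs ! j \<longleftrightarrow> i = j" if "i < m" "j < m" for i j
    using that dist by (simp add: nth_eq_iff_index_eq m_def)
  let ?a = "cs ! 0" and ?b = "cs ! 1"
  have ab: "?a \<in> W" "?b \<in> W" "?a \<noteq> ?b" using csW[of 0] csW[of 1] inj[of 0 1] m by auto
  note H = complement_edges_iff
  have succ: "{cs ! i, cs ! (Suc i mod m)} \<in> ?H" if "i < m" for i
    using that cyc unfolding cycle_edges_def m_def by blast
  \<comment> \<open>A vertex joined to both \<open>?a\<close> and \<open>?b\<close> in the
    complement would be next to both on the cycle, which is impossible with at least four vertices.
    Hence \<open>Var v * Var ?a * Var ?b\<close> lies in the edge ideal.\<close>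
  have triple: "{v, ?a} \<in> E \<or> {v, ?b} \<in> E" if v: "v \<in> W" "v \<noteq> ?a" "v \<noteq> ?b" for v
  proof (rule ccontr)
    assume none: "\<not> ?thesis"
    obtain i where i: "i < m" "v = cs ! i" using v(1) by (auto simp: W_def m_def in_set_conv_nth)
    have i2: "i \<noteq> 0" "i \<noteq> 1" using i(2) v(2,3) by metis+
    have "{v, ?a} \<in> ?H" "{v, ?b} \<in> ?H" using none v ab WV by (auto simp: H)
    then have ce: "{cs ! i, cs ! 0} \<in> cycle_edges cs" "{cs ! i, cs ! 1} \<in> cycle_edges cs"
      using nochord v(1) ab i by (auto simp: W_def)
    have len: "i < length cs" "0 < length cs" "1 < length cs" using i(1) m unfolding m_def by linarith+
    have "0 = Suc i mod m \<or> i = Suc 0 mod m" "1 = Suc i mod m \<or> i = Suc 1 mod m"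
      unfolding m_def
      by (rule cycle_edge_positions[OF dist len(1,2) ce(1)], rule cycle_edge_positions[OF dist len(1,3) ce(2)])
    then have "Suc i = m" "i = 2 \<or> 1 = Suc i mod m"
      using i(1) i2 m by (auto simp: mod_Suc split: if_splits)
    then show False using m by auto
  qed
  \<comment> \<open>The boundary of \<open>h\<close> is the required cycle: the values of
    \<open>h\<close> need not lie in the edge ideal, but each boundary term is a variable
    \<open>v\<close> times the monomial of \<open>?a\<close> and \<open>?b\<close>, which
    \<open>triple\<close> puts inside.\<close>
  define h :: "'a set \<Rightarrow> ('a, 'k) mpoly" where "h \<sigma> = (if \<sigma> = W - {?a, ?b} then face_mon {?a, ?b} else 0)" for \<sigma>
  have aV: "?a \<in> V" "?b \<in> V" using ab WV by auto
  have fm2: "(face_mon {u, v} :: ('a, 'k) mpoly) \<in> forms V (Suc (Suc 0))" if "u \<in> V" "v \<in> V" "u \<noteq> v" for u v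
    using face_mon_forms[of "{u, v}" V] that by simp
  have h: "h \<sigma> \<in> forms V (Suc (Suc 0))" for \<sigma>
    using fm2[OF aV ab(3)] by (simp add: h_def)
  have E2: "\<And>e. e \<in> E \<Longrightarrow> finite e \<and> e \<subseteq> V" using edge by blast
  have zI: "kd h \<sigma> \<in> gen V (f ` {..<b})" if s: "\<sigma> \<subseteq> V" for \<sigma>
    unfolding gen kd_def
  proof (rule gen_sum)
    fix v assume v: "v \<in> V - \<sigma>"
    have "Var v * h (insert v \<sigma>) \<in> gen V (face_mon ` E)"
    proof (cases "insert v \<sigma> = W - {?a, ?b}")
      case True
      then have vW: "v \<in> W" "v \<noteq> ?a" "v \<noteq> ?b" by auto
      have "Var v * h (insert v \<sigma>) = Var ?b * face_mon {v, ?a}"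
        "Var v * h (insert v \<sigma>) = Var ?a * face_mon {v, ?b}"
        using True ab(3) vW by (simp_all add: h_def face_mon_pair mult_ac)
      then show ?thesis
        using triple[OF vW] aV gen_base[of "face_mon {v, ?a}" "face_mon ` E" V]
          gen_base[of "face_mon {v, ?b}" "face_mon ` E" V] by (metis gen_mult image_eqI polys_Var)
    qed (simp add: h_def)
    then show "single 0 (sg v \<sigma>) * (Var v * h (insert v \<sigma>)) \<in> gen V (face_mon ` E)"
      by (rule gen_mult) simp
  qed
  have zf: "kd h \<sigma> \<in> forms V (Suc (Suc (Suc 0)))" if "\<sigma> \<subseteq> V" for \<sigma>
    by (rule kd_forms[OF h that])
  have "\<exists>w. (\<forall>c<b. w c \<in> forms V (Suc 0)) \<and> kd h \<sigma> = mul b (\<lambda>r. f) w 0" if s: "\<sigma> \<subseteq> V" for \<sigma>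
  proof -
    obtain a where a: "\<forall>c. a c \<in> polys V" "kd h \<sigma> = mul b (\<lambda>r. f) a 0"
      using gen_image_lessThan[OF zI[OF s]] unfolding mul_def by blast
    have "kd h \<sigma> = hcomp (2 + Suc 0) (mul b (\<lambda>r. f) a 0)"
      using hcomp_same[OF zf[OF s]] a(2) by (simp add: numeral_3_eq_3)
    also have "\<dots> = mul b (\<lambda>r. f) (\<lambda>c. hcomp (Suc 0) (a c)) 0"
      by (rule hcomp_mul) (use f a in auto)
    finally show ?thesis using a(1) hcomp_forms by (intro exI[of _ "\<lambda>c. hcomp (Suc 0) (a c)"]) auto
  qed
  then obtain w where w: "\<And>\<sigma> c. \<sigma> \<subseteq> V \<Longrightarrow> c < b \<Longrightarrow> w \<sigma> c \<in> forms V (Suc 0)"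
    "\<And>\<sigma>. \<sigma> \<subseteq> V \<Longrightarrow> kd h \<sigma> = mul b (\<lambda>r. f) (w \<sigma>) 0" by metis
  have dw: "kd (\<lambda>\<tau>. mul b (\<lambda>r. f) (w \<tau>) r) \<sigma> = 0" if "\<sigma> \<subseteq> V" "r < 1" for \<sigma> r
  proof -
    have "kd (\<lambda>\<tau>. mul b (\<lambda>r. f) (w \<tau>) r) \<sigma> = kd (kd h) \<sigma>"
      by (rule kd_cong[OF _ that(1)]) (use w(2) that(2) in simp)
    then show ?thesis by (simp only: kd_kd[OF that(1)])
  qed
  obtain y where y: "\<And>\<sigma> c. \<sigma> \<subseteq> V \<Longrightarrow> c < b \<Longrightarrow> y \<sigma> c \<in> forms V 0"
    "\<And>\<sigma> r. \<sigma> \<subseteq> V \<Longrightarrow> r < 1 \<Longrightarrow> mul b (\<lambda>r. f) (w \<sigma>) r = kd (\<lambda>\<tau>. mul b (\<lambda>r. f) (y \<tau>) r) \<sigma>"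
    by (rule acyclic_imageE[OF acyc, of w 0]) (use w(1) dw in auto)
  define Y where "Y \<sigma> = mul b (\<lambda>r. f) (y \<sigma>) 0" for \<sigma>
  have Yf: "Y \<sigma> \<in> forms V (Suc (Suc 0))" if "\<sigma> \<subseteq> V" for \<sigma>
  proof -
    have "Y \<sigma> \<in> forms V (2 + 0)" unfolding Y_def by (rule mul_forms) (use f y that in auto)
    then show ?thesis by (simp add: numeral_2_eq_2)
  qed
  have YI: "Y \<sigma> \<in> gen V (face_mon ` E)" if "\<sigma> \<subseteq> V" for \<sigma>
    unfolding gen[symmetric] Y_def mul_def by (rule gen_image_sum) (rule forms_polys[OF y(1)[OF that]])
  \<comment> \<open>The cycle is also the boundary of \<open>Y\<close>, which has values in the
    ideal. So \<open>h - Y\<close> is a cycle of the full Koszul complex and the boundary of some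
    \<open>u\<close>, from whose coefficients the contradiction is read off.\<close>
  have hY: "kd (\<lambda>\<tau>. h \<tau> - Y \<tau>) \<sigma> = 0" if "\<sigma> \<subseteq> V" for \<sigma>
    using w(2)[OF that] y(2)[OF that, of 0] by (simp add: kd_diff Y_def[abs_def])
  obtain u where u: "\<And>\<sigma>. \<sigma> \<subseteq> V \<Longrightarrow> kd u \<sigma> = h \<sigma> - Y \<sigma>"
    by (rule koszul_exact[of "\<lambda>\<tau>. h \<tau> - Y \<tau>" "Suc 0"]) (use h Yf hY in auto)
  let ?X = "\<lambda>v. single v (1::nat)"
  \<comment> \<open>Coefficients of \<open>u\<close> in the multidegree of \<open>W\<close>, on the
    faces with one vertex left out. The signs are adjusted so that the boundary formula becomes a
    difference \<open>U p - U q\<close> up to sign.\<close>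
  define U where "U v = sg v (W - {v}) * coef (u (W - {v})) (?X v)" for v
  have sgn0: "sg v \<sigma> \<noteq> (0 :: 'k)" for v \<sigma>
    using sg_cases[of v \<sigma>, where 'k = 'k] by auto
  \<comment> \<open>Compare coefficients at the monomial of \<open>p\<close> and \<open>q\<close> on
    the face \<open>W - {p, q}\<close>. \<open>Y\<close> contributes nothing, because the non-edge
    \<open>{p, q}\<close> gives no element of the ideal; \<open>h\<close> contributes 1 if the pair
    is \<open>{?a, ?b}\<close> and 0 otherwise.\<close>
  have Ueq: "U p = U q \<longleftrightarrow> {p, q} \<noteq> {?a, ?b}" if pq: "p \<in> W" "q \<in> W" "{p, q} \<in> ?H" for p q
  proof -
    have ne: "p \<noteq> q" and nE: "{p, q} \<notin> E" using pq(3) by (auto simp: H)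
    define \<sigma> where "\<sigma> = W - {p, q}"
    have s: "\<sigma> \<subseteq> V" "p \<in> V - \<sigma>" "q \<in> V - \<sigma>" using WV pq by (auto simp: \<sigma>_def)
    have ins: "insert p \<sigma> = W - {q}" "insert q \<sigma> = W - {p}" using pq ne by (auto simp: \<sigma>_def)
    let ?m = "?X p + ?X q"
    have face: "face_exp {p, q} = ?m" using ne by (simp add: face_exp_def)
    have cm: "coef ?m v = (if v = p \<or> v = q then 1 else 0)" for v
      using ne by (simp add: lookup_add lookup_single when_def)
    have sm: "?m - ?X p = ?X q" "?m - ?X q = ?X p" by simp_all
    have "coef (kd u \<sigma>) ?m = (\<Sum>v\<in>V - \<sigma>. (if v = p then sg p \<sigma> * coef (u (W - {q})) (?X q) else 0)
        + (if v = q then sg q \<sigma> * coef (u (W - {p})) (?X p) else 0))"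
      unfolding coef_kd cm
      by (rule sum.cong) (use ne sm ins in auto)
    also have "\<dots> = sg p \<sigma> * coef (u (W - {q})) (?X q) + sg q \<sigma> * coef (u (W - {p})) (?X p)"
      using s fin by (simp add: sum.distrib)
    also have "coef (u (W - {q})) (?X q) = sg q (W - {q}) * U q" by (simp add: U_def)
    also have "coef (u (W - {p})) (?X p) = sg p (W - {p}) * U p" by (simp add: U_def)
    also have "sg p \<sigma> * (sg q (W - {q}) * U q) + sg q \<sigma> * (sg p (W - {p}) * U p)
        = sg q \<sigma> * sg p (W - {p}) * (U p - U q)"
    proof -
      have "sg p \<sigma> * sg q (W - {q}) = - (sg q \<sigma> * sg p (W - {p}) :: 'k)"
        using sg_swap[OF s(1) s(3) s(2), where 'b = 'k] ne unfolding ins by auto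
      then have "sg p \<sigma> * (sg q (W - {q}) * U q) = - (sg q \<sigma> * sg p (W - {p}) * U q)"
        by (simp add: mult.assoc[symmetric])
      then show ?thesis by (simp add: algebra_simps)
    qed
    finally have 1: "coef (h \<sigma> - Y \<sigma>) ?m = sg q \<sigma> * sg p (W - {p}) * (U p - U q)"
      unfolding u[OF s(1)] .
    have "?m \<notin> supp (Y \<sigma>)"
    proof
      assume "?m \<in> supp (Y \<sigma>)"
      then obtain e where e: "e \<in> E" "e \<subseteq> supp ?m"
        using YI[OF s(1)] gen_face_mon_iff[of E V "Y \<sigma>"] E2 by blast
      have "supp ?m = {p, q}" unfolding face[symmetric] by (rule supp_face_exp) simp
      then have "e = {p, q}" using e edge(2)[OF e(1)] card_2_subset_pair by metis
      then show False using e(1) nE by simp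
    qed
    then have Y0: "coef (Y \<sigma>) ?m = 0" by (simp add: in_keys_iff)
    have seq: "\<sigma> = W - {?a, ?b} \<longleftrightarrow> {p, q} = {?a, ?b}"
      using pq ab unfolding \<sigma>_def by auto
    have h0: "coef (h \<sigma>) ?m = (if {p, q} = {?a, ?b} then 1 else 0)"
    proof (cases "{p, q} = {?a, ?b}")
      case True
      then have "h \<sigma> = face_mon {p, q}" using seq by (simp add: h_def)
      moreover have "coef (face_mon {p, q} :: ('a, 'k) mpoly) ?m = 1"
        unfolding face[symmetric] face_mon_eq by simp
      ultimately show ?thesis using True by simp
    next
      case False
      then show ?thesis unfolding h_def using seq by simp
    qed
    have "sg q \<sigma> * sg p (W - {p}) * (U p - U q) = (if {p, q} = {?a, ?b} then 1 else 0 :: 'k)"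
      using 1 Y0 h0 by (simp add: lookup_minus)
    then show ?thesis using sgn0 by (auto split: if_splits)
  qed
  \<comment> \<open>Following the cycle from \<open>?b\<close> to \<open>?a\<close> without the edge
    between them forces \<open>U ?a = U ?b\<close>, while that edge demands the opposite.\<close>
  have const: "U (cs ! i) = U ?b" if "1 \<le> i" "i < m" for i
    using that
  proof (induction i rule: dec_induct)
    case (step i)
    then have "{cs ! i, cs ! Suc i} \<in> ?H" using succ[of i] by simp
    moreover have "{cs ! i, cs ! Suc i} \<noteq> {?a, ?b}"
      using step inj[of "Suc i" 0] inj[of "Suc i" 1] m by (auto simp: doubleton_eq_iff)
    ultimately have "U (cs ! i) = U (cs ! Suc i)"
      using Ueq[of "cs ! i" "cs ! Suc i"] csW[of i] csW[of "Suc i"] step.prems by simp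
    then show ?case using step by simp
  qed simp
  have "U (cs ! (m - 1)) = U ?b" by (rule const) (use m in auto)
  moreover have "{cs ! (m - 1), ?a} \<in> ?H"
  proof -
    have "Suc (m - 1) mod m = 0" using m by simp
    then show ?thesis using succ[of "m - 1"] m by simp
  qed
  moreover have "{cs ! (m - 1), ?a} \<noteq> {?a, ?b}"
    using inj[of "m - 1" 0] inj[of "m - 1" 1] m by (auto simp: doubleton_eq_iff)
  ultimately have "U ?a = U ?b" using Ueq[of "cs ! (m - 1)" ?a] csW[of "m - 1"] ab m by simp
  moreover have "{?a, ?b} \<in> ?H" using succ[of 0] m by simp
  ultimately show False using Ueq[of ?a ?b] ab by simp
qed

section \<open>From linear quotients and linear resolutions to chordality\<close>

context fin_graph
begin

lemma linear_quotients_chordal: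
  assumes "has_linear_quotients V (edge_ideal V E :: ('a, 'k::field) mpoly set)"
  shows "chordal V (complement_edges V E)"
proof -
  obtain rk :: "'a \<Rightarrow> nat" where "inj_on rk V" using finite_imp_inj_to_nat_seg[OF finV] by blast
  then have K: "koszul V rk" using finV by unfold_locales
  obtain fs :: "('a, 'k) mpoly list" where fs: "minimal_homogeneous_generators V (edge_ideal V E) fs"
    and lq: "\<forall>i<length fs. \<exists>L. L \<subseteq> linear_forms V \<and>
      colon_ideal V (genideal (poly_ring V) (set (take i fs))) (fs ! i) = genideal (poly_ring V) L"
    using assms unfolding has_linear_quotients_def by blast
  have forms: "set fs \<subseteq> forms V 2" using linear_quotients_degree[OF fs] by blast
  then have "set fs \<subseteq> polys V" using forms_polys by blast
  then have "gen V (set fs) = gen V (face_mon ` E)"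
    using fs genideal_eq_gen[of "set fs" V]
    by (simp add: minimal_homogeneous_generators_def homogeneous_generators_def edge_ideal_eq)
  moreover have "(!) fs ` {..<length fs} = set fs"
    by (auto simp: set_conv_nth)
  ultimately have gen: "gen V ((!) fs ` {..<length fs}) = gen V (face_mon ` E)" by simp
  have deg: "fs ! c \<in> forms V 2" if "c < length fs" for c
    using forms nth_mem[OF that] by blast
  show ?thesis
    by (rule acyclic_chordal[OF K deg koszul.has_linear_quotients_acyclic[OF K forms lq] gen])
qed

lemma linear_resolution_chordal:
  assumes "has_linear_resolution V 2 (edge_ideal V E :: ('a, 'k::field) mpoly set)"
  shows "chordal V (complement_edges V E)"
proof -
  obtain rk :: "'a \<Rightarrow> nat" where "inj_on rk V" using finite_imp_inj_to_nat_seg[OF finV] by blast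
  then have K: "koszul V rk" using finV by unfold_locales
  obtain b and f :: "nat \<Rightarrow> ('a, 'k) mpoly" where f: "\<And>c. c < b \<Longrightarrow> f c \<in> forms V 2"
    "koszul.acyclic_image V rk 1 b (\<lambda>r. f)" "gen V (f ` {..<b}) = edge_ideal V E"
    by (rule koszul.linear_resolution_acyclic[OF K assms]) (rule that)
  show ?thesis
    by (rule acyclic_chordal[OF K f(1,2)]) (use f(3) edge_ideal_eq in auto)
qed

end

theorem theorem4p3:
  fixes V :: "'a set" and E :: "'a set set"
  assumes "simple_graph V E"
  shows "(edgewise_strongly_shellable V E \<longleftrightarrow>
            has_linear_quotients V (edge_ideal V E :: ('a, 'k::field) mpoly set)) \<and>
         (has_linear_quotients V (edge_ideal V E :: ('a, 'k) mpoly set) \<longleftrightarrow>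
            has_linear_resolution V 2 (edge_ideal V E :: ('a, 'k) mpoly set)) \<and>
         (has_linear_resolution V 2 (edge_ideal V E :: ('a, 'k) mpoly set) \<longleftrightarrow>
            chordal V (complement_edges V E)) \<and>
         (chordal V (complement_edges V E) \<longleftrightarrow>
            (\<exists>vs. perfect_elimination_ordering V (complement_edges V E) vs))"
proof -
  interpret fin_graph V E using assms by unfold_locales
  have "{u} \<notin> complement_edges V E" for u
    using complement_edges_iff[of u u V E] by simp
  then show ?thesis
    using chordal_imp_peo[OF finV, of "complement_edges V E"] peo_shellable[OF assms] shellable_has_linear_quotients shellable_has_linear_resolution
      linear_quotients_chordal linear_resolution_chordal by blast
qed

end
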